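(* Let $S$ be a string of length $n$ over an alphabet $\Sigma$, let $k$ be a positive integer and let $a,b,c\in\{0,1,\dots,k-1\}$ be pairwise different. The number of all $(a,b,c)$-partial-$k$-cadences of $S$ can be computed in $$\mathcal{O}\left(\min\left(|\Sigma|\,n(\log n)^2,\; n^{3/2}\log n\right)\right)$$ time.
   Context: A string $S=S[1]S[2]\cdots S[n]$ is a sequence of characters from $\Sigma$. For pairwise different integers $a,b,c\in\{0,\dots,k-1\}$, an $(a,b,c)$-partial-$k$-cadence of $S$ is a triple $(i,d,k)$ with positive integers $i,d$ such that $i-d\le 0$, $i+(k-1)d\le n<i+kd$ and $S[i+ad]=S[i+bd]=S[i+cd]$. Computational model: arithmetic operations on integers with $\mathcal{O}(\log n)$ bits take constant time; each character $S[j]$ can be read in constant time; characters are sufficiently small integers, so that they can be sorted. The standard fact that the acyclic convolution of two sequences of length $m$ can be computed in $\mathcal{O}(m\log m)$ operations is assumed. Constants in $\mathcal{O}$ are absolute. *)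

theory Defs
  imports Complex_Main
begin

text \<open>
  Strings are lists, but the positions of a string \<open>S\<close> are \<open>1, \<dots>, length S\<close>; hence the shift.
\<close>

definition char_at :: "'a list \<Rightarrow> nat \<Rightarrow> 'a" where
  "char_at S j = S ! (j - 1)"

definition partial_cadences :: "nat \<Rightarrow> nat \<Rightarrow> nat \<Rightarrow> nat \<Rightarrow> 'a list \<Rightarrow> (nat \<times> nat \<times> nat) set" where
  "partial_cadences a b c k S =
    {(i, d, k') | i d k'. k' = k \<and> 0 < i \<and> 0 < d \<and>
       int i - int d \<le> 0 \<and> i + (k - 1) * d \<le> length S \<and> length S < i + k * d \<and>
       char_at S (i + a * d) = char_at S (i + b * d) \<and>
       char_at S (i + b * d) = char_at S (i + c * d)}"


text \<open>
  The machine model: a random access machine, presented as a structured imperative language with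
  integer variables and integer arrays. A program mentions finitely many names, so its arrays can
  be interleaved in a single memory with constant overhead. Every operation, array access,
  assignment and test costs one unit of time.

  All semantic notions depend on a word bound \<open>B\<close>. An arithmetic operation is admitted only if
  its operands and its result are at most \<open>B\<close> in absolute value, and an array access only at an
  index between \<open>0\<close> and \<open>B\<close>; a program that violates this has no execution. Numbers that are
  part of the input can be copied and compared whatever their size.
\<close>

type_synonym name = string

record state =
  scalar :: "name \<Rightarrow> int"
  arr :: "name \<Rightarrow> nat \<Rightarrow> int"

datatype aexp =
    Const int
  | Var name
  | Read name aexp
  | Add aexp aexp
  | Sub aexp aexp
  | Mul aexp aexp
  | Div aexp aexp
  | Mod aexp aexp

datatype bexp =
    Less aexp aexp
  | Equal aexp aexp
  | Not bexp
  | And bexp bexp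

datatype com =
    Skip
  | Assign name aexp
  | Write name aexp aexp
  | Seq com com
  | If bexp com com
  | While bexp com

fun aval :: "aexp \<Rightarrow> state \<Rightarrow> int" where
  "aval (Const v) s = v"
| "aval (Var x) s = scalar s x"
| "aval (Read x e) s = arr s x (nat (aval e s))"
| "aval (Add e f) s = aval e s + aval f s"
| "aval (Sub e f) s = aval e s - aval f s"
| "aval (Mul e f) s = aval e s * aval f s"
| "aval (Div e f) s = aval e s div aval f s"
| "aval (Mod e f) s = aval e s mod aval f s"

definition fits :: "int \<Rightarrow> int \<Rightarrow> bool" where
  "fits B v \<longleftrightarrow> \<bar>v\<bar> \<le> B"

fun asafe :: "int \<Rightarrow> aexp \<Rightarrow> state \<Rightarrow> bool" where
  "asafe B (Const v) s \<longleftrightarrow> True"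
| "asafe B (Var x) s \<longleftrightarrow> True"
| "asafe B (Read x e) s \<longleftrightarrow> asafe B e s \<and> 0 \<le> aval e s \<and> fits B (aval e s)"
| "asafe B (Add e f) s \<longleftrightarrow> asafe B e s \<and> asafe B f s \<and>
     fits B (aval e s) \<and> fits B (aval f s) \<and> fits B (aval (Add e f) s)"
| "asafe B (Sub e f) s \<longleftrightarrow> asafe B e s \<and> asafe B f s \<and>
     fits B (aval e s) \<and> fits B (aval f s) \<and> fits B (aval (Sub e f) s)"
| "asafe B (Mul e f) s \<longleftrightarrow> asafe B e s \<and> asafe B f s \<and>
     fits B (aval e s) \<and> fits B (aval f s) \<and> fits B (aval (Mul e f) s)"
| "asafe B (Div e f) s \<longleftrightarrow> asafe B e s \<and> asafe B f s \<and> aval f s \<noteq> 0 \<and>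
     fits B (aval e s) \<and> fits B (aval f s) \<and> fits B (aval (Div e f) s)"
| "asafe B (Mod e f) s \<longleftrightarrow> asafe B e s \<and> asafe B f s \<and> aval f s \<noteq> 0 \<and>
     fits B (aval e s) \<and> fits B (aval f s) \<and> fits B (aval (Mod e f) s)"

fun atime :: "aexp \<Rightarrow> nat" where
  "atime (Const v) = 1"
| "atime (Var x) = 1"
| "atime (Read x e) = atime e + 1"
| "atime (Add e f) = atime e + atime f + 1"
| "atime (Sub e f) = atime e + atime f + 1"
| "atime (Mul e f) = atime e + atime f + 1"
| "atime (Div e f) = atime e + atime f + 1"
| "atime (Mod e f) = atime e + atime f + 1"

fun bval :: "bexp \<Rightarrow> state \<Rightarrow> bool" where
  "bval (Less e f) s \<longleftrightarrow> aval e s < aval f s"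
| "bval (Equal e f) s \<longleftrightarrow> aval e s = aval f s"
| "bval (Not b) s \<longleftrightarrow> \<not> bval b s"
| "bval (And b b') s \<longleftrightarrow> bval b s \<and> bval b' s"

fun bsafe :: "int \<Rightarrow> bexp \<Rightarrow> state \<Rightarrow> bool" where
  "bsafe B (Less e f) s \<longleftrightarrow> asafe B e s \<and> asafe B f s"
| "bsafe B (Equal e f) s \<longleftrightarrow> asafe B e s \<and> asafe B f s"
| "bsafe B (Not b) s \<longleftrightarrow> bsafe B b s"
| "bsafe B (And b b') s \<longleftrightarrow> bsafe B b s \<and> bsafe B b' s"

fun btime :: "bexp \<Rightarrow> nat" where
  "btime (Less e f) = atime e + atime f + 1"
| "btime (Equal e f) = atime e + atime f + 1"
| "btime (Not b) = btime b + 1"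
| "btime (And b b') = btime b + btime b' + 1"

text \<open>
  \<open>exec B p s t s'\<close>: with word bound \<open>B\<close>, program \<open>p\<close> started in state \<open>s\<close> terminates after
  exactly \<open>t\<close> units of time in state \<open>s'\<close>.
\<close>

inductive exec :: "int \<Rightarrow> com \<Rightarrow> state \<Rightarrow> nat \<Rightarrow> state \<Rightarrow> bool" for B where
  exec_Skip: "exec B Skip s 1 s"
| exec_Assign: "asafe B e s \<Longrightarrow>
    exec B (Assign x e) s (atime e + 1) (s\<lparr>scalar := (scalar s)(x := aval e s)\<rparr>)"
| exec_Write: "\<lbrakk>asafe B i s; 0 \<le> aval i s; fits B (aval i s); asafe B e s\<rbrakk> \<Longrightarrow>
    exec B (Write x i e) s (atime i + atime e + 1)
      (s\<lparr>arr := (arr s)(x := (arr s x)(nat (aval i s) := aval e s))\<rparr>)"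
| exec_Seq: "\<lbrakk>exec B p s t s'; exec B q s' t' s''\<rbrakk> \<Longrightarrow> exec B (Seq p q) s (t + t') s''"
| exec_IfTrue: "\<lbrakk>bsafe B b s; bval b s; exec B p s t s'\<rbrakk> \<Longrightarrow>
    exec B (If b p q) s (btime b + t + 1) s'"
| exec_IfFalse: "\<lbrakk>bsafe B b s; \<not> bval b s; exec B q s t s'\<rbrakk> \<Longrightarrow>
    exec B (If b p q) s (btime b + t + 1) s'"
| exec_WhileFalse: "\<lbrakk>bsafe B b s; \<not> bval b s\<rbrakk> \<Longrightarrow> exec B (While b p) s (btime b + 1) s"
| exec_WhileTrue: "\<lbrakk>bsafe B b s; bval b s; exec B p s t s'; exec B (While b p) s' t' s''\<rbrakk> \<Longrightarrow>
    exec B (While b p) s (btime b + t + t' + 1) s''"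

text \<open>
  For inputs of size \<open>n\<close> the word bound is polynomial in \<open>n\<close> with a fixed exponent, that is,
  words have \<open>O(log n)\<close> bits. The \<open>2\<close> keeps the bound nontrivial for \<open>n \<le> 1\<close>.
\<close>

definition word_bound :: "nat \<Rightarrow> nat \<Rightarrow> int" where
  "word_bound w n = (int n + 2) ^ w"


definition acyclic_convolution :: "int list \<Rightarrow> int list \<Rightarrow> nat \<Rightarrow> int" where
  "acyclic_convolution xs ys j =
     (\<Sum>i | i \<le> j \<and> i < length xs \<and> j - i < length ys. xs ! i * ys ! (j - i))"

definition convolution_input :: "int list \<Rightarrow> int list \<Rightarrow> state \<Rightarrow> bool" where
  "convolution_input xs ys s \<longleftrightarrow>
     scalar s ''m'' = int (length xs) \<and>
     (\<forall>i < length xs. arr s ''x'' i = xs ! i) \<and>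
     (\<forall>i < length ys. arr s ''y'' i = ys ! i)"

text \<open>
  The fact that two sequences of length \<open>m\<close>, with entries of \<open>O(log m)\<close> bits, can be convolved in
  time \<open>O(m log m)\<close>. As everywhere below, memory outside the input has arbitrary initial contents,
  so the program can be run repeatedly without clearing memory in between.
\<close>

definition fast_convolution :: bool where
  "fast_convolution \<longleftrightarrow>
     (\<forall>e. \<exists>p w. \<exists>K::real. \<forall>m xs ys s.
        2 \<le> m \<and> length xs = m \<and> length ys = m \<and>
        (\<forall>v \<in> set xs \<union> set ys. \<bar>v\<bar> \<le> word_bound e m) \<and> convolution_input xs ys s \<longrightarrow>
        (\<exists>t s'. exec (word_bound w m) p s t s' \<and>
           (\<forall>j < 2 * m - 1. arr s' ''z'' j = acyclic_convolution xs ys j) \<and>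
           real t \<le> K * (real m * log 2 (real m))))"

definition cadence_input :: "int list \<Rightarrow> nat \<Rightarrow> nat \<Rightarrow> nat \<Rightarrow> nat \<Rightarrow> state \<Rightarrow> bool" where
  "cadence_input S k a b c s \<longleftrightarrow>
     scalar s ''n'' = int (length S) \<and> scalar s ''k'' = int k \<and>
     scalar s ''a'' = int a \<and> scalar s ''b'' = int b \<and> scalar s ''c'' = int c \<and>
     (\<forall>j \<in> {1..length S}. arr s ''S'' j = char_at S j)"

end

theory Submission
  imports Defs
begin

text \<open>
  Sort \<open>a < b < c\<close>. A character that occurs \<open>m\<close> times is handled in time \<open>O(m\<^sup>2)\<close> by trying all
  pairs of occurrences as positions \<open>x = i + a d\<close> and \<open>z = i + c d\<close>, and in time \<open>O(n (log n)\<^sup>2)\<close> by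
  convolutions; the first way is taken if \<open>m < \<surd>n log n\<close>. Summing \<open>min(m\<^sup>2, n (log n)\<^sup>2)\<close> over the
  characters gives both bounds at once, because this minimum is at most \<open>m \<surd>n log n\<close>.

  For the convolutions, fix the residue \<open>r\<close> of \<open>x\<close> and \<open>z\<close> modulo \<open>c - a\<close>. The admissible pairs then form
  a convex quadrilateral in an integer grid of side \<open>O(n / (k (c - a)) + 1)\<close>, whose four edges are graphs of
  monotone functions. A quadtree splits this region into squares of which \<open>O(s / w)\<close> have side \<open>w\<close>, where
  \<open>s\<close> is the side of the grid, since a monotone curve crosses at most one cell of each antidiagonal.
  On a square inside the region no constraint is left, so one convolution of length \<open>(c - a) w\<close>
  counts its solutions. All sizes stay \<open>O(n)\<close> since \<open>i + a d\<close> ranges over an interval of length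
  \<open>O(n / k)\<close> only.
\<close>

section \<open>Weakest preconditions with running time\<close>

text \<open>Why a residue class is cheap: the constraints force \<open>n < (k + 1) * d\<close> and
  \<open>(k - 1) * d < n\<close>, so \<open>d\<close> takes only O(n/k^2 + 1) values, and the
  product of the number of classes, \<open>c - a\<close> and the side s is O(n). Each quadtree level
  then costs O((c - a) s log n) for its convolutions, whatever the width w, and O(log n) levels over
  all classes give O(n (log n)^2). The obstacle is that a convolution sees only the three
  characters, not the inequalities on i and d. It counts correctly only where these hold throughout,
  which forces the splitting along the boundary of the region. The machine model adds that every
  operation must respect the word bound. Hence three scales: \<open>X\<close> for positions and
  sides, \<open>N\<close> for stored numbers, and \<open>B\<close>, at least \<open>N ^ 8\<close>,
  for intermediate results. Characters may exceed all of them; they are only copied and compared,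
  and their occurrences are grouped by a comparison sort. The logarithm is replaced by an integer
  \<open>lg\<close>, and the threshold on m by comparing m^2 with n lg^2.\<close>

definition setv :: "name \<Rightarrow> int \<Rightarrow> state \<Rightarrow> state" where
  "setv x v s = s\<lparr>scalar := (scalar s)(x := v)\<rparr>"

definition seta :: "name \<Rightarrow> nat \<Rightarrow> int \<Rightarrow> state \<Rightarrow> state" where
  "seta x i v s = s\<lparr>arr := (arr s)(x := (arr s x)(i := v))\<rparr>"

lemma setv_simps [simp]:
  "scalar (setv x v s) y = (if y = x then v else scalar s y)"
  "arr (setv x v s) = arr s"
  by (auto simp: setv_def)

lemma seta_simps [simp]:
  "scalar (seta x i v s) = scalar s"
  "arr (seta x i v s) y = (if y = x then (arr s x)(i := v) else arr s y)"
  by (auto simp: seta_def)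

text \<open>The argument \<open>t\<close> is the time elapsed before the start of \<open>p\<close>.\<close>

definition wp :: "int \<Rightarrow> com \<Rightarrow> (int \<Rightarrow> state \<Rightarrow> bool) \<Rightarrow> int \<Rightarrow> state \<Rightarrow> bool" where
  "wp B p Q t s \<longleftrightarrow> (\<exists>t' s'. exec B p s t' s' \<and> Q (t + int t') s')"

text \<open>This rule keeps the simplifier out of programs and postconditions.\<close>

lemma wp_cong [cong]: "t = t' \<Longrightarrow> s = s' \<Longrightarrow> wp B p Q t s = wp B p Q t' s'"
  by simp

inductive_cases exec_SkipE: "exec B Skip s t s'"
inductive_cases exec_AssignE: "exec B (Assign x e) s t s'"
inductive_cases exec_WriteE: "exec B (Write x i e) s t s'"
inductive_cases exec_SeqE: "exec B (Seq p q) s t s'"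
inductive_cases exec_IfE: "exec B (If b p q) s t s'"

text \<open>This rule and its companions below are equivalences, because inverting
  \<open>exec\<close> determines the execution. The simplifier can thus run a loop-free program
  symbolically, its elapsed time included.\<close>

lemma wp_Skip [simp]: "wp B Skip Q t s \<longleftrightarrow> Q (t + 1) s"
  unfolding wp_def by (force elim: exec_SkipE intro: exec_Skip)

lemma wp_Assign [simp]:
  "wp B (Assign x e) Q t s \<longleftrightarrow> asafe B e s \<and> Q (t + int (atime e) + 1) (setv x (aval e s) s)"
  unfolding wp_def setv_def
  by (force elim!: exec_AssignE intro: exec_Assign simp: ac_simps)

lemma wp_Write [simp]:
  "wp B (Write x i e) Q t s \<longleftrightarrow> asafe B (Read x i) s \<and> asafe B e s \<and>
     Q (t + int (atime i) + int (atime e) + 1) (seta x (nat (aval i s)) (aval e s) s)"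
  unfolding wp_def seta_def
  by (force elim!: exec_WriteE intro: exec_Write simp: ac_simps)

lemma wp_Seq [simp]: "wp B (Seq p q) Q t s \<longleftrightarrow> wp B p (wp B q Q) t s"
  unfolding wp_def
  by (force elim!: exec_SeqE intro: exec_Seq simp: ac_simps)

lemma wp_If [simp]:
  "wp B (If b p q) Q t s \<longleftrightarrow> bsafe B b s \<and>
     (if bval b s then wp B p Q (t + int (btime b) + 1) s else wp B q Q (t + int (btime b) + 1) s)"
proof
  assume "wp B (If b p q) Q t s"
  then obtain t' s' where e: "exec B (If b p q) s t' s'" and Q: "Q (t + int t') s'"
    unfolding wp_def by blast
  show "bsafe B b s \<and> (if bval b s then wp B p Q (t + int (btime b) + 1) s
      else wp B q Q (t + int (btime b) + 1) s)"
    using e Q unfolding wp_def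
    by (elim exec_IfE) (auto simp: ac_simps intro!: exI)
next
  assume *: "bsafe B b s \<and> (if bval b s then wp B p Q (t + int (btime b) + 1) s
      else wp B q Q (t + int (btime b) + 1) s)"
  show "wp B (If b p q) Q t s"
  proof (cases "bval b s")
    case True
    then obtain t' s' where "exec B p s t' s'" "Q (t + int (btime b) + 1 + int t') s'"
      using * unfolding wp_def by auto
    then have "exec B (If b p q) s (btime b + t' + 1) s'" "Q (t + int (btime b + t' + 1)) s'"
      using * True exec_IfTrue by (auto simp: ac_simps)
    then show ?thesis unfolding wp_def by blast
  next
    case False
    then obtain t' s' where "exec B q s t' s'" "Q (t + int (btime b) + 1 + int t') s'"
      using * unfolding wp_def by auto
    then have "exec B (If b p q) s (btime b + t' + 1) s'" "Q (t + int (btime b + t' + 1)) s'"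
      using * False exec_IfFalse by (auto simp: ac_simps)
    then show ?thesis unfolding wp_def by blast
  qed
qed

section \<open>Frame conditions and loop rules\<close>

fun svars :: "com \<Rightarrow> name set" where
  "svars Skip = {}"
| "svars (Assign x e) = {x}"
| "svars (Write x i e) = {}"
| "svars (Seq p q) = svars p \<union> svars q"
| "svars (If b p q) = svars p \<union> svars q"
| "svars (While b p) = svars p"

fun avars :: "com \<Rightarrow> name set" where
  "avars Skip = {}"
| "avars (Assign x e) = {}"
| "avars (Write x i e) = {x}"
| "avars (Seq p q) = avars p \<union> avars q"
| "avars (If b p q) = avars p \<union> avars q"
| "avars (While b p) = avars p"

text \<open>\<open>X\<close> and \<open>Y\<close> list the names that may have changed. Since
  \<open>exec_same\<close> fills them with the names assigned in the program, everything else
  survives a run without being mentioned in an invariant.\<close>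

definition same :: "name set \<Rightarrow> name set \<Rightarrow> state \<Rightarrow> state \<Rightarrow> bool" where
  "same X Y s s' \<longleftrightarrow> (\<forall>x. x \<notin> X \<longrightarrow> scalar s' x = scalar s x) \<and> (\<forall>x. x \<notin> Y \<longrightarrow> arr s' x = arr s x)"

lemma same_scalar: "same X Y s s' \<Longrightarrow> x \<notin> X \<Longrightarrow> scalar s' x = scalar s x"
  and same_arr: "same X Y s s' \<Longrightarrow> y \<notin> Y \<Longrightarrow> arr s' y = arr s y"
  by (auto simp: same_def)

lemma same_refl: "same X Y s s"
  by (simp add: same_def)

lemma same_trans: "same X Y s s' \<Longrightarrow> same X Y s' s'' \<Longrightarrow> same X Y s s''"
  by (auto simp: same_def)

lemma exec_same: "exec B p s t s' \<Longrightarrow> same (svars p) (avars p) s s'"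
  by (induction rule: exec.induct) (auto simp: same_def)

lemma wp_conseq:
  assumes "wp B p Q t s"
    and "\<And>t' s'. Q t' s' \<Longrightarrow> same (svars p) (avars p) s s' \<Longrightarrow> Q' t' s'"
  shows "wp B p Q' t s"
  using assms exec_same unfolding wp_def by blast

text \<open>The ghost value \<open>g\<close> carries the abstract state of the loop (a counter, a
  stack, a block boundary), and termination is measured on it alone. The invariant sees the elapsed
  time, so running time and correctness are proved together.\<close>

lemma wp_While:
  fixes f :: "'g \<Rightarrow> nat"
  assumes "I g t s"
    and safe: "\<And>g t s'. I g t s' \<Longrightarrow> same (svars p) (avars p) s s' \<Longrightarrow> bsafe B b s'"
    and step: "\<And>g t s'. I g t s' \<Longrightarrow> same (svars p) (avars p) s s' \<Longrightarrow> bval b s' \<Longrightarrow>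
      wp B p (\<lambda>t'' s''. \<exists>g'. I g' t'' s'' \<and> f g' < f g) (t + int (btime b) + 1) s'"
    and exit: "\<And>g t s'. I g t s' \<Longrightarrow> same (svars p) (avars p) s s' \<Longrightarrow> \<not> bval b s' \<Longrightarrow>
      Q (t + int (btime b) + 1) s'"
  shows "wp B (While b p) Q t s"
proof -
  have "I g t s' \<Longrightarrow> same (svars p) (avars p) s s' \<Longrightarrow> wp B (While b p) Q t s'" for g t s'
  proof (induction "f g" arbitrary: g t s' rule: less_induct)
    case less
    show ?case
    proof (cases "bval b s'")
      case True
      obtain t1 s1 g1 where 1: "exec B p s' t1 s1" "I g1 (t + int (btime b) + 1 + int t1) s1"
          "f g1 < f g"
        using step[OF less.prems True] unfolding wp_def by blast
      have "same (svars p) (avars p) s s1"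
        using same_trans[OF less.prems(2) exec_same[OF 1(1)]] .
      from less.hyps[OF 1(3,2) this] obtain t2 s2 where
        2: "exec B (While b p) s1 t2 s2" "Q (t + int (btime b) + 1 + int t1 + int t2) s2"
        unfolding wp_def by blast
      have "exec B (While b p) s' (btime b + t1 + t2 + 1) s2"
        using exec_WhileTrue[OF safe[OF less.prems] True 1(1) 2(1)] .
      moreover have "Q (t + int (btime b + t1 + t2 + 1)) s2"
        using 2(2) by (simp add: ac_simps)
      ultimately show ?thesis unfolding wp_def by blast
    next
      case False
      have "exec B (While b p) s' (btime b + 1) s'"
        using exec_WhileFalse[OF safe[OF less.prems] False] .
      moreover have "Q (t + int (btime b + 1)) s'"
        using exit[OF less.prems False] by (simp add: ac_simps)
      ultimately show ?thesis unfolding wp_def by blast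
    qed
  qed
  with assms(1) show ?thesis by (simp add: same_refl)
qed

notation Seq (infixr ";;" 60)
notation Assign (infix "::=" 62)
notation Add (infixl "\<oplus>" 65)
notation Sub (infixl "\<ominus>" 65)
notation Mul (infixl "\<otimes>" 70)

definition For :: "name \<Rightarrow> aexp \<Rightarrow> aexp \<Rightarrow> com \<Rightarrow> com" where
  "For x e f p = (x ::= e;; While (Less (Var x) f) (p;; x ::= Var x \<oplus> Const 1))"

lemma svars_For [simp]: "svars (For x e f p) = insert x (svars p)"
  and avars_For [simp]: "avars (For x e f p) = avars p"
  by (auto simp: For_def)

lemma wp_For:
  fixes lo hi T :: int
  assumes e: "asafe B e s" "aval e s = lo" and lohi: "0 \<le> lo" "lo \<le> hi" "hi \<le> B" "1 \<le> B"
    and start: "I lo (setv x lo s)"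
    and f: "\<And>i s'. I i s' \<Longrightarrow> same (insert x (svars p)) (avars p) s s' \<Longrightarrow>
      asafe B f s' \<and> aval f s' = hi"
    and step: "\<And>i t s'. I i s' \<Longrightarrow> same (insert x (svars p)) (avars p) s s' \<Longrightarrow> scalar s' x = i \<Longrightarrow>
      lo \<le> i \<Longrightarrow> i < hi \<Longrightarrow>
      wp B p (\<lambda>t' s''. scalar s'' x = i \<and> I (i + 1) (setv x (i + 1) s'') \<and> t' \<le> t + T) t s'"
    and exit: "\<And>t' s'. I hi s' \<Longrightarrow> same (insert x (svars p)) (avars p) s s' \<Longrightarrow> scalar s' x = hi \<Longrightarrow>
      t' \<le> t + (hi - lo) * (T + int (atime f) + 7) + int (atime e) + int (atime f) + 4 \<Longrightarrow> Q t' s'"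
  shows "wp B (For x e f p) Q t s"
proof -
  \<comment> \<open>Per iteration the test costs \<open>atime f + 3\<close> and the increment 4, on
    top of the body's \<open>T\<close>.\<close>
  let ?T = "T + int (atime f) + 7"
  let ?t = "t + int (atime e) + 1"
  let ?I = "\<lambda>i t' s'. scalar s' x = i \<and> lo \<le> i \<and> i \<le> hi \<and> I i s' \<and> t' \<le> ?t + (i - lo) * ?T"
  let ?X = "insert x (svars p)"
  have same': "same ?X (avars p) s s'" if "same ?X (avars p) (setv x lo s) s'" for s'
    using that by (auto simp: same_def)
  have "wp B (While (Less (Var x) f) (p;; x ::= Var x \<oplus> Const 1)) Q ?t (setv x lo s)"
  proof (rule wp_While[where I = "?I" and f = "\<lambda>i. nat (hi - i)"])
    show "?I lo ?t (setv x lo s)" using start lohi by simp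
  next
    fix i t' s' assume "?I i t' s'" and "same (svars (p;; x ::= Var x \<oplus> Const 1))
      (avars (p;; x ::= Var x \<oplus> Const 1)) (setv x lo s) s'"
    then show "bsafe B (Less (Var x) f) s'"
      using f same' by auto
  next
    fix i t' s' assume I: "?I i t' s'" and sm: "same (svars (p;; x ::= Var x \<oplus> Const 1))
      (avars (p;; x ::= Var x \<oplus> Const 1)) (setv x lo s) s'" and b: "bval (Less (Var x) f) s'"
    from I have i: "scalar s' x = i" "lo \<le> i" "i \<le> hi" "I i s'" "t' \<le> ?t + (i - lo) * ?T"
      by auto
    have sm': "same ?X (avars p) s s'" using sm same' by simp
    have ih: "i < hi" using f[OF i(4) sm'] b i(1) by simp
    show "wp B (p;; x ::= Var x \<oplus> Const 1) (\<lambda>t'' s''. \<exists>i'. ?I i' t'' s'' \<and>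
       nat (hi - i') < nat (hi - i)) (t' + int (btime (Less (Var x) f)) + 1) s'"
      unfolding wp_Seq
    proof (rule wp_conseq[OF step[OF i(4) sm' i(1,2) ih]])
      fix t'' s''
      assume *: "scalar s'' x = i \<and> I (i + 1) (setv x (i + 1) s'') \<and>
          t'' \<le> t' + int (btime (Less (Var x) f)) + 1 + T"
      have "t'' + 4 \<le> ?t + (i + 1 - lo) * ?T"
        using * i(5) by (simp add: algebra_simps)
      then show "wp B (x ::= Var x \<oplus> Const 1) (\<lambda>t'' s''. \<exists>i'. ?I i' t'' s'' \<and>
         nat (hi - i') < nat (hi - i)) t'' s''"
        using * i ih lohi by (simp add: fits_def)
    qed
  next
    fix i t' s' assume I: "?I i t' s'" and sm: "same (svars (p;; x ::= Var x \<oplus> Const 1))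
      (avars (p;; x ::= Var x \<oplus> Const 1)) (setv x lo s) s'" and b: "\<not> bval (Less (Var x) f) s'"
    from I have i: "scalar s' x = i" "lo \<le> i" "i \<le> hi" "I i s'" "t' \<le> ?t + (i - lo) * ?T"
      by auto
    have sm': "same ?X (avars p) s s'" using sm same' by simp
    have ih: "i = hi" using f[OF i(4) sm'] b i(1,3) by simp
    show "Q (t' + int (btime (Less (Var x) f)) + 1) s'"
      using i ih sm' by (intro exit) auto
  qed
  then show ?thesis
    using e unfolding For_def by simp
qed


section \<open>Renaming the variables of a program\<close>

text \<open>
  The assumed convolution program may use any names. Prefixing all of them with an underscore
  keeps it from interfering with the variables of the algorithm.
\<close>

fun aprime :: "aexp \<Rightarrow> aexp" where
  "aprime (Const v) = Const v"
| "aprime (Var x) = Var (CHR ''_'' # x)"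
| "aprime (Read x e) = Read (CHR ''_'' # x) (aprime e)"
| "aprime (Add e f) = Add (aprime e) (aprime f)"
| "aprime (Sub e f) = Sub (aprime e) (aprime f)"
| "aprime (Mul e f) = Mul (aprime e) (aprime f)"
| "aprime (Div e f) = Div (aprime e) (aprime f)"
| "aprime (Mod e f) = Mod (aprime e) (aprime f)"

fun bprime :: "bexp \<Rightarrow> bexp" where
  "bprime (Less e f) = Less (aprime e) (aprime f)"
| "bprime (Equal e f) = Equal (aprime e) (aprime f)"
| "bprime (Not b) = Not (bprime b)"
| "bprime (And b b') = And (bprime b) (bprime b')"

fun cprime :: "com \<Rightarrow> com" where
  "cprime Skip = Skip"
| "cprime (Assign x e) = Assign (CHR ''_'' # x) (aprime e)"
| "cprime (Write x i e) = Write (CHR ''_'' # x) (aprime i) (aprime e)"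
| "cprime (Seq p q) = Seq (cprime p) (cprime q)"
| "cprime (If b p q) = If (bprime b) (cprime p) (cprime q)"
| "cprime (While b p) = While (bprime b) (cprime p)"

definition unprime :: "state \<Rightarrow> state" where
  "unprime s = \<lparr>scalar = (\<lambda>x. scalar s (CHR ''_'' # x)), arr = (\<lambda>x. arr s (CHR ''_'' # x))\<rparr>"

lemma unprime_simps [simp]:
  "scalar (unprime s) x = scalar s (CHR ''_'' # x)"
  "arr (unprime s) x = arr s (CHR ''_'' # x)"
  by (auto simp: unprime_def)

lemma aval_aprime [simp]: "aval (aprime e) s = aval e (unprime s)"
  by (induction e) auto

lemma asafe_aprime [simp]: "asafe B (aprime e) s = asafe B e (unprime s)"
  by (induction e) auto

lemma atime_aprime [simp]: "atime (aprime e) = atime e"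
  by (induction e) auto

lemma bval_bprime [simp]: "bval (bprime b) s = bval b (unprime s)"
  by (induction b) auto

lemma bsafe_bprime [simp]: "bsafe B (bprime b) s = bsafe B b (unprime s)"
  by (induction b) auto

lemma btime_bprime [simp]: "btime (bprime b) = btime b"
  by (induction b) auto

lemma exec_cprime:
  "exec B p r t r' \<Longrightarrow> r = unprime s \<Longrightarrow> \<exists>s'. exec B (cprime p) s t s' \<and> r' = unprime s'"
proof (induction arbitrary: s rule: exec.induct)
  case (exec_Skip r)
  then show ?case using exec.exec_Skip by fastforce
next
  case (exec_Assign e r x)
  then have "exec B (cprime (Assign x e)) s (atime e + 1)
      (s\<lparr>scalar := (scalar s)(CHR ''_'' # x := aval e (unprime s))\<rparr>)"
    using exec.exec_Assign[of B "aprime e" s "CHR ''_'' # x"] by simp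
  moreover have "r\<lparr>scalar := (scalar r)(x := aval e r)\<rparr> =
      unprime (s\<lparr>scalar := (scalar s)(CHR ''_'' # x := aval e (unprime s))\<rparr>)"
    using exec_Assign by (auto simp: unprime_def)
  ultimately show ?case by blast
next
  case (exec_Write i r e x)
  then have "exec B (cprime (Write x i e)) s (atime i + atime e + 1)
      (s\<lparr>arr := (arr s)(CHR ''_'' # x :=
        (arr s (CHR ''_'' # x))(nat (aval i (unprime s)) := aval e (unprime s)))\<rparr>)"
    using exec.exec_Write[of B "aprime i" s "aprime e" "CHR ''_'' # x"] by simp
  moreover have "r\<lparr>arr := (arr r)(x := (arr r x)(nat (aval i r) := aval e r))\<rparr> =
      unprime (s\<lparr>arr := (arr s)(CHR ''_'' # x :=
        (arr s (CHR ''_'' # x))(nat (aval i (unprime s)) := aval e (unprime s)))\<rparr>)"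
    using exec_Write by (auto simp: unprime_def)
  ultimately show ?case by blast
next
  case (exec_Seq p r t r' q t' r'')
  then show ?case by (metis cprime.simps(4) exec.exec_Seq)
next
  case (exec_IfTrue b r p t r' q)
  then show ?case by (metis cprime.simps(5) exec.exec_IfTrue bval_bprime bsafe_bprime btime_bprime)
next
  case (exec_IfFalse b r q t r' p)
  then show ?case by (metis cprime.simps(5) exec.exec_IfFalse bval_bprime bsafe_bprime btime_bprime)
next
  case (exec_WhileFalse b r p)
  then show ?case by (metis cprime.simps(6) exec.exec_WhileFalse bval_bprime bsafe_bprime btime_bprime)
next
  case (exec_WhileTrue b r p t r' t' r'')
  then show ?case by (metis cprime.simps(6) exec.exec_WhileTrue bval_bprime bsafe_bprime btime_bprime)
qed

lemma asafe_mono: "asafe B e s \<Longrightarrow> B \<le> B' \<Longrightarrow> asafe B' e s"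
  by (induction e) (auto simp: fits_def)

lemma bsafe_mono: "bsafe B b s \<Longrightarrow> B \<le> B' \<Longrightarrow> bsafe B' b s"
  by (induction b) (auto intro: asafe_mono)

lemma exec_mono: "exec B p s t s' \<Longrightarrow> B \<le> B' \<Longrightarrow> exec B' p s t s'"
proof (induction rule: exec.induct)
  case (exec_Write i s e x)
  then show ?case
    by (intro exec.exec_Write) (auto intro: asafe_mono simp: fits_def)
qed (blast intro: exec.intros asafe_mono bsafe_mono)+

lemma svars_cprime: "svars (cprime p) \<subseteq> range (Cons (CHR ''_''))"
  and avars_cprime: "avars (cprime p) \<subseteq> range (Cons (CHR ''_''))"
  by (induction p) auto

text \<open>The form in which the assumption is used. The inputs are indicator sequences, so the
  entry exponent 0, with bound 1, is enough; any power of two that is at least \<open>m\<close> may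
  stand for its logarithm; the real factor is rounded up so that times stay in
  \<open>int\<close>.\<close>

lemma fast_convolution_prime:
  assumes "fast_convolution"
  obtains p w C where
    "svars p \<subseteq> range (Cons (CHR ''_''))" "avars p \<subseteq> range (Cons (CHR ''_''))" "0 \<le> C"
    "\<And>B (m::nat) lg xs ys s t. 2 \<le> m \<Longrightarrow> (int m + 2) ^ w \<le> B \<Longrightarrow> real m \<le> 2 ^ lg \<Longrightarrow>
      length xs = m \<Longrightarrow> length ys = m \<Longrightarrow> set xs \<subseteq> {0, 1} \<Longrightarrow> set ys \<subseteq> {0, 1} \<Longrightarrow>
      scalar s ''_m'' = int m \<Longrightarrow> \<forall>i<m. arr s ''_x'' i = xs ! i \<Longrightarrow>
      \<forall>i<m. arr s ''_y'' i = ys ! i \<Longrightarrow>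
      wp B p (\<lambda>t' s'. t' \<le> t + C * (int m * int lg) \<and>
        (\<forall>j<m. arr s' ''_z'' j = acyclic_convolution xs ys j)) t s"
proof -
  from assms[unfolded fast_convolution_def, THEN spec[of _ 0]]
  obtain p w and K :: real where p: "\<And>m xs ys s. 2 \<le> m \<and> length xs = m \<and> length ys = m \<and>
        (\<forall>v \<in> set xs \<union> set ys. \<bar>v\<bar> \<le> word_bound 0 m) \<and> convolution_input xs ys s \<Longrightarrow>
        \<exists>t s'. exec (word_bound w m) p s t s' \<and>
           (\<forall>j < 2 * m - 1. arr s' ''z'' j = acyclic_convolution xs ys j) \<and>
           real t \<le> K * (real m * log 2 (real m))"
    by (elim exE) (rule that, blast)
  define C where "C = \<lceil>\<bar>K\<bar>\<rceil>"
  show ?thesis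
  proof (rule that[of "cprime p" C w])
    fix B :: int and m lg :: nat and xs ys :: "int list" and s :: state and t :: int
    assume a: "2 \<le> m" "(int m + 2) ^ w \<le> B" "real m \<le> 2 ^ lg" "length xs = m" "length ys = m"
      "set xs \<subseteq> {0, 1}" "set ys \<subseteq> {0, 1}" "scalar s ''_m'' = int m"
      "\<forall>i<m. arr s ''_x'' i = xs ! i" "\<forall>i<m. arr s ''_y'' i = ys ! i"
    have "\<bar>v\<bar> \<le> 1" if "v \<in> set xs \<union> set ys" for v
    proof -
      have "v \<in> {0, 1}" using that a(6,7) by blast
      then show ?thesis by auto
    qed
    then have "\<forall>v \<in> set xs \<union> set ys. \<bar>v\<bar> \<le> word_bound 0 m"
      by (simp add: word_bound_def)
    moreover have "convolution_input xs ys (unprime s)"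
      using a(4,5,8-) by (simp add: convolution_input_def)
    ultimately obtain t1 s1 where 1: "exec (word_bound w m) p (unprime s) t1 s1"
      "\<forall>j < 2 * m - 1. arr s1 ''z'' j = acyclic_convolution xs ys j"
      "real t1 \<le> K * (real m * log 2 (real m))"
      using p[of m xs ys "unprime s"] a(1,4,5) by blast
    from exec_cprime[OF 1(1) refl] obtain s2 where
      2: "exec (word_bound w m) (cprime p) s t1 s2" "s1 = unprime s2" by blast
    have 3: "exec B (cprime p) s t1 s2"
      using exec_mono[OF 2(1)] a(2) by (simp add: word_bound_def)
    have lg: "0 \<le> log 2 (real m)" "log 2 (real m) \<le> real lg"
      using a(1,3) by (auto simp: le_log_iff log_le_iff powr_realpow)
    have "real t1 \<le> K * (real m * log 2 (real m))" using 1(3) .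
    also have "\<dots> \<le> real_of_int C * (real m * real lg)"
      using lg unfolding C_def by (intro mult_mono mult_nonneg_nonneg) linarith+
    finally have "real_of_int (int t1) \<le> real_of_int (C * (int m * int lg))" by simp
    then have "int t1 \<le> C * (int m * int lg)" by linarith
    moreover have "\<forall>j<m. arr s2 ''_z'' j = acyclic_convolution xs ys j"
      using 1(2) 2(2) a(1) by auto
    ultimately show "wp B (cprime p) (\<lambda>t' s'. t' \<le> t + C * (int m * int lg) \<and>
        (\<forall>j<m. arr s' ''_z'' j = acyclic_convolution xs ys j)) t s"
      using 3 unfolding wp_def by (intro exI[of _ t1] exI[of _ s2]) simp
  qed (use svars_cprime avars_cprime C_def in auto)
qed


section \<open>Arithmetic within the word bound\<close>

text \<open>An exponent for the size of the value: if all leaves are at most \<open>N\<close> in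
  absolute value, the value is at most \<open>N ^ adeg e\<close>. A sum takes one more factor
  \<open>N\<close>, which covers the doubling because \<open>2 \<le> N\<close>.\<close>

fun adeg :: "aexp \<Rightarrow> nat" where
  "adeg (Const v) = 1"
| "adeg (Var x) = 1"
| "adeg (Read x e) = 1"
| "adeg (Add e f) = max (adeg e) (adeg f) + 1"
| "adeg (Sub e f) = max (adeg e) (adeg f) + 1"
| "adeg (Mul e f) = adeg e + adeg f"
| "adeg (Div e f) = max (adeg e) (adeg f)"
| "adeg (Mod e f) = max (adeg e) (adeg f)"

lemma abs_div_int_le: "\<bar>x div y\<bar> \<le> \<bar>x\<bar>" if "y \<noteq> 0" for x y :: int
proof -
  have pos: "\<bar>x div y\<bar> \<le> \<bar>x\<bar>" if "0 < y" for x y :: int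
  proof -
    define q where "q = x div y"
    have x: "y * (q) \<le> x" "x < y * (q + 1)"
      using that pos_mod_bound[of y x] pos_mod_sign[of y x] mult_div_mod_eq[where a = x and b = y]
      unfolding distrib_left q_def by linarith+
    show ?thesis
      unfolding q_def[symmetric]
    proof (cases "0 \<le> q")
      case True
      then have "1 * (q) \<le> y * (q)" using that by (intro mult_right_mono) auto
      then show "\<bar>q\<bar> \<le> \<bar>x\<bar>" using x True by linarith
    next
      case False
      note x(2)
      also have "y * (q + 1) \<le> 1 * (q + 1)"
        using False that by (intro mult_right_mono_neg) auto
      finally have "x < q + 1" by simp
      then show "\<bar>q\<bar> \<le> \<bar>x\<bar>" using False by linarith
    qed
  qed
  show ?thesis
  proof (cases "0 < y")
    case False
    then show ?thesis using that pos[of "- y" "- x"] by simp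
  qed (use pos in blast)
qed

text \<open>\<open>N\<close> bounds the stored numbers that enter arithmetic, \<open>B\<close>
  whatever arises while an expression is evaluated. Safety of an expression then reduces to bounds
  on its leaves and a count of degrees.\<close>

locale word_bounds =
  fixes B N :: int
  assumes N2: "2 \<le> N" and NB: "N ^ 8 \<le> B"
begin

fun ok :: "state \<Rightarrow> aexp \<Rightarrow> bool" where
  "ok s (Const v) \<longleftrightarrow> \<bar>v\<bar> \<le> N"
| "ok s (Var x) \<longleftrightarrow> \<bar>scalar s x\<bar> \<le> N"
| "ok s (Read x e) \<longleftrightarrow> ok s e \<and> adeg e \<le> 8 \<and> 0 \<le> aval e s \<and> \<bar>arr s x (nat (aval e s))\<bar> \<le> N"
| "ok s (Add e f) \<longleftrightarrow> ok s e \<and> ok s f"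
| "ok s (Sub e f) \<longleftrightarrow> ok s e \<and> ok s f"
| "ok s (Mul e f) \<longleftrightarrow> ok s e \<and> ok s f"
| "ok s (Div e f) \<longleftrightarrow> ok s e \<and> ok s f \<and> aval f s \<noteq> 0"
| "ok s (Mod e f) \<longleftrightarrow> ok s e \<and> ok s f \<and> aval f s \<noteq> 0"

lemma pow_mono: "i \<le> j \<Longrightarrow> N ^ i \<le> N ^ j"
  using N2 by (intro power_increasing) auto

lemma ok_bound: "ok s e \<Longrightarrow> \<bar>aval e s\<bar> \<le> N ^ adeg e"
proof (induction e)
  case (Add e f)
  let ?m = "max (adeg e) (adeg f)"
  have "\<bar>aval e s\<bar> \<le> N ^ ?m" "\<bar>aval f s\<bar> \<le> N ^ ?m"
    using Add pow_mono[of "adeg e" ?m] pow_mono[of "adeg f" ?m] by force+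
  moreover have "2 * N ^ ?m \<le> N * N ^ ?m" using N2 by (intro mult_right_mono) auto
  ultimately show ?case by simp
next
  case (Sub e f)
  let ?m = "max (adeg e) (adeg f)"
  have "\<bar>aval e s\<bar> \<le> N ^ ?m" "\<bar>aval f s\<bar> \<le> N ^ ?m"
    using Sub pow_mono[of "adeg e" ?m] pow_mono[of "adeg f" ?m] by force+
  moreover have "2 * N ^ ?m \<le> N * N ^ ?m" using N2 by (intro mult_right_mono) auto
  ultimately show ?case by simp
next
  case (Mul e f)
  then have "\<bar>aval e s\<bar> * \<bar>aval f s\<bar> \<le> N ^ adeg e * N ^ adeg f"
    using N2 by (intro mult_mono) auto
  then show ?case by (simp add: abs_mult power_add)
next
  case (Div e f)
  have "\<bar>aval e s div aval f s\<bar> \<le> \<bar>aval e s\<bar>"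
    using Div.prems by (intro abs_div_int_le) auto
  then show ?case using Div pow_mono[of "adeg e" "max (adeg e) (adeg f)"] by force
next
  case (Mod e f)
  have "\<bar>aval e s mod aval f s\<bar> \<le> \<bar>aval f s\<bar>"
    using Mod.prems abs_mod_less[of "aval f s" "aval e s"] by auto
  then show ?case using Mod pow_mono[of "adeg f" "max (adeg e) (adeg f)"] by force
qed (use N2 in auto)

lemma ok_fits: "ok s e \<Longrightarrow> adeg e \<le> 8 \<Longrightarrow> fits B (aval e s)"
  unfolding fits_def using ok_bound[of s e] pow_mono[of "adeg e" 8] NB by linarith

lemma asafe_ok: "ok s e \<Longrightarrow> adeg e \<le> 8 \<Longrightarrow> asafe B e s"
proof (induction e)
  case (Add e f)
  then show ?case using ok_fits[of s e] ok_fits[of s f] ok_fits[of s "Add e f"] by simp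
next
  case (Sub e f)
  then show ?case using ok_fits[of s e] ok_fits[of s f] ok_fits[of s "Sub e f"] by simp
next
  case (Mul e f)
  then show ?case using ok_fits[of s e] ok_fits[of s f] ok_fits[of s "Mul e f"] by simp
next
  case (Div e f)
  then show ?case using ok_fits[of s e] ok_fits[of s f] ok_fits[of s "Div e f"] by simp
next
  case (Mod e f)
  then show ?case using ok_fits[of s e] ok_fits[of s f] ok_fits[of s "Mod e f"] by simp
next
  case (Read x e)
  then show ?case using ok_fits[of s e] by simp
qed auto

lemma asafe_Read_ok: "ok s e \<Longrightarrow> adeg e \<le> 8 \<Longrightarrow> 0 \<le> aval e s \<Longrightarrow> asafe B (Read x e) s"
  using asafe_ok[of s e] ok_fits[of s e] by simp

lemma B_bounds: "1 \<le> B" "N \<le> B"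
  using N2 NB pow_mono[of 1 8] by simp_all

end


section \<open>Counting with a convolution\<close>

text \<open>Each entry of an indicator sequence is a sum over \<open>u\<close>, since
  \<open>al * u = j\<close> has at most one solution; the convolution then expands into a sum over
  pairs. Spreading the sequences by the factors \<open>al\<close> and \<open>be\<close> makes an
  ordinary convolution count a weighted sum of indices.\<close>

lemma acyclic_convolution_of_bool:
  fixes al be W m :: nat
  assumes "0 < al" "0 < be" "j < m"
  shows "acyclic_convolution (map (\<lambda>j. of_bool (\<exists>u<W. al * u = j \<and> P u)) [0..<m])
      (map (\<lambda>j. of_bool (\<exists>v<W. be * v = j \<and> Q v)) [0..<m]) j =
    (\<Sum>u<W. \<Sum>v<W. of_bool (P u \<and> Q v \<and> al * u + be * v = j))"
proof -
  have single: "of_bool (\<exists>u<W. g * u = i \<and> R u) = (\<Sum>u<W. of_bool (g * u = i \<and> R u) :: int)"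
    if "0 < g" for g i :: nat and R
  proof (cases "\<exists>u<W. g * u = i \<and> R u")
    case True
    then obtain u where u: "u < W" "g * u = i" "R u" by blast
    have "(\<Sum>u'<W. of_bool (g * u' = i \<and> R u') :: int) = (\<Sum>u'<W. if u' = u then 1 else 0)"
      using u that by (intro sum.cong) auto
    then show ?thesis using u True by simp
  qed auto
  have "acyclic_convolution (map (\<lambda>j. of_bool (\<exists>u<W. al * u = j \<and> P u)) [0..<m])
      (map (\<lambda>j. of_bool (\<exists>v<W. be * v = j \<and> Q v)) [0..<m]) j =
    (\<Sum>i\<le>j. of_bool (\<exists>u<W. al * u = i \<and> P u) * of_bool (\<exists>v<W. be * v = j - i \<and> Q v))"
    unfolding acyclic_convolution_def using assms(3) by (intro sum.cong) auto
  also have "\<dots> = (\<Sum>i\<le>j. (\<Sum>u<W. of_bool (al * u = i \<and> P u)) *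
      (\<Sum>v<W. of_bool (be * v = j - i \<and> Q v)))"
    using single assms(1,2) by presburger
  also have "\<dots> = (\<Sum>i\<le>j. \<Sum>u<W. \<Sum>v<W.
      of_bool (al * u = i \<and> P u) * of_bool (be * v = j - i \<and> Q v))"
    by (simp only: sum_product)
  also have "\<dots> = (\<Sum>u<W. \<Sum>v<W. \<Sum>i\<le>j.
      of_bool (al * u = i \<and> P u) * of_bool (be * v = j - i \<and> Q v))"
    by (rule trans[OF sum.swap]) (intro sum.cong refl sum.swap)
  also have "\<dots> = (\<Sum>u<W. \<Sum>v<W. of_bool (P u \<and> Q v \<and> al * u + be * v = j))"
  proof (intro sum.cong refl)
    fix u v
    have "(\<Sum>i\<le>j. of_bool (al * u = i \<and> P u) * of_bool (be * v = j - i \<and> Q v) :: int) =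
        (\<Sum>i\<le>j. if i = al * u then of_bool (P u \<and> Q v \<and> al * u + be * v = j) else 0)"
      by (intro sum.cong) auto
    also have "\<dots> = of_bool (P u \<and> Q v \<and> al * u + be * v = j)"
      by auto
    finally show "(\<Sum>i\<le>j. of_bool (al * u = i \<and> P u) * of_bool (be * v = j - i \<and> Q v) :: int) =
        of_bool (P u \<and> Q v \<and> al * u + be * v = j)" .
  qed
  finally show ?thesis .
qed

text \<open>\<open>H\<close> is the test at the middle position, read off at the index
  \<open>al * u + be * v\<close>. For \<open>u, v < W\<close> this index is below \<open>m\<close>,
  so the first \<open>m\<close> coefficients contain every pair.\<close>

lemma sum_acyclic_convolution_of_bool:
  fixes al be W m :: nat
  assumes "0 < al" "0 < be" "(al + be) * W \<le> m"
  shows "(\<Sum>j<m. of_bool (H j) *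
      acyclic_convolution (map (\<lambda>j. of_bool (\<exists>u<W. al * u = j \<and> P u)) [0..<m])
        (map (\<lambda>j. of_bool (\<exists>v<W. be * v = j \<and> Q v)) [0..<m]) j) =
    (\<Sum>u<W. \<Sum>v<W. of_bool (P u \<and> H (al * u + be * v) \<and> Q v))"
proof -
  have "(\<Sum>j<m. of_bool (H j) *
      acyclic_convolution (map (\<lambda>j. of_bool (\<exists>u<W. al * u = j \<and> P u)) [0..<m])
        (map (\<lambda>j. of_bool (\<exists>v<W. be * v = j \<and> Q v)) [0..<m]) j) =
    (\<Sum>j<m. \<Sum>u<W. \<Sum>v<W. of_bool (H j) * of_bool (P u \<and> Q v \<and> al * u + be * v = j))"
    using assms by (intro sum.cong refl) (simp add: acyclic_convolution_of_bool sum_distrib_left)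
  also have "\<dots> = (\<Sum>u<W. \<Sum>v<W. \<Sum>j<m.
      of_bool (H j) * of_bool (P u \<and> Q v \<and> al * u + be * v = j))"
    by (rule trans[OF sum.swap]) (intro sum.cong refl sum.swap)
  also have "\<dots> = (\<Sum>u<W. \<Sum>v<W. of_bool (P u \<and> H (al * u + be * v) \<and> Q v))"
  proof (intro sum.cong refl)
    fix u v assume "u \<in> {..<W}" "v \<in> {..<W}"
    then have "al * Suc u \<le> al * W" "be * Suc v \<le> be * W"
      by (auto intro: mult_le_mono2 simp del: mult_Suc_right)
    then have "al * u + be * v < m"
      using assms by (simp add: algebra_simps)
    moreover have "(\<Sum>j<m. of_bool (H j) * of_bool (P u \<and> Q v \<and> al * u + be * v = j) :: int) =
        (\<Sum>j<m. if j = al * u + be * v then of_bool (P u \<and> H (al * u + be * v) \<and> Q v) else 0)"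
      by (intro sum.cong) auto
    ultimately show "(\<Sum>j<m. of_bool (H j) * of_bool (P u \<and> Q v \<and> al * u + be * v = j) :: int) =
        of_bool (P u \<and> H (al * u + be * v) \<and> Q v)"
      by simp
  qed
  finally show ?thesis .
qed


section \<open>Counting in a full cell\<close>

text \<open>From here on the safety of compound expressions goes through \<open>asafe_ok\<close>, so
  the simplifier must not unfold its definition.\<close>

declare asafe.simps(3-8) [simp del]

text \<open>The buffers still hold the entries of earlier cells. Clearing them is linear in the
  length of the convolution, whose cost absorbs it.\<close>

definition cell_clear :: com where
  "cell_clear = For ''j'' (Const 0) (Var ''m'')
     (Write ''_x'' (Var ''j'') (Const 0);; Write ''_y'' (Var ''j'') (Const 0))"

definition cell_fill :: com where
  "cell_fill = For ''j'' (Const 0) (Var ''w'')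
     (If (Equal (Read ''S'' (Var ''r'' \<oplus> Var ''D'' \<otimes> (Var ''p'' \<oplus> Var ''j''))) (Var ''ch''))
        (Write ''_x'' (Var ''al'' \<otimes> Var ''j'') (Const 1)) Skip;;
      If (Equal (Read ''S'' (Var ''r'' \<oplus> Var ''D'' \<otimes> (Var ''q'' \<oplus> Var ''j''))) (Var ''ch''))
        (Write ''_y'' (Var ''be'' \<otimes> Var ''j'') (Const 1)) Skip)"

definition cell_sum :: com where
  "cell_sum = For ''j'' (Const 0) (Var ''m'')
     (If (Equal (Read ''S'' (Var ''r'' \<oplus> Var ''al'' \<otimes> Var ''p'' \<oplus> Var ''be'' \<otimes> Var ''q'' \<oplus> Var ''j''))
            (Var ''ch''))
        (''count'' ::= Var ''count'' \<oplus> Read ''_z'' (Var ''j'')) Skip)"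

definition full_cell :: "com \<Rightarrow> com" where
  "full_cell cp =
    (''m'' ::= Var ''D'' \<otimes> Var ''w'';; cell_clear;; cell_fill;; ''_m'' ::= Var ''m'';; cp;; cell_sum)"

lemmas cell_defs = full_cell_def cell_clear_def cell_fill_def cell_sum_def

context word_bounds
begin

lemma N_simps [simp]: "0 \<le> N" "1 \<le> N" "2 \<le> N"
  using N2 by simp_all

lemma wp_cell_clear:
  assumes "scalar s ''m'' = int m" "int m \<le> N"
  shows "wp B cell_clear (\<lambda>t' s'. t' \<le> t + 20 * int m + 10 \<and>
    (\<forall>j<m. arr s' ''_x'' j = 0 \<and> arr s' ''_y'' j = 0)) t s"
  unfolding cell_clear_def
proof (rule wp_For[where lo = 0 and hi = "int m" and T = 10 and
      I = "\<lambda>i s'. \<forall>j<nat i. arr s' ''_x'' j = 0 \<and> arr s' ''_y'' j = 0"], goal_cases)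
  case (9 i t s')
  then show ?case
    using assms B_bounds N2 by (auto simp: asafe_ok asafe_Read_ok same_scalar less_Suc_eq nat_add_distrib)
qed (use assms B_bounds in \<open>auto simp: same_scalar\<close>)

lemma wp_cell_fill:
  fixes al be W m :: nat and D r p q ch :: int and s :: state
  defines "P \<equiv> \<lambda>u::nat. arr s ''S'' (nat (r + D * (p + int u))) = ch"
    and "Q \<equiv> \<lambda>v::nat. arr s ''S'' (nat (r + D * (q + int v))) = ch"
  assumes st: "scalar s ''D'' = D" "scalar s ''al'' = int al" "scalar s ''be'' = int be"
    "scalar s ''r'' = r" "scalar s ''p'' = p" "scalar s ''q'' = q" "scalar s ''w'' = int W"
    "scalar s ''ch'' = ch"
  assumes pos: "0 < al" "0 < be"
    and small: "int W \<le> N" "int al \<le> N" "int be \<le> N" "0 \<le> D" "D \<le> N" "\<bar>r\<bar> \<le> N" "\<bar>p\<bar> \<le> N" "\<bar>q\<bar> \<le> N"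
    and nonneg: "0 \<le> r + D * p" "0 \<le> r + D * q"
    and zero: "\<forall>j<m. arr s ''_x'' j = 0 \<and> arr s ''_y'' j = 0"
  shows "wp B cell_fill (\<lambda>t' s'. t' \<le> t + 50 * int W + 10 \<and>
    (\<forall>j<m. arr s' ''_x'' j = of_bool (\<exists>u<W. al * u = j \<and> P u) \<and>
           arr s' ''_y'' j = of_bool (\<exists>v<W. be * v = j \<and> Q v))) t s"
proof -
  define X where "X i j = (of_bool (\<exists>u<i. al * u = j \<and> P u) :: int)" for i j
  define Y where "Y i j = (of_bool (\<exists>v<i. be * v = j \<and> Q v) :: int)" for i j
  have X: "X (Suc u) j = (if P u \<and> j = al * u then 1 else X u j)" for u j
    by (auto simp: X_def less_Suc_eq)
  have Y: "Y (Suc u) j = (if Q u \<and> j = be * u then 1 else Y u j)" for u j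
    by (auto simp: Y_def less_Suc_eq)
  show ?thesis
    unfolding cell_fill_def X_def[symmetric] Y_def[symmetric]
  proof (rule wp_For[where lo = 0 and hi = "int W" and T = 40 and
        I = "\<lambda>i s'. \<forall>j<m. arr s' ''_x'' j = X (nat i) j \<and> arr s' ''_y'' j = Y (nat i) j"], goal_cases)
    case (9 i t s')
    then obtain u where u: "i = int u" using nonneg_int_cases by blast
    have S: "arr s' ''S'' = arr s ''S''" using 9(2) by (simp add: same_arr)
    have nn: "0 \<le> r + D * (p + i)" "0 \<le> r + D * (q + i)"
      using nonneg mult_nonneg_nonneg[of D i] 9(4) small(4) unfolding distrib_left by linarith+
    have vars: "scalar s' ''D'' = D" "scalar s' ''al'' = int al" "scalar s' ''be'' = int be"
      "scalar s' ''r'' = r" "scalar s' ''p'' = p" "scalar s' ''q'' = q" "scalar s' ''ch'' = ch"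
      "scalar s' ''j'' = i"
      using 9(2,3) st by (simp_all add: same_scalar)
    have nat': "nat (int g * i) = g * u" for g
      unfolding u by (simp flip: of_nat_mult)
    have sm: "i \<le> N" "nat (i + 1) = Suc u" "nat i = u" "0 \<le> i" using 9 small(1) u by simp_all
    have PQ: "P u \<longleftrightarrow> arr s ''S'' (nat (r + D * (p + i))) = ch"
      "Q u \<longleftrightarrow> arr s ''S'' (nat (r + D * (q + i))) = ch"
      by (simp_all add: P_def Q_def u)
    show ?case
      using 9(1)
      by (cases "P u"; cases "Q u"; simp add: vars nat' S X Y PQ sm split del: if_split; intro conjI)
        (simp add: asafe_ok asafe_Read_ok vars sm small nn; fail | auto)+
  qed (use assms B_bounds in \<open>auto simp: same_scalar X_def Y_def\<close>)
qed

text \<open>The coefficients are nonnegative, so each partial count is at most the final one; a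
  single bound on the final count keeps all additions within words.\<close>

lemma wp_cell_sum:
  fixes al be m :: nat and r p q ch cnt :: int and s :: state
  defines "H \<equiv> \<lambda>j::nat. arr s ''S'' (nat (r + int al * p + int be * q + int j)) = ch"
  assumes st: "scalar s ''al'' = int al" "scalar s ''be'' = int be"
    "scalar s ''r'' = r" "scalar s ''p'' = p" "scalar s ''q'' = q" "scalar s ''m'' = int m"
    "scalar s ''ch'' = ch" "scalar s ''count'' = cnt"
  assumes small: "int m \<le> N" "int al \<le> N" "int be \<le> N" "\<bar>r\<bar> \<le> N" "\<bar>p\<bar> \<le> N" "\<bar>q\<bar> \<le> N"
    and nonneg: "0 \<le> r + int al * p + int be * q"
    and z: "\<forall>j<m. arr s ''_z'' j = z j" "\<forall>j<m. 0 \<le> z j"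
    and cnt: "0 \<le> cnt" "cnt + (\<Sum>j<m. of_bool (H j) * z j) \<le> N"
  shows "wp B cell_sum (\<lambda>t' s'. t' \<le> t + 40 * int m + 10 \<and>
    scalar s' ''count'' = cnt + (\<Sum>j<m. of_bool (H j) * z j)) t s"
  unfolding cell_sum_def
proof (rule wp_For[where lo = 0 and hi = "int m" and T = 30 and
      I = "\<lambda>i s'. scalar s' ''count'' = cnt + (\<Sum>j<nat i. of_bool (H j) * z j)"], goal_cases)
  case (9 i t s')
  from 9(4) obtain u where u: "i = int u" using nonneg_int_cases by blast
  with 9(5) have um: "u < m" by simp
  have S: "arr s' ''S'' = arr s ''S''" "arr s' ''_z'' u = z u"
    using 9(2) z um by (simp_all add: same_arr)
  have nn: "0 \<le> r + int al * p + int be * q + i" using nonneg 9(4) by simp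
  have vars: "scalar s' ''al'' = int al" "scalar s' ''be'' = int be"
    "scalar s' ''r'' = r" "scalar s' ''p'' = p" "scalar s' ''q'' = q" "scalar s' ''ch'' = ch"
    "scalar s' ''j'' = i"
    using 9(2,3) st by (simp_all add: same_scalar)
  define c where "c = cnt + (\<Sum>j<u. of_bool (H j) * z j)"
  have le: "c + of_bool (H u) * z u \<le> cnt + (\<Sum>j<m. of_bool (H j) * z j)"
    using sum_mono2[of "{..<m}" "{..<Suc u}" "\<lambda>j. of_bool (H j) * z j"] um z by (auto simp: c_def)
  have nonneg': "0 \<le> c" "0 \<le> z u"
    using um z cnt by (auto intro!: sum_nonneg add_nonneg_nonneg simp: c_def)
  have sm: "i \<le> N" "nat (i + 1) = Suc u" "nat i = u" using 9(4,5) small(1) u by simp_all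
  have c: "scalar s' ''count'' = c" using 9(1) sm(3) by (simp add: c_def)
  have Hu: "H u \<longleftrightarrow> arr s ''S'' (nat (r + int al * p + int be * q + i)) = ch"
    by (simp add: H_def u)
  have zc: "z u \<le> N" "c \<le> N" if "H u" using that le nonneg' cnt(2) by simp_all
  show ?case
  proof (cases "H u")
    case True
    then show ?thesis
      using zc by (simp add: asafe_ok asafe_Read_ok vars S Hu c sm small nn nonneg' 9(4))
        (simp add: c_def H_def u)
  next
    case False
    then show ?thesis
      by (simp add: asafe_ok asafe_Read_ok vars S Hu c sm small nn 9(4))
        (simp add: c_def H_def u)
  qed
qed (use assms B_bounds in \<open>auto simp: same_scalar\<close>)

end

text \<open>\<open>lg\<close> is one number for all convolutions of length at most \<open>N\<close>:
  each call is charged \<open>lg\<close> per entry, whatever its own length.\<close>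

locale conv_machine = word_bounds +
  fixes cp :: com and C lg :: int
  assumes conv_svars: "svars cp \<subseteq> range (Cons (CHR ''_''))"
    and conv_avars: "avars cp \<subseteq> range (Cons (CHR ''_''))"
    and C_nonneg: "0 \<le> C" and lg_pos: "1 \<le> lg"
    and conv: "\<And>(m::nat) xs ys s t. 2 \<le> m \<Longrightarrow> int m \<le> N \<Longrightarrow>
      length xs = m \<Longrightarrow> length ys = m \<Longrightarrow> set xs \<subseteq> {0, 1} \<Longrightarrow> set ys \<subseteq> {0, 1} \<Longrightarrow>
      scalar s ''_m'' = int m \<Longrightarrow> \<forall>i<m. arr s ''_x'' i = xs ! i \<Longrightarrow>
      \<forall>i<m. arr s ''_y'' i = ys ! i \<Longrightarrow>
      wp B cp (\<lambda>t' s'. t' \<le> t + C * (int m * lg) \<and>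
        (\<forall>j<m. arr s' ''_z'' j = acyclic_convolution xs ys j)) t s"
begin

lemma conv_vars [simp]:
  "c \<noteq> CHR ''_'' \<Longrightarrow> c # x \<notin> svars cp" "c \<noteq> CHR ''_'' \<Longrightarrow> c # x \<notin> avars cp"
  using conv_svars conv_avars by blast+

lemma wp_full_cell:
  fixes al be W :: nat and r p q ch cnt t :: int and s :: state
  defines "m \<equiv> (al + be) * W"
  defines "P \<equiv> \<lambda>u::nat. arr s ''S'' (nat (r + int (al + be) * (p + int u))) = ch"
    and "Q \<equiv> \<lambda>v::nat. arr s ''S'' (nat (r + int (al + be) * (q + int v))) = ch"
    and "H \<equiv> \<lambda>j::nat. arr s ''S'' (nat (r + int al * p + int be * q + int j)) = ch"
  defines "tot \<equiv> (\<Sum>u<W. \<Sum>v<W. of_bool (P u \<and> H (al * u + be * v) \<and> Q v))"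
  assumes st: "scalar s ''D'' = int (al + be)" "scalar s ''al'' = int al" "scalar s ''be'' = int be"
    "scalar s ''r'' = r" "scalar s ''p'' = p" "scalar s ''q'' = q" "scalar s ''w'' = int W"
    "scalar s ''ch'' = ch" "scalar s ''count'' = cnt"
  assumes pos: "0 < al" "0 < be" "0 < W"
    and small: "int m \<le> N" "\<bar>r\<bar> \<le> N" "\<bar>p\<bar> \<le> N" "\<bar>q\<bar> \<le> N" "0 \<le> cnt" "cnt + tot \<le> N"
    and nonneg: "0 \<le> r + int (al + be) * p" "0 \<le> r + int (al + be) * q"
      "0 \<le> r + int al * p + int be * q"
  shows "wp B (full_cell cp) (\<lambda>t' s'. t' \<le> t + (C + 200) * (int m * lg) \<and>
    scalar s' ''count'' = cnt + tot) t s"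
proof -
  define xs where "xs = map (\<lambda>j. of_bool (\<exists>u<W. al * u = j \<and> P u) :: int) [0..<m]"
  define ys where "ys = map (\<lambda>j. of_bool (\<exists>v<W. be * v = j \<and> Q v) :: int) [0..<m]"
  define z where "z = acyclic_convolution xs ys"
  have "W \<le> m" "al + be \<le> m"
    using pos by (simp_all add: m_def)
  then have m: "2 \<le> m" "W \<le> m" "al + be \<le> m"
    using pos by linarith+
  have len: "length xs = m" "length ys = m" "set xs \<subseteq> {0, 1}" "set ys \<subseteq> {0, 1}"
    by (auto simp: xs_def ys_def)
  have z: "z j = (\<Sum>u<W. \<Sum>v<W. of_bool (P u \<and> Q v \<and> al * u + be * v = j))" if "j < m" for j
    unfolding z_def xs_def ys_def using pos(1,2) that by (rule acyclic_convolution_of_bool)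
  have z_nn: "0 \<le> z j" if "j < m" for j
    using z[OF that] by (simp add: sum_nonneg)
  have tot: "(\<Sum>j<m. of_bool (H j) * z j) = tot"
    unfolding z_def xs_def ys_def tot_def
    using pos by (intro sum_acyclic_convolution_of_bool) (auto simp: m_def)
  have bnds: "int W \<le> N" "int al \<le> N" "int be \<le> N" "int (al + be) \<le> N"
    using m small(1) by linarith+
  \<comment> \<open>The 200 absorbs clearing, filling and summing, all linear in \<open>m\<close>,
    because \<open>1 \<le> lg\<close>.\<close>
  have time: "(C + 200) * (int m * lg) \<ge> C * (int m * lg) + 200 * int m" "int m \<ge> int W" "int m \<ge> 2"
    using m lg_pos by (auto simp: distrib_right)
  show ?thesis
    unfolding full_cell_def wp_Seq wp_Assign
  proof (intro conjI, goal_cases)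
    case 1
    show ?case using bnds by (intro asafe_ok) (auto simp: st)
  next
    case 2
    let ?s1 = "setv ''m'' (aval (Var ''D'' \<otimes> Var ''w'') s) s"
    have "scalar ?s1 ''m'' = int m" by (simp add: st m_def)
    from wp_cell_clear[OF this small(1)] show ?case
    proof (rule wp_conseq, goal_cases)
      case (1 t2 s2)
      note s2 = 1(1) and same2 = 1(2)[unfolded cell_clear_def, simplified]
      have "wp B cell_fill (\<lambda>t' s'. t' \<le> t2 + 50 * int W + 10 \<and>
        (\<forall>j<m. arr s' ''_x'' j = of_bool (\<exists>u<W. al * u = j \<and>
            arr s2 ''S'' (nat (r + int (al + be) * (p + int u))) = ch) \<and>
           arr s' ''_y'' j = of_bool (\<exists>v<W. be * v = j \<and>
            arr s2 ''S'' (nat (r + int (al + be) * (q + int v))) = ch))) t2 s2"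
        using same2 s2 pos bnds small nonneg
        by (intro wp_cell_fill) (simp_all add: same_scalar st)
      then show ?case
      proof (rule wp_conseq, goal_cases)
        case (1 t3 s3)
        note s3 = 1(1) and same3 = 1(2)[unfolded cell_fill_def, simplified]
        have S: "arr s2 ''S'' = arr s ''S''" "arr s3 ''S'' = arr s ''S''"
          using same2 same3 by (simp_all add: same_arr)
        let ?s4 = "setv ''_m'' (int m) s3"
        have m3: "scalar s3 ''m'' = int m"
          using same2 same3 by (simp add: same_scalar st m_def)
        have "wp B cp (\<lambda>t' s'. t' \<le> t3 + 2 + C * (int m * lg) \<and>
            (\<forall>j<m. arr s' ''_z'' j = acyclic_convolution xs ys j)) (t3 + 2) ?s4"
          using s3 by (intro conv) (use m len small in \<open>auto simp: xs_def ys_def P_def Q_def S\<close>)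
        then have "wp B cp (wp B cell_sum (\<lambda>t' s'. t' \<le> t + (C + 200) * (int m * lg) \<and>
            scalar s' ''count'' = cnt + tot)) (t3 + 2) ?s4"
        proof (rule wp_conseq, goal_cases)
          case (1 t5 s5)
          note s5 = 1(1) and same5 = 1(2)
          have S5: "arr s5 ''S'' = arr s ''S''"
            using same5 S by (simp add: same_arr)
          have H: "H = (\<lambda>j::nat. arr s5 ''S'' (nat (r + int al * p + int be * q + int j)) = ch)"
            by (simp add: H_def S5)
          have "wp B cell_sum (\<lambda>t' s'. t' \<le> t5 + 40 * int m + 10 \<and>
              scalar s' ''count'' = cnt + (\<Sum>j<m. of_bool (arr s5 ''S'' (nat (r + int al * p + int be * q + int j)) = ch) * z j)) t5 s5"
            using same2 same3 same5 small bnds nonneg m3 s5 z_nn tot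
            by (intro wp_cell_sum) (simp_all add: same_scalar st z_def H)
          then show ?case
          proof (rule wp_conseq, goal_cases)
            case (1 t6 s6)
            then show ?case
              using s2 s3 s5 time tot unfolding H by auto
          qed
        qed
        then show ?case
          using m3 by (simp add: add.commute)
      qed
    qed
  qed
qed

end


section \<open>The quadtree of a residue class\<close>

text \<open>The form \<open>u p - v q + e\<close> is monotone in \<open>p\<close> and antitone in
  \<open>q\<close>. A walk along an antidiagonal of cells raises \<open>p\<close> and lowers
  \<open>q\<close>, and the maximum over one cell is at most the minimum over every later one. So
  \<open>th\<close> separates minimum and maximum for at most one cell of each antidiagonal, and
  there are at most \<open>2 * m\<close> antidiagonals.\<close>

lemma card_antidiagonal:
  fixes u v e th q0 w :: int and m :: nat
  assumes "0 \<le> u" "0 \<le> v" "1 \<le> w"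
  shows "card {(i, j). i < m \<and> j < m \<and> u * (int i * w) - v * (q0 + int j * w + w - 1) + e \<le> th \<and>
    th < u * (int i * w + w - 1) - v * (q0 + int j * w) + e} \<le> 2 * m"
    (is "card ?E \<le> _")
proof -
  have *: False if "(i, j) \<in> ?E" "(i', j') \<in> ?E" "i + j = i' + j'" "i < i'" for i j i' j'
  proof -
    define g where "g = i' - i - 1"
    have g: "i' = i + 1 + g" "j = j' + 1 + g"
      using that(3,4) by (auto simp: g_def)
    \<comment> \<open>The sum of the two terms is the gap between the maximum over cell
      \<open>(i, j)\<close> and the minimum over cell \<open>(i', j')\<close>.\<close>
    have "0 \<le> u * (int g * w + 1)" "0 \<le> v * (int g * w + 1)"
      using assms by simp_all
    then show False
      using that(1,2) unfolding g by (simp add: algebra_simps)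
  qed
  have "inj_on (\<lambda>(i, j). i + j) ?E"
    using * by (intro inj_onI) (metis (no_types, lifting) case_prod_conv surj_pair
        add_left_imp_eq add_right_imp_eq linorder_neqE_nat)
  moreover have "(\<lambda>(i, j). i + j) ` ?E \<subseteq> {..<2 * m}" by auto
  ultimately have "card ?E \<le> card {..<2 * m}" by (rule card_inj_on_le) simp
  then show ?thesis by simp
qed

lemma sum_lessThan_add:
  fixes f :: "nat \<Rightarrow> 'a :: comm_monoid_add"
  shows "(\<Sum>i<m + n. f i) = (\<Sum>i<m. f i) + (\<Sum>i<n. f (m + i))"
  by (induction n) (simp_all add: add.assoc)

lemma zle_div_iff: "0 < d \<Longrightarrow> m \<le> n div d \<longleftrightarrow> m * d \<le> n" for d m n :: int
proof -
  assume d: "0 < d"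
  have *: "n div d * d \<le> n" "n < (n div d + 1) * d"
    using d pos_mod_bound[of d n] pos_mod_sign[of d n] div_mult_mod_eq[of n d]
    unfolding distrib_right by linarith+
  show ?thesis
  proof
    assume "m \<le> n div d"
    then have "m * d \<le> n div d * d" using d by (intro mult_right_mono) auto
    then show "m * d \<le> n" using * by linarith
  next
    assume "m * d \<le> n"
    then have "m * d < (n div d + 1) * d" using * by linarith
    then show "m \<le> n div d" using d by (simp add: mult_less_cancel_right)
  qed
qed

lemma int_card_filter:
  "finite A \<Longrightarrow> int (card {z \<in> A. P z}) = (\<Sum>z\<in>A. of_bool (P z))"
  by (simp add: sum.inter_filter[symmetric] of_bool_def)

locale cadence =
  fixes n k a b c :: int
  assumes a0: "0 \<le> a" and ab: "a < b" and bc: "b < c" and ck: "c < k" and kn: "k \<le> n"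
begin

lemma coeffs:
  "0 \<le> a" "0 \<le> b" "0 \<le> c" "0 \<le> k - 1 - c" "0 \<le> k - 1 - b" "0 \<le> k - 1 - a"
  "0 \<le> k - c" "0 \<le> k - b" "0 \<le> k - a"
  using a0 ab bc ck by linarith+

definition valid :: "int \<Rightarrow> int \<Rightarrow> bool" where
  "valid i d \<longleftrightarrow> 1 \<le> i \<and> i \<le> d \<and> i + (k - 1) * d \<le> n \<and> n < i + k * d"

text \<open>
  With \<open>x = i + a d\<close> and \<open>z = i + c d\<close>, the integrality of \<open>d\<close> says \<open>x \<equiv> z\<close> modulo \<open>c - a\<close>.
  Writing \<open>x = r + (c - a) p\<close> and \<open>z = r + (c - a) q\<close> turns \<open>i\<close> and \<open>d\<close> into integral linear
  forms in \<open>p\<close> and \<open>q\<close>, and the middle position into \<open>r + (c - b) p + (b - a) q\<close>.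
\<close>

definition start :: "int \<Rightarrow> int \<Rightarrow> int \<Rightarrow> int" where
  "start r p q = r + c * p - a * q"

definition hit :: "(int \<Rightarrow> bool) \<Rightarrow> int \<Rightarrow> int \<Rightarrow> int \<Rightarrow> bool" where
  "hit f r p q \<longleftrightarrow> valid (start r p q) (q - p) \<and> f (r + (c - a) * p) \<and>
     f (r + (c - b) * p + (b - a) * q) \<and> f (r + (c - a) * q)"

definition sol :: "(int \<Rightarrow> bool) \<Rightarrow> int \<Rightarrow> nat \<Rightarrow> int \<Rightarrow> int \<Rightarrow> int" where
  "sol f r w p q = (\<Sum>u<w. \<Sum>v<w. of_bool (hit f r (p + int u) (q + int v)))"

lemma sol_nonneg: "0 \<le> sol f r w p q"
  by (simp add: sol_def sum_nonneg)

lemma sol_split: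
  "sol f r (2 * w) p q = sol f r w p q + sol f r w p (q + int w) +
     sol f r w (p + int w) q + sol f r w (p + int w) (q + int w)"
  unfolding sol_def mult_2 sum_lessThan_add by (simp add: sum.distrib ac_simps)

text \<open>
  Each of the four linear forms defining \<open>valid\<close> is monotone in \<open>p\<close> and antitone in \<open>q\<close>, or the
  other way round, so its extreme values on a cell are attained at the two corners
  \<open>(p, q + w - 1)\<close> and \<open>(p + w - 1, q)\<close>.
\<close>

definition outside :: "int \<Rightarrow> int \<Rightarrow> int \<Rightarrow> int \<Rightarrow> bool" where
  "outside r w p q \<longleftrightarrow>
     (let iA = start r p (q + w - 1); dA = q + w - 1 - p; iB = start r (p + w - 1) q; dB = q - (p + w - 1)
      in dA < iA \<or> iB < 1 \<or> n < iB + (k - 1) * dB \<or> iA + k * dA \<le> n)"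

definition full :: "int \<Rightarrow> int \<Rightarrow> int \<Rightarrow> int \<Rightarrow> bool" where
  "full r w p q \<longleftrightarrow>
     (let iA = start r p (q + w - 1); dA = q + w - 1 - p; iB = start r (p + w - 1) q; dB = q - (p + w - 1)
      in iB \<le> dB \<and> 1 \<le> iA \<and> iA + (k - 1) * dA \<le> n \<and> n < iB + k * dB)"

lemma
  assumes "p \<le> p'" "p' < p + w" "q \<le> q'" "q' < q + w"
  shows full_valid: "full r w p q \<Longrightarrow> valid (start r p' q') (q' - p')"
    and outside_not_valid: "outside r w p q \<Longrightarrow> \<not> valid (start r p' q') (q' - p')"
proof -
  \<comment> \<open>Coefficients of \<open>p\<close> and \<open>q\<close> in the forms
    \<open>i\<close>, \<open>i + (k - 1) * d\<close> and \<open>i + k * d\<close>, times the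
    distances of the point from the sides of the cell. Given the signs of these products, comparing
    a form at the point with its value at a corner is linear arithmetic.\<close>
  have "0 \<le> g * (p' - p)" "0 \<le> g * (p + w - 1 - p')" "0 \<le> g * (q' - q)" "0 \<le> g * (q + w - 1 - q')"
    if "0 \<le> g" for g using assms that by simp_all
  note * = this[OF coeffs(1)] this[OF coeffs(3)] this[OF coeffs(4)] this[OF coeffs(6)]
    this[OF coeffs(7)] this[OF coeffs(9)]
  from *
  show "full r w p q \<Longrightarrow> valid (start r p' q') (q' - p')"
    "outside r w p q \<Longrightarrow> \<not> valid (start r p' q') (q' - p')"
    using assms
    by (auto simp: full_def outside_def valid_def start_def Let_def algebra_simps)
qed

text \<open>A cell of side 1 is a single point, so both corners coincide and the conditions of
  \<open>outside\<close> are the negations of those of \<open>full\<close>. This ends the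
  splitting.\<close>

lemma outside_or_full: "outside r 1 p q \<or> full r 1 p q"
  by (auto simp: full_def outside_def Let_def)

lemma sol_outside: "outside r (int w) p q \<Longrightarrow> sol f r w p q = 0"
  unfolding sol_def hit_def
  by (intro sum.neutral ballI) (simp add: outside_not_valid[of p _ "int w" q])

lemma sol_full:
  "full r (int w) p q \<Longrightarrow> sol f r w p q = (\<Sum>u<w. \<Sum>v<w.
     of_bool (f (r + (c - a) * (p + int u)) \<and>
       f (r + (c - b) * (p + int u) + (b - a) * (q + int v)) \<and> f (r + (c - a) * (q + int v))))"
  unfolding sol_def hit_def
  by (intro sum.cong refl) (simp add: full_valid[of p _ "int w" q])

text \<open>All three positions are of the form \<open>i + x * d\<close> with
  \<open>0 \<le> x \<le> k - 1\<close>, hence lie between \<open>i\<close> and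
  \<open>i + (k - 1) * d\<close>.\<close>

lemma valid_positions:
  assumes "valid (start r p q) (q - p)"
  shows "1 \<le> r + (c - a) * p" "r + (c - a) * q \<le> n"
    "1 \<le> r + (c - b) * p + (b - a) * q" "r + (c - b) * p + (b - a) * q \<le> n"
    "1 \<le> r + (c - a) * q"
proof -
  have d: "1 \<le> q - p" using assms by (simp add: valid_def)
  have "0 \<le> g * (q - p)" if "0 \<le> g" for g using d that by simp
  from this[OF coeffs(1)] this[OF coeffs(2)] this[OF coeffs(3)] this[OF coeffs(4)] this[OF coeffs(5)]
  show "1 \<le> r + (c - a) * p" "r + (c - a) * q \<le> n"
    "1 \<le> r + (c - b) * p + (b - a) * q" "r + (c - b) * p + (b - a) * q \<le> n"
    "1 \<le> r + (c - a) * q"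
    using assms by (auto simp: valid_def start_def algebra_simps)
qed

text \<open>
  The traversal pays \<open>K0\<close> for each visited cell and \<open>K1 w\<close> for the convolution on a full cell of side \<open>w\<close>.
\<close>

fun cost :: "int \<Rightarrow> int \<Rightarrow> int \<Rightarrow> nat \<Rightarrow> int \<Rightarrow> int \<Rightarrow> int" where
  "cost K0 K1 r 0 p q = K0 + (if outside r 1 p q then 0 else K1)"
| "cost K0 K1 r (Suc l) p q = K0 +
     (if outside r (2 ^ Suc l) p q then 0
      else if full r (2 ^ Suc l) p q then K1 * 2 ^ Suc l
      else cost K0 K1 r l p q + cost K0 K1 r l p (q + 2 ^ l) +
        cost K0 K1 r l (p + 2 ^ l) q + cost K0 K1 r l (p + 2 ^ l) (q + 2 ^ l))"

lemma cost_nonneg: "0 \<le> K0 \<Longrightarrow> 0 \<le> K1 \<Longrightarrow> 0 \<le> cost K0 K1 r l p q"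
  by (induction l arbitrary: p q) auto

definition crossing :: "int \<Rightarrow> nat \<Rightarrow> int \<Rightarrow> nat \<Rightarrow> (nat \<times> nat) set" where
  "crossing r l q0 m = {(i, j). i < m \<and> j < m \<and>
     \<not> outside r (2 ^ l) (int i * 2 ^ l) (q0 + int j * 2 ^ l) \<and>
     \<not> full r (2 ^ l) (int i * 2 ^ l) (q0 + int j * 2 ^ l)}"

lemma finite_crossing: "finite (crossing r l q0 m)"
  by (rule finite_subset[of _ "{..<m} \<times> {..<m}"]) (auto simp: crossing_def)

text \<open>In a crossing cell some constraint neither fails throughout nor holds throughout, so the
  two corners lie on different sides of its threshold. Each of the four forms accounts for at most
  \<open>2 * m\<close> cells by \<open>card_antidiagonal\<close>.\<close>

lemma card_crossing: "card (crossing r l q0 m) \<le> 8 * m"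
proof -
  let ?w = "2 ^ l :: int"
  let ?E = "\<lambda>u v e th. {(i, j). i < m \<and> j < m \<and> u * (int i * ?w) - v * (q0 + int j * ?w + ?w - 1) + e \<le> th \<and>
    th < u * (int i * ?w + ?w - 1) - v * (q0 + int j * ?w) + e}"
  \<comment> \<open>The forms are \<open>i - d\<close>, \<open>i\<close>, and the negatives of
    \<open>i + (k - 1) * d\<close> and \<open>i + k * d\<close>. The last two are antitone in
    \<open>p\<close> before the change of sign, which turns "exceeds \<open>n\<close>" into "is at
    most \<open>- n - 1\<close>".\<close>
  let ?E1 = "?E (c + 1) (a + 1) r 0" and ?E2 = "?E c a r 0"
  let ?E3 = "?E (k - 1 - c) (k - 1 - a) (- r) (- n - 1)" and ?E4 = "?E (k - c) (k - a) (- r) (- n - 1)"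
  have fin: "finite (?E u v e th)" for u v e th
    by (rule finite_subset[of _ "{..<m} \<times> {..<m}"]) auto
  have "crossing r l q0 m \<subseteq> ?E1 \<union> ?E2 \<union> ?E3 \<union> ?E4"
  proof (rule subrelI)
    fix i j
    define w where "w = ?w"
    define p q where "p = int i * w" and "q = q0 + int j * w"
    assume "(i, j) \<in> crossing r l q0 m"
    then have ij: "i < m" "j < m" and x: "\<not> outside r w p q" "\<not> full r w p q"
      by (auto simp: crossing_def w_def p_def q_def)
    from x show "(i, j) \<in> ?E1 \<union> ?E2 \<union> ?E3 \<union> ?E4"
      unfolding Un_iff mem_Collect_eq case_prod_conv w_def[symmetric] p_def[symmetric] q_def[symmetric]
      using ij by (auto simp: outside_def full_def Let_def start_def algebra_simps)
  qed
  then have "card (crossing r l q0 m) \<le> card (?E1 \<union> ?E2 \<union> ?E3 \<union> ?E4)"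
    by (intro card_mono finite_UnI fin)
  also have "\<dots> \<le> card ?E1 + card ?E2 + card ?E3 + card ?E4"
    by (meson card_Un_le add_le_mono order.trans order.refl)
  also have "\<dots> \<le> 2 * m + 2 * m + 2 * m + 2 * m"
    using a0 ab bc ck by (intro add_mono card_antidiagonal) auto
  finally show ?thesis by simp
qed

text \<open>Only crossing cells are split. On level \<open>l + 1\<close> there are at most
  \<open>8 * 2 ^ (L - l - 1)\<close> of them, and each pays \<open>K0\<close> for itself and
  \<open>K0 + K1 * 2 ^ l\<close> for each of four children, apart from what crossing children cost
  further down. This is at most \<open>2 ^ L * (20 * K0 + 16 * K1)\<close> on every level, and the
  root adds one more such term.\<close>

lemma cost_le:
  assumes "0 \<le> K0" "0 \<le> K1"
  shows "cost K0 K1 r L 0 q0 \<le> (int L + 1) * 2 ^ L * (20 * K0 + 16 * K1)"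
proof -
  define cc where "cc l = (\<lambda>(i, j). cost K0 K1 r l (int i * 2 ^ l) (q0 + int j * 2 ^ l))" for l
  let ?E = "\<lambda>l. crossing r l q0 (2 ^ (L - l))"
  let ?K = "20 * K0 + 16 * K1"
  define V where "V l = (\<Sum>x\<in>?E l. cc l x)" for l
  \<comment> \<open>For a cell that is not crossing, the first two terms already bound the cost; for
    a crossing cell the last term alone does.\<close>
  have leaf: "cc l (i, j) \<le> K0 + K1 * 2 ^ l + (if (i, j) \<in> ?E l then cc l (i, j) else 0)"
    if "i < 2 ^ (L - l)" "j < 2 ^ (L - l)" for l i j
    using that assms by (cases l) (auto simp: crossing_def cc_def)
  have V: "V l \<le> int l * 2 ^ L * ?K" if "l \<le> L" for l
    using that
  proof (induction l)
    case 0
    have "?E 0 = {}" using outside_or_full by (auto simp: crossing_def)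
    then show ?case by (simp add: V_def)
  next
    case (Suc l)
    let ?w = "2 ^ l :: int"
    define g where "g x = (if x \<in> ?E l then cc l x else 0)" for x
    \<comment> \<open>Sends a cell and a pair of parities to one of its four children. Halves and
      parities recover the argument, so \<open>ch\<close> is injective and no child is counted
      twice.\<close>
    define ch where "ch = (\<lambda>((i, j), (e, e')). (2 * i + e, 2 * j + e') :: nat \<times> nat)"
    let ?F = "?E (Suc l) \<times> ({0, 1} \<times> {0, 1})"
    have pow: "(2::nat) ^ (L - l) = 2 * 2 ^ (L - Suc l)" and pow': "(2::int) ^ L = 2 * 2 ^ l * 2 ^ (L - Suc l)"
      using Suc.prems by (auto simp flip: power_Suc power_add simp: Suc_diff_Suc)
    have g0: "0 \<le> g x" for x
      using cost_nonneg assms by (cases x) (auto simp: g_def cc_def)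
    have "cc (Suc l) x \<le> 5 * K0 + 4 * (K1 * ?w) + (\<Sum>y\<in>{0, 1} \<times> {0, 1}. g (ch (x, y)))"
      if "x \<in> ?E (Suc l)" for x
    proof -
      obtain i j where x: "x = (i, j)" by (cases x)
      have ij: "i < 2 ^ (L - Suc l)" "j < 2 ^ (L - Suc l)"
        using that by (auto simp: x crossing_def)
      define M where "M = K0 + K1 * ?w"
      have child: "cc l (2 * i + e, 2 * j + e') \<le> K0 + K1 * ?w + g (2 * i + e, 2 * j + e')"
        if "e \<le> 1" "e' \<le> 1" for e e'
        using leaf[of "2 * i + e" l "2 * j + e'"] ij that pow by (simp add: g_def)
      have "cc (Suc l) x = K0 + (cc l (2 * i + 0, 2 * j + 0) + cc l (2 * i + 0, 2 * j + 1) +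
          cc l (2 * i + 1, 2 * j + 0) + cc l (2 * i + 1, 2 * j + 1))"
        using that by (simp add: x crossing_def cc_def algebra_simps)
      also have "\<dots> \<le> K0 + (4 * (K0 + K1 * ?w) + (g (2 * i + 0, 2 * j + 0) + g (2 * i + 0, 2 * j + 1) +
          g (2 * i + 1, 2 * j + 0) + g (2 * i + 1, 2 * j + 1)))"
        using child[OF zero_le_one zero_le_one] child[OF zero_le_one order.refl]
          child[OF order.refl zero_le_one] child[OF order.refl order.refl]
        unfolding M_def[symmetric] by simp
      also have "g (2 * i + 0, 2 * j + 0) + g (2 * i + 0, 2 * j + 1) +
          g (2 * i + 1, 2 * j + 0) + g (2 * i + 1, 2 * j + 1) =
          (\<Sum>y\<in>{0, 1} \<times> {0, 1}. g (ch (x, y)))"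
        by (simp add: x ch_def sum.cartesian_product[symmetric])
      finally show ?thesis by simp
    qed
    then have "V (Suc l) \<le> (\<Sum>x\<in>?E (Suc l). 5 * K0 + 4 * (K1 * ?w) +
        (\<Sum>y\<in>{0, 1} \<times> {0, 1}. g (ch (x, y))))"
      unfolding V_def by (intro sum_mono)
    also have "\<dots> = int (card (?E (Suc l))) * (5 * K0 + 4 * (K1 * ?w)) + (\<Sum>z\<in>?F. g (ch z))"
      unfolding sum.distrib by (simp only: sum_constant sum.cartesian_product case_prod_unfold prod.collapse distrib_left)
    also have "(\<Sum>z\<in>?F. g (ch z)) = (\<Sum>z\<in>ch ` ?F. g z)"
    proof (rule sum.reindex_cong[OF _ refl refl, symmetric])
      show "inj_on ch ?F"
        by (rule inj_onI) (auto simp: ch_def, presburger+)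
    qed
    also have "\<dots> \<le> (\<Sum>z\<in>ch ` ?F \<union> ?E l. g z)"
      using g0 by (intro sum_mono2) (auto simp: finite_crossing)
    also have "\<dots> = (\<Sum>z\<in>?E l. g z)"
      by (intro sum.mono_neutral_right) (auto simp: finite_crossing g_def)
    also have "\<dots> = V l" by (simp add: V_def g_def)
    also have "int (card (?E (Suc l))) * (5 * K0 + 4 * (K1 * ?w)) \<le>
        (8 * 2 ^ (L - Suc l)) * (5 * (K0 * ?w) + 4 * (K1 * ?w))"
    proof (rule mult_mono)
      show "int (card (?E (Suc l))) \<le> 8 * 2 ^ (L - Suc l)"
        using of_nat_mono[OF card_crossing[of r "Suc l" q0 "2 ^ (L - Suc l)"], where 'a = int] by simp
      have "K0 * 1 \<le> K0 * ?w" using assms by (intro mult_left_mono) auto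
      then show "5 * K0 + 4 * (K1 * ?w) \<le> 5 * (K0 * ?w) + 4 * (K1 * ?w)" by simp
    qed (use assms in auto)
    also have "\<dots> = 2 ^ L * ?K"
      unfolding pow' by (simp add: algebra_simps)
    finally have "V (Suc l) \<le> 2 ^ L * ?K + V l" by simp
    with Suc show ?case by (simp add: algebra_simps)
  qed
  have cc0: "cc L (0, 0) = cost K0 K1 r L 0 q0" by (simp add: cc_def)
  have "cost K0 K1 r L 0 q0 \<le> K0 + K1 * 2 ^ L + (if (0, 0) \<in> ?E L then cost K0 K1 r L 0 q0 else 0)"
    using leaf[of 0 L 0] unfolding cc0 by simp
  also have "(if (0, 0) \<in> ?E L then cost K0 K1 r L 0 q0 else 0) \<le> V L"
  proof (cases "(0, 0) \<in> ?E L")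
    case True
    then have "?E L = {(0, 0)}" by (auto simp: crossing_def)
    then show ?thesis by (simp add: V_def cc_def)
  next
    case False
    then show ?thesis
      using cost_nonneg assms by (auto simp: V_def cc_def intro!: sum_nonneg)
  qed
  also have "V L \<le> int L * 2 ^ L * ?K" using V by simp
  also have "K0 + K1 * 2 ^ L \<le> 2 ^ L * ?K"
  proof -
    have "K0 * 1 \<le> K0 * 2 ^ L" using assms by (intro mult_left_mono) auto
    moreover have "0 \<le> K0 * 2 ^ L" "0 \<le> K1 * 2 ^ L" using assms by auto
    ultimately show ?thesis by (simp add: algebra_simps)
  qed
  finally show ?thesis by (simp add: algebra_simps)
qed

text \<open>\<open>i \<le> d\<close> and \<open>n < i + k * d\<close> give
  \<open>n < (k + 1) * d\<close>; \<open>1 \<le> i\<close> and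
  \<open>i + (k - 1) * d \<le> n\<close> give \<open>(k - 1) * d \<le> n - 1\<close>. Then
  \<open>x = i + a * d\<close> lies between \<open>x_min\<close> and
  \<open>x_min + x_span\<close>.\<close>

definition d_min :: int where "d_min = n div (k + 1) + 1"
definition d_max :: int where "d_max = (n - 1) div (k - 1)"
definition x_min :: int where "x_min = 1 + a * d_min"
definition x_span :: int where "x_span = d_max + a * (d_max - d_min)"
text \<open>Residues are represented by the first positions from \<open>x_min\<close> on. Only
  \<open>x_span + 1\<close> positions come into question, so the second bound removes the empty
  classes that a large \<open>c - a\<close> would produce.\<close>

definition classes :: int where "classes = min (c - a) (x_span + 1)"
text \<open>\<open>p\<close> is at most \<open>x_span div (c - a)\<close>, and
  \<open>q - d_min\<close> exceeds \<open>p\<close> by at most \<open>d_max - d_min\<close>; so one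
  square with corner \<open>(0, d_min)\<close> contains all points of a class.\<close>

definition side :: int where "side = x_span div (c - a) + (d_max - d_min) + 1"

lemma valid_d:
  assumes "valid i d"
  shows "d_min \<le> d" "d \<le> d_max"
proof -
  have "n < (k + 1) * d" "(k - 1) * d \<le> n - 1"
    using assms by (auto simp: valid_def algebra_simps)
  moreover have "0 < k + 1" "0 < k - 1" using coeffs ab bc ck by linarith+
  ultimately show "d_min \<le> d" "d \<le> d_max"
    unfolding d_min_def d_max_def
    using zle_div_iff[of "k + 1" d n] zle_div_iff[of "k - 1" d "n - 1"]
    by (auto simp: mult.commute)
qed

text \<open>Division with remainder of \<open>i + a * d - x_min\<close> by \<open>c - a\<close>
  yields \<open>p\<close> and \<open>r - x_min\<close>, and \<open>q = p + d\<close>. So each pair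
  \<open>(i, d)\<close> is found in exactly one class and at exactly one point of its grid.\<close>

lemma sum_sol:
  assumes "side \<le> int w"
  shows "(\<Sum>r\<in>{x_min..<x_min + classes}. sol f r w 0 d_min) =
    int (card {(i, d). valid i d \<and> f (i + a * d) \<and> f (i + b * d) \<and> f (i + c * d)})"
proof -
  let ?A = "{x_min..<x_min + classes} \<times> {..<w} \<times> {..<w}"
  let ?H = "\<lambda>(r, u, v). hit f r (int u) (d_min + int v)"
  let ?B = "{(i, d). valid i d \<and> f (i + a * d) \<and> f (i + b * d) \<and> f (i + c * d)}"
  let ?g = "\<lambda>(r, u, v). (start r (int u) (d_min + int v), d_min + int v - int u)"
  have D: "0 < c - a" using ab bc by simp
  have "(\<Sum>r\<in>{x_min..<x_min + classes}. sol f r w 0 d_min) = (\<Sum>z\<in>?A. of_bool (?H z))"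
    by (simp only: sol_def sum.cartesian_product case_prod_unfold add_0)
  also have "\<dots> = int (card {z \<in> ?A. ?H z})"
    by (rule int_card_filter[symmetric]) simp
  also have "card {z \<in> ?A. ?H z} = card ?B"
  proof (rule bij_betw_same_card[of ?g], rule bij_betw_imageI)
    show "inj_on ?g {z \<in> ?A. ?H z}"
    proof (rule inj_onI)
      fix z z'
      assume zz: "z \<in> {z \<in> ?A. ?H z}" "z' \<in> {z \<in> ?A. ?H z}" "?g z = ?g z'"
      obtain r u v r' u' v' where z: "z = (r, u, v)" "z' = (r', u', v')" by (metis surj_pair)
      have r: "r \<in> {x_min..<x_min + classes}" "r' \<in> {x_min..<x_min + classes}"
        and eq: "start r (int u) (d_min + int v) = start r' (int u') (d_min + int v')"
          "d_min + int v - int u = d_min + int v' - int u'"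
        using zz by (auto simp: z)
      have x: "r + (c - a) * int u = r' + (c - a) * int u'"
      proof -
        have "start r (int u) (d_min + int v) = r + (c - a) * int u - a * (d_min + int v - int u)"
          "start r' (int u') (d_min + int v') = r' + (c - a) * int u' - a * (d_min + int v' - int u')"
          by (simp_all add: start_def algebra_simps)
        then show ?thesis using eq by simp
      qed
      have "\<bar>r - r'\<bar> < c - a" using r by (auto simp: classes_def)
      moreover have "(c - a) dvd (r - r')"
        using x by (intro dvdI[of _ _ "int u' - int u"]) (simp add: algebra_simps)
      ultimately have "r = r'" using dvd_imp_le_int[of "r - r'" "c - a"] D by auto
      with x D have "u = u'" by simp
      with eq \<open>r = r'\<close> show "z = z'" by (simp add: z)
    qed
    show "?g ` {z \<in> ?A. ?H z} = ?B"
    proof (intro equalityI subsetI)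
      fix y assume "y \<in> ?g ` {z \<in> ?A. ?H z}"
      then show "y \<in> ?B"
        by (auto simp: hit_def start_def algebra_simps)
    next
      fix y assume "y \<in> ?B"
      then obtain i d where y: "y = (i, d)" and v: "valid i d"
        and f: "f (i + a * d)" "f (i + b * d)" "f (i + c * d)" by auto
      define o' where "o' = i + a * d - x_min"
      define r p where "r = x_min + o' mod (c - a)" and "p = o' div (c - a)"
      have "a * d_min \<le> a * d" "a * d \<le> a * d_max"
        using valid_d[OF v] a0 by (auto intro: mult_left_mono)
      then have o: "0 \<le> o'" "o' \<le> x_span"
        using v valid_d[OF v] by (auto simp: o'_def x_min_def x_span_def valid_def algebra_simps)
      have p: "0 \<le> p" "p \<le> x_span div (c - a)"
        unfolding p_def using o D by (auto intro: zdiv_mono1 simp: pos_imp_zdiv_nonneg_iff)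
      have mod: "0 \<le> o' mod (c - a)" "o' mod (c - a) < c - a" "o' mod (c - a) \<le> o'"
        using D o by (auto simp: zmod_le_nonneg_dividend)
      then have r: "r \<in> {x_min..<x_min + classes}"
        using o by (auto simp: r_def classes_def)
      have x: "r + (c - a) * p = i + a * d"
        unfolding r_def p_def o'_def by (simp add: add.assoc)
      then have st: "start r p (p + d) = i"
        by (simp add: start_def algebra_simps)
      have u: "nat p < w" "nat (p + d - d_min) < w"
        using p assms valid_d[OF v] by (auto simp: side_def)
      have yz: "r + (c - b) * p + (b - a) * (p + d) = i + b * d" "r + (c - a) * (p + d) = i + c * d"
        using x by (simp_all add: algebra_simps)
      have "hit f r p (p + d)"
        unfolding hit_def x yz st using v f by simp
      then have "(r, nat p, nat (p + d - d_min)) \<in> {z \<in> ?A. ?H z}"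
        using r u p valid_d[OF v] by auto
      moreover have "y = ?g (r, nat p, nat (p + d - d_min))"
        using p valid_d[OF v] st by (auto simp: y)
      ultimately show "y \<in> ?g ` {z \<in> ?A. ?H z}" by blast
    qed
  qed
  finally show ?thesis .
qed

text \<open>The driving estimate is
  \<open>(k - 1) * ((k + 1) * (d_max - d_min)) \<le> 2 * n\<close>. As \<open>a\<close> and
  \<open>c - a\<close> are below \<open>k\<close>, it leaves room for two factors
  \<open>c - a\<close> on \<open>d_max - d_min\<close> and for one on \<open>x_span\<close>. The
  \<open>1\<close> in \<open>side\<close> contributes \<open>classes * (c - a)\<close>, where the
  bound \<open>x_span + 1\<close> on \<open>classes\<close> is used.\<close>

lemma
  assumes "d_min \<le> d_max"
  shows classes_side: "classes * ((c - a) * side) \<le> 9 * n"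
    and side_pos: "1 \<le> side" and side_le: "side \<le> 6 * n"
    and d_min_pos: "1 \<le> d_min" and d_max_le: "d_max \<le> n"
    and x_span_nonneg: "0 \<le> x_span" and x_span_le: "x_span \<le> 3 * n"
proof -
  let ?e = "d_max - d_min"
  have k: "3 \<le> k" "1 \<le> n" using a0 ab bc ck kn by linarith+
  have D: "2 \<le> c - a" "c - a \<le> k - 1" using a0 ab bc ck by linarith+
  show dm: "1 \<le> d_min" using k by (simp add: d_min_def pos_imp_zdiv_nonneg_iff)
  have dM: "d_max * (k - 1) \<le> n - 1"
    using k zle_div_iff[of "k - 1" d_max "n - 1"] by (simp add: d_max_def)
  have "n < d_min * (k + 1)"
    using k zle_div_iff[of "k + 1" d_min n] by (simp add: d_min_def)
  then have "(k - 1) * (n + 1) \<le> (k - 1) * (d_min * (k + 1))"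
    using k by (intro mult_left_mono) auto
  moreover have "(k + 1) * (d_max * (k - 1)) \<le> (k + 1) * (n - 1)"
    using dM k by (intro mult_left_mono) auto
  \<comment> \<open>The outer sides differ by
    \<open>(k + 1) * (n - 1) - (k - 1) * (n + 1) = 2 * n - 2 * k\<close>.\<close>
  ultimately have e: "(k - 1) * ((k + 1) * ?e) \<le> 2 * n"
    using k by (simp add: algebra_simps)
  have "(k - 1) * ((k - 1) * ?e) \<le> (k - 1) * ((k + 1) * ?e)"
    using assms k by (intro mult_left_mono mult_right_mono) auto
  with e have e': "(k - 1) * ((k - 1) * ?e) \<le> 2 * n" by simp
  have "(c - a) * ((c - a) * ?e) \<le> (k - 1) * ((k - 1) * ?e)" "(c - a) * (a * ?e) \<le> (k - 1) * ((k - 1) * ?e)"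
    using assms D a0 ab bc ck by (intro mult_mono mult_nonneg_nonneg; simp)+
  with e' have e1: "(c - a) * ((c - a) * ?e) \<le> 2 * n" "(c - a) * (a * ?e) \<le> 2 * n" by linarith+
  have dM0: "0 \<le> d_max" "0 \<le> ?e" using dm assms by linarith+
  have "(c - a) * d_max \<le> (k - 1) * d_max" using D dM0 by (intro mult_right_mono) auto
  then have Dd: "(c - a) * d_max \<le> n" using dM by (simp add: mult.commute)
  have span: "(c - a) * x_span \<le> 3 * n"
    using e1 Dd by (simp add: x_span_def distrib_left)
  show span0: "0 \<le> x_span" using dM0 a0 by (simp add: x_span_def)
  have le: "y \<le> (c - a) * y" if "0 \<le> y" for y
    using mult_right_mono[of 1 "c - a" y] D that by simp
  show "x_span \<le> 3 * n" using le[OF span0] span by simp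
  show "d_max \<le> n" using le[OF dM0(1)] Dd by simp
  have div: "(c - a) * (x_span div (c - a)) \<le> x_span" "0 \<le> x_span div (c - a)"
    using D span0 zle_div_iff[of "c - a" "x_span div (c - a)" x_span]
    by (auto simp: pos_imp_zdiv_nonneg_iff mult.commute)
  show "1 \<le> side" using div dM0 by (simp add: side_def)
  have "0 \<le> (c - a) * ?e" using D dM0 by simp
  with le[OF dM0(2)] le[OF this] have "?e \<le> 2 * n" using e1 by simp
  moreover have "x_span div (c - a) \<le> 3 * n"
    using le[OF div(2)] le[OF span0] div span by linarith
  ultimately show "side \<le> 6 * n" using k by (simp add: side_def)
  have "(c - a) * side = (c - a) * (x_span div (c - a)) + (c - a) * ?e + (c - a)"
    by (simp add: side_def distrib_left)
  also have "\<dots> \<le> x_span + (c - a) * ?e + (c - a)" using div by simp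
  finally have "classes * ((c - a) * side) \<le> classes * (x_span + (c - a) * ?e + (c - a))"
    using D span0 by (intro mult_left_mono) (auto simp: classes_def)
  also have "\<dots> = classes * x_span + classes * ((c - a) * ?e) + classes * (c - a)"
    by (simp add: distrib_left)
  also have "\<dots> \<le> (c - a) * x_span + (c - a) * ((c - a) * ?e) + (x_span + 1) * (c - a)"
    using D span0 dM0 by (intro add_mono mult_right_mono) (auto simp: classes_def)
  \<comment> \<open>The last two terms come from \<open>(x_span + 1) * (c - a)\<close>, split into
    \<open>3 * n\<close> and \<open>c - a \<le> n\<close>.\<close>
  also have "\<dots> \<le> 3 * n + 2 * n + 3 * n + n"
    using span e1 D ck kn k by (simp add: algebra_simps)
  finally show "classes * ((c - a) * side) \<le> 9 * n" by simp
qed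

end


section \<open>Traversing the quadtree\<close>

text \<open>The language has no procedures, so the quadtree is traversed with an explicit stack of
  squares. The suffixes \<open>A\<close> and \<open>B\<close> stand for the corners
  \<open>(p, q + w - 1)\<close> and \<open>(p + w - 1, q)\<close>.\<close>

definition quad_pop :: com where
  "quad_pop =
    (''top'' ::= Var ''top'' \<ominus> Const 1;;
     ''p'' ::= Read ''sp'' (Var ''top'');;
     ''q'' ::= Read ''sq'' (Var ''top'');;
     ''w'' ::= Read ''sw'' (Var ''top'');;
     ''e'' ::= Var ''w'' \<ominus> Const 1;;
     ''iA'' ::= Var ''r'' \<oplus> Var ''c'' \<otimes> Var ''p'' \<ominus> Var ''a'' \<otimes> (Var ''q'' \<oplus> Var ''e'');;
     ''dA'' ::= Var ''q'' \<oplus> Var ''e'' \<ominus> Var ''p'';;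
     ''iB'' ::= Var ''r'' \<oplus> Var ''c'' \<otimes> (Var ''p'' \<oplus> Var ''e'') \<ominus> Var ''a'' \<otimes> Var ''q'';;
     ''dB'' ::= Var ''q'' \<ominus> (Var ''p'' \<oplus> Var ''e''))"

definition quad_inside :: bexp where
  "quad_inside =
    And (Not (Less (Var ''dA'') (Var ''iA''))) (And (Not (Less (Var ''iB'') (Const 1)))
      (And (Not (Less (Var ''n'') (Var ''iB'' \<oplus> (Var ''k'' \<ominus> Const 1) \<otimes> Var ''dB'')))
        (Less (Var ''n'') (Var ''iA'' \<oplus> Var ''k'' \<otimes> Var ''dA''))))"

definition quad_full :: bexp where
  "quad_full =
    And (Not (Less (Var ''dB'') (Var ''iB''))) (And (Not (Less (Var ''iA'') (Const 1)))
      (And (Not (Less (Var ''n'') (Var ''iA'' \<oplus> (Var ''k'' \<ominus> Const 1) \<otimes> Var ''dA'')))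
        (Less (Var ''n'') (Var ''iB'' \<oplus> Var ''k'' \<otimes> Var ''dB''))))"

definition quad_push :: "aexp \<Rightarrow> aexp \<Rightarrow> com" where
  "quad_push e f =
    (Write ''sp'' (Var ''top'') e;; Write ''sq'' (Var ''top'') f;; Write ''sw'' (Var ''top'') (Var ''w'');;
     ''top'' ::= Var ''top'' \<oplus> Const 1)"

definition quad_split :: com where
  "quad_split =
    (''w'' ::= Div (Var ''w'') (Const 2);;
     quad_push (Var ''p'') (Var ''q'');;
     quad_push (Var ''p'') (Var ''q'' \<oplus> Var ''w'');;
     quad_push (Var ''p'' \<oplus> Var ''w'') (Var ''q'');;
     quad_push (Var ''p'' \<oplus> Var ''w'') (Var ''q'' \<oplus> Var ''w''))"

definition quad_body :: "com \<Rightarrow> com" where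
  "quad_body cp = (quad_pop;; If quad_inside (If quad_full (full_cell cp) quad_split) Skip)"

definition quad :: "com \<Rightarrow> com" where
  "quad cp = While (Less (Const 0) (Var ''top'')) (quad_body cp)"

lemmas quad_body_defs = quad_body_def quad_pop_def quad_split_def quad_push_def cell_defs
lemmas quad_defs = quad_def quad_body_defs

text \<open>The head of the list is the top of the stack, stored at index \<open>length cs\<close>,
  so the entries below stay in place under pushing and popping. Sides are powers of two, recorded by
  their exponents.\<close>

fun stk :: "state \<Rightarrow> (nat \<times> int \<times> int) list \<Rightarrow> bool" where
  "stk s [] \<longleftrightarrow> True"
| "stk s ((l, p, q) # cs) \<longleftrightarrow> arr s ''sp'' (length cs) = p \<and> arr s ''sq'' (length cs) = q \<and>
     arr s ''sw'' (length cs) = 2 ^ l \<and> stk s cs"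

lemma stk_cong:
  "stk s cs \<Longrightarrow> (\<And>i. i < length cs \<Longrightarrow> arr s' ''sp'' i = arr s ''sp'' i \<and>
     arr s' ''sq'' i = arr s ''sq'' i \<and> arr s' ''sw'' i = arr s ''sw'' i) \<Longrightarrow> stk s' cs"
  by (induction s cs rule: stk.induct) auto

section \<open>The stack operations\<close>

context word_bounds
begin

lemma wp_quad_pop:
  assumes "scalar s ''top'' = int T + 1" "arr s ''sp'' T = p" "arr s ''sq'' T = q" "arr s ''sw'' T = w"
    and st: "scalar s ''r'' = r" "scalar s ''a'' = a" "scalar s ''c'' = c"
    and small: "int T + 1 \<le> N" "\<bar>p\<bar> \<le> N" "\<bar>q\<bar> \<le> N" "\<bar>w\<bar> \<le> N" "\<bar>w - 1\<bar> \<le> N" "\<bar>r\<bar> \<le> N" "\<bar>a\<bar> \<le> N" "\<bar>c\<bar> \<le> N"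
  shows "wp B quad_pop (\<lambda>t' s'. t' \<le> t + 60 \<and>
    scalar s' ''top'' = int T \<and> scalar s' ''p'' = p \<and> scalar s' ''q'' = q \<and> scalar s' ''w'' = w \<and>
    scalar s' ''iA'' = r + c * p - a * (q + w - 1) \<and> scalar s' ''dA'' = q + w - 1 - p \<and>
    scalar s' ''iB'' = r + c * (p + w - 1) - a * q \<and> scalar s' ''dB'' = q - (p + w - 1)) t s"
proof -
  have T: "int T \<le> N" using small(1) by simp
  show ?thesis
    unfolding quad_pop_def
    by (simp add: asafe_ok asafe_Read_ok assms T)
qed

lemma wp_quad_push:
  assumes "scalar s ''top'' = int (length cs)" "scalar s ''w'' = 2 ^ l" "stk s cs"
    and "asafe B e s" "asafe B f s"
    and e: "\<And>s'. (\<forall>x. scalar s' x = scalar s x) \<Longrightarrow> asafe B e s' \<and> aval e s' = p \<and> asafe B f s' \<and> aval f s' = q"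
    and "int (length cs) + 1 \<le> N" "atime e \<le> 3" "atime f \<le> 3"
  shows "wp B (quad_push e f) (\<lambda>t' s'. t' \<le> t + 20 \<and>
    scalar s' ''top'' = int (length cs) + 1 \<and> stk s' ((l, p, q) # cs)) t s"
proof -
  have "int (length cs) \<le> N" using assms(7) by simp
  moreover have "stk (seta ''sw'' (length cs) (2 ^ l) (seta ''sq'' (length cs) q (seta ''sp'' (length cs) p s))) cs"
    "stk (setv ''top'' x (seta ''sw'' (length cs) (2 ^ l) (seta ''sq'' (length cs) q (seta ''sp'' (length cs) p s)))) cs"
    for x
    using assms(3) by (auto elim!: stk_cong)
  ultimately show ?thesis
    unfolding quad_push_def using assms(8,9) e[of s] e[of "seta ''sp'' (length cs) p s"]
    by (simp add: asafe_ok asafe_Read_ok assms(1,2))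
qed

lemma wp_quad_split:
  assumes "scalar s ''top'' = int (length cs)" "scalar s ''w'' = 2 ^ Suc l" "stk s cs"
    "scalar s ''p'' = p" "scalar s ''q'' = q"
    and small: "int (length cs) + 4 \<le> N" "2 ^ Suc l \<le> N" "\<bar>p\<bar> \<le> N" "\<bar>q\<bar> \<le> N"
  shows "wp B quad_split (\<lambda>t' s'. t' \<le> t + 84 \<and> (\<exists>cs'. cs' =
    (l, p + 2 ^ l, q + 2 ^ l) # (l, p + 2 ^ l, q) # (l, p, q + 2 ^ l) # (l, p, q) # cs \<and>
    scalar s' ''top'' = int (length cs') \<and> stk s' cs')) t s"
proof -
  have "(0::int) \<le> 2 ^ l" by simp
  then have l: "2 ^ l \<le> N" using small(2) unfolding power_Suc by linarith
  define s1 where "s1 = setv ''w'' (2 ^ l) s"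
  have 1: "scalar s1 ''top'' = int (length cs)" "scalar s1 ''w'' = 2 ^ l" "stk s1 cs"
    "scalar s1 ''p'' = p" "scalar s1 ''q'' = q"
    using assms(1-5) by (auto simp: s1_def elim: stk_cong)
  have "wp B (quad_push (Var ''p'') (Var ''q'')) (\<lambda>t' s'. t' \<le> t + 4 + 20 \<and>
      scalar s' ''top'' = int (length cs) + 1 \<and> stk s' ((l, p, q) # cs)) (t + 4) s1"
    using 1 small by (intro wp_quad_push) auto
  then have "wp B (quad_push (Var ''p'') (Var ''q'');;
     quad_push (Var ''p'') (Var ''q'' \<oplus> Var ''w'');;
     quad_push (Var ''p'' \<oplus> Var ''w'') (Var ''q'');;
     quad_push (Var ''p'' \<oplus> Var ''w'') (Var ''q'' \<oplus> Var ''w'')) (\<lambda>t' s'. t' \<le> t + 84 \<and> (\<exists>cs'. cs' =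
    (l, p + 2 ^ l, q + 2 ^ l) # (l, p + 2 ^ l, q) # (l, p, q + 2 ^ l) # (l, p, q) # cs \<and>
    scalar s' ''top'' = int (length cs') \<and> stk s' cs')) (t + 4) s1"
    unfolding wp_Seq
  proof (rule wp_conseq, goal_cases)
    case (1 t2 s2)
    let ?cs2 = "(l, p, q) # cs"
    have s2: "scalar s2 ''w'' = 2 ^ l" "scalar s2 ''p'' = p" "scalar s2 ''q'' = q"
      using 1(2) \<open>scalar s1 ''w'' = 2 ^ l\<close> \<open>scalar s1 ''p'' = p\<close> \<open>scalar s1 ''q'' = q\<close>
      by (simp_all add: quad_push_def same_scalar)
    have "wp B (quad_push (Var ''p'') (Var ''q'' \<oplus> Var ''w'')) (\<lambda>t' s'. t' \<le> t2 + 20 \<and>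
        scalar s' ''top'' = int (length ?cs2) + 1 \<and> stk s' ((l, p, q + 2 ^ l) # ?cs2)) t2 s2"
      using 1(1) s2 small l by (intro wp_quad_push) (auto simp: asafe_ok)
    then show ?case
    proof (rule wp_conseq, goal_cases)
      case (1 t3 s3)
      let ?cs3 = "(l, p, q + 2 ^ l) # ?cs2"
      have s3: "scalar s3 ''w'' = 2 ^ l" "scalar s3 ''p'' = p" "scalar s3 ''q'' = q"
        using 1(2) s2 by (simp_all add: quad_push_def same_scalar)
      have "wp B (quad_push (Var ''p'' \<oplus> Var ''w'') (Var ''q'')) (\<lambda>t' s'. t' \<le> t3 + 20 \<and>
          scalar s' ''top'' = int (length ?cs3) + 1 \<and> stk s' ((l, p + 2 ^ l, q) # ?cs3)) t3 s3"
        using 1(1) s3 small l by (intro wp_quad_push) (auto simp: asafe_ok)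
      then show ?case
      proof (rule wp_conseq, goal_cases)
        case (1 t4 s4)
        let ?cs4 = "(l, p + 2 ^ l, q) # ?cs3"
        have s4: "scalar s4 ''w'' = 2 ^ l" "scalar s4 ''p'' = p" "scalar s4 ''q'' = q"
          using 1(2) s3 by (simp_all add: quad_push_def same_scalar)
        have "wp B (quad_push (Var ''p'' \<oplus> Var ''w'') (Var ''q'' \<oplus> Var ''w'')) (\<lambda>t' s'. t' \<le> t4 + 20 \<and>
            scalar s' ''top'' = int (length ?cs4) + 1 \<and> stk s' ((l, p + 2 ^ l, q + 2 ^ l) # ?cs4)) t4 s4"
          using 1(1) s4 small l by (intro wp_quad_push) (auto simp: asafe_ok)
        then show ?case
        proof (rule wp_conseq, goal_cases)
          case (1 t5 s5)
          then show ?case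
            using \<open>t4 \<le> t3 + 20 \<and> _\<close> \<open>t3 \<le> t2 + 20 \<and> _\<close> \<open>t2 \<le> t + 4 + 20 \<and> _\<close> by simp
        qed
      qed
    qed
  qed
  moreover have "asafe B (Div (Var ''w'') (Const 2)) s"
    using assms(2) small(2) by (intro asafe_ok) auto
  ultimately show ?thesis
    unfolding quad_split_def s1_def using assms(2) by (simp add: add.commute)
qed

end

lemma length_le_sum_list: "(\<And>x. x \<in> set xs \<Longrightarrow> 1 \<le> f x) \<Longrightarrow> length xs \<le> sum_list (map f xs)"
  for f :: "'a \<Rightarrow> nat"
  by (induction xs) force+

text \<open>\<open>X\<close> bounds positions, sides and offsets. The corner tests involve products
  of two such numbers, and the stack holds at most \<open>8 ^ L = (2 ^ L) ^ 3\<close> squares; both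
  fit because \<open>X ^ 3 \<le> N\<close>.\<close>

locale cadence_machine = conv_machine B N cp C lg + cadence n k a b c
  for B N cp C lg n k a b c +
  fixes X :: int
  assumes nX: "n \<le> X" and X8: "8 \<le> X" and XN: "X ^ 3 \<le> N"
begin

lemma X_bounds: "8 * X * X \<le> N" "X * X \<le> N" "8 * X \<le> N" "X \<le> N"
proof -
  have "8 * (X * X) \<le> X ^ 3" "8 * X \<le> X * X"
    using X8 by (auto simp: power3_eq_cube intro!: mult_right_mono)
  then show "8 * X * X \<le> N" "X * X \<le> N" "8 * X \<le> N" "X \<le> N"
    using XN X8 unfolding mult.assoc by linarith+
qed

definition env :: "state \<Rightarrow> bool" where
  "env s \<longleftrightarrow> scalar s ''n'' = n \<and> scalar s ''k'' = k \<and> scalar s ''a'' = a \<and> scalar s ''b'' = b \<and>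
     scalar s ''c'' = c \<and> scalar s ''D'' = c - a \<and> scalar s ''al'' = c - b \<and> scalar s ''be'' = b - a"

lemma env_same:
  assumes "env s" "same Y Z s s'"
    and "''n'' \<notin> Y" "''k'' \<notin> Y" "''a'' \<notin> Y" "''b'' \<notin> Y" "''c'' \<notin> Y" "''D'' \<notin> Y" "''al'' \<notin> Y" "''be'' \<notin> Y"
  shows "env s'"
  using assms by (simp add: env_def same_scalar)

lemma params_le:
  "0 \<le> n" "n \<le> N" "0 \<le> k" "k \<le> N" "a \<le> N" "c \<le> N" "b \<le> N" "a \<le> X" "c \<le> X" "k \<le> X"
  using coeffs a0 ab bc ck kn nX X_bounds by linarith+

lemma quad_tests:
  assumes "env s"
    "scalar s ''iA'' = start r p (q + w - 1)" "scalar s ''dA'' = q + w - 1 - p"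
    "scalar s ''iB'' = start r (p + w - 1) q" "scalar s ''dB'' = q - (p + w - 1)"
    and bounds: "0 \<le> r" "r \<le> X" "0 \<le> p" "0 \<le> q" "1 \<le> w" "p + w \<le> X" "q + w \<le> 2 * X"
  shows "bsafe B quad_inside s" "bval quad_inside s \<longleftrightarrow> \<not> outside r w p q"
    "bsafe B quad_full s" "bval quad_full s \<longleftrightarrow> full r w p q"
proof -
  have st: "\<bar>start r p' q'\<bar> \<le> N" if "0 \<le> p'" "p' \<le> X" "0 \<le> q'" "q' \<le> 2 * X" for p' q'
  proof -
    have "0 \<le> c * p'" "0 \<le> a * q'" using coeffs that by simp_all
    moreover have "c * p' \<le> X * X" "a * q' \<le> X * (2 * X)"
      using coeffs that params_le by (intro mult_mono; simp)+
    moreover have "X * 1 \<le> X * X" using X8 by (intro mult_left_mono) auto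
    then have "r \<le> X * X" using bounds by linarith
    ultimately show ?thesis using X_bounds(1) bounds by (simp add: start_def)
  qed
  have iA: "\<bar>start r p (q + w - 1)\<bar> \<le> N" and iB: "\<bar>start r (p + w - 1) q\<bar> \<le> N"
    using bounds by (intro st; simp)+
  have d: "\<bar>q + w - 1 - p\<bar> \<le> N" "\<bar>q - (p + w - 1)\<bar> \<le> N"
    using bounds X_bounds by linarith+
  have sc: "scalar s ''n'' = n" "scalar s ''k'' = k" using assms(1) by (simp_all add: env_def)
  show "bsafe B quad_inside s" "bsafe B quad_full s"
    unfolding quad_inside_def quad_full_def
    using iA iB d by (simp_all add: asafe_ok assms(2-5) sc params_le)
  show "bval quad_inside s \<longleftrightarrow> \<not> outside r w p q" "bval quad_full s \<longleftrightarrow> full r w p q"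
    unfolding quad_inside_def quad_full_def outside_def full_def Let_def
    by (auto simp: assms(2-5) sc)
qed

lemma wp_full_cell_sol:
  fixes r ch :: int and s :: state
  defines "f \<equiv> \<lambda>x. arr s ''S'' (nat x) = ch"
  assumes env: "env s" and full: "full r (2 ^ l) p q"
    and st: "scalar s ''r'' = r" "scalar s ''p'' = p" "scalar s ''q'' = q" "scalar s ''w'' = 2 ^ l"
      "scalar s ''ch'' = ch"
    and bounds: "0 \<le> r" "r \<le> X" "0 \<le> p" "0 \<le> q" "p + 2 ^ l \<le> X" "q + 2 ^ l \<le> 2 * X"
    and cnt: "0 \<le> scalar s ''count''" "scalar s ''count'' + sol f r (2 ^ l) p q \<le> N"
  shows "wp B (full_cell cp) (\<lambda>t' s'. t' \<le> t + (C + 200) * ((c - a) * lg) * 2 ^ l \<and>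
    scalar s' ''count'' = scalar s ''count'' + sol f r (2 ^ l) p q) t s"
proof -
  define al be where "al = nat (c - b)" and "be = nat (b - a)"
  have al: "int al = c - b" "int be = b - a" "int (al + be) = c - a"
    using ab bc by (auto simp: al_def be_def)
  have w: "(1::int) \<le> 2 ^ l" by simp
  have "valid (start r p q) (q - p)" using full w by (intro full_valid[of p p "2 ^ l" q q]) auto
  note pos = valid_positions[OF this]
  have sum: "sol f r (2 ^ l) p q = (\<Sum>u<2 ^ l. \<Sum>v<2 ^ l.
      of_bool (f (r + int (al + be) * (p + int u)) \<and>
        f (r + int al * p + int be * q + int (al * u + be * v)) \<and> f (r + int (al + be) * (q + int v))))"
    using full by (subst sol_full) (simp_all add: al algebra_simps)
  have m: "int ((al + be) * 2 ^ l) = (c - a) * 2 ^ l" using al(3) by simp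
  have "(c - a) * 2 ^ l \<le> X * X"
    using bounds params_le coeffs by (intro mult_mono) auto
  then have mN: "int ((al + be) * 2 ^ l) \<le> N" using X_bounds(2) unfolding m by linarith
  have "wp B (full_cell cp) (\<lambda>t' s'. t' \<le> t + (C + 200) * (int ((al + be) * 2 ^ l) * lg) \<and>
    scalar s' ''count'' = scalar s ''count'' + sol f r (2 ^ l) p q) t s"
    unfolding sum unfolding f_def
  proof (rule wp_full_cell)
    show "scalar s ''count'' + (\<Sum>u<2 ^ l. \<Sum>v<2 ^ l.
      of_bool (arr s ''S'' (nat (r + int (al + be) * (p + int u))) = ch \<and>
        arr s ''S'' (nat (r + int al * p + int be * q + int (al * u + be * v))) = ch \<and>
        arr s ''S'' (nat (r + int (al + be) * (q + int v))) = ch)) \<le> N"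
      using cnt(2) unfolding sum unfolding f_def .
    show "int ((al + be) * 2 ^ l) \<le> N" by (rule mN)
    show "\<bar>r\<bar> \<le> N" "\<bar>p\<bar> \<le> N" "\<bar>q\<bar> \<le> N" using bounds X_bounds w by linarith+
    show "0 \<le> r + int (al + be) * p" "0 \<le> r + int (al + be) * q" "0 \<le> r + int al * p + int be * q"
      using pos unfolding al by linarith+
    show "scalar s ''D'' = int (al + be)" using env al(3) by (simp add: env_def)
  qed (use st env al(1,2) cnt ab bc in \<open>auto simp: env_def\<close>)
  moreover have "(C + 200) * ((c - a) * 2 ^ l * lg) = (C + 200) * ((c - a) * lg) * 2 ^ l"
    by simp
  ultimately show ?thesis
    unfolding m by metis
qed

lemma wp_quad:
  fixes r ch :: int and s :: state and q0 cnt :: int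
  defines "f \<equiv> \<lambda>x. arr s ''S'' (nat x) = ch"
  defines "co \<equiv> cost 300 ((C + 200) * ((c - a) * lg)) r"
  assumes env: "env s"
    and st: "scalar s ''r'' = r" "scalar s ''ch'' = ch" "scalar s ''top'' = 1" "scalar s ''count'' = cnt"
    and stk: "stk s [(L, 0, q0)]"
    and bounds: "0 \<le> r" "r \<le> X" "2 ^ L \<le> X" "0 \<le> q0" "q0 \<le> X"
    and cnt: "0 \<le> cnt" "cnt + sol f r (2 ^ L) 0 q0 \<le> N"
  shows "wp B (quad cp) (\<lambda>t' s'. t' \<le> t + co L 0 q0 + 4 \<and>
    scalar s' ''count'' = cnt + sol f r (2 ^ L) 0 q0) t s"
proof -
  let ?sol = "\<lambda>(l, p, q). sol f r (2 ^ l) p q"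
  let ?co = "\<lambda>(l, p, q). co l p q"
  \<comment> \<open>Splitting replaces \<open>8 ^ Suc l\<close> by \<open>4 * 8 ^ l\<close>, a
    strict decrease that base 4 would not give, so the total weight proves termination. Every weight
    is at least 1, so it also bounds the height of the stack.\<close>
  let ?sz = "\<lambda>(l, p, q). 8 ^ l :: nat"
  let ?box = "\<lambda>(l, p, q). 0 \<le> p \<and> p + 2 ^ l \<le> 2 ^ L \<and> q0 \<le> q \<and> q + 2 ^ l \<le> q0 + 2 ^ L"
  \<comment> \<open>A balance: time spent plus the costs still pending stays within the total cost,
    and the count plus the solutions still pending equals the final count.\<close>
  let ?I = "\<lambda>cs t' s'. scalar s' ''top'' = int (length cs) \<and> stk s' cs \<and> (\<forall>x\<in>set cs. ?box x) \<and>
    t' + sum_list (map ?co cs) \<le> t + co L 0 q0 \<and> 0 \<le> scalar s' ''count'' \<and>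
    scalar s' ''count'' + sum_list (map ?sol cs) = cnt + sol f r (2 ^ L) 0 q0 \<and>
    sum_list (map ?sz cs) \<le> 8 ^ L"
  have K1: "0 \<le> (C + 200) * ((c - a) * lg)"
    using C_nonneg lg_pos ab bc by simp
  then have co_nn: "0 \<le> co l p q" for l p q
    unfolding co_def by (intro cost_nonneg) auto
  have co_sum: "0 \<le> sum_list (map ?co cs)" and sol_sum: "0 \<le> sum_list (map ?sol cs)" for cs
    using co_nn sol_nonneg by (auto intro!: sum_list_nonneg)
  have size: "int (length cs) \<le> N" if "sum_list (map ?sz cs) \<le> 8 ^ L" for cs
  proof -
    have "length cs \<le> sum_list (map ?sz cs)" by (rule length_le_sum_list) auto
    with that have "int (length cs) \<le> int (8 ^ L)" by linarith
    also have "int (8 ^ L) = (2 ^ 3) ^ L" by simp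
    also have "\<dots> = (2 ^ L) ^ 3" by (simp only: power_mult[symmetric] mult.commute)
    also have "\<dots> \<le> X ^ 3" using bounds by (intro power_mono) auto
    finally show ?thesis using XN by simp
  qed
  show ?thesis
    unfolding quad_def
  proof (rule wp_While[where I = ?I and f = "\<lambda>cs. sum_list (map ?sz cs)" and g = "[(L, 0, q0)]"], goal_cases)
    case 1
    show ?case using st stk cnt bounds by auto
  next
    case 2
    then show ?case by simp
  next
    case (3 cs t1 s1)
    then obtain l p q cs' where cs: "cs = (l, p, q) # cs'"
      by (cases cs) auto
    have I: "scalar s1 ''top'' = int (length cs') + 1" "stk s1 ((l, p, q) # cs')"
        "\<forall>x\<in>set cs'. ?box x" "?box (l, p, q)"
        "t1 + (co l p q + sum_list (map ?co cs')) \<le> t + co L 0 q0" "0 \<le> scalar s1 ''count''"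
        "scalar s1 ''count'' + (sol f r (2 ^ l) p q + sum_list (map ?sol cs')) = cnt + sol f r (2 ^ L) 0 q0"
        "8 ^ l + sum_list (map ?sz cs') \<le> 8 ^ L"
      using 3(1) by (auto simp: cs)
    have len: "int (length cs') + 1 \<le> N" using size[of cs] 3(1) by (simp add: cs)
    have same1: "same (svars (quad_body cp)) (avars (quad_body cp)) s s1" by (rule 3(2))
    have same1': "scalar s1 ''r'' = r" "scalar s1 ''ch'' = ch" "arr s1 ''S'' = arr s ''S''" "env s1"
      using same1 st env
      by (auto simp: quad_body_defs same_scalar same_arr elim: env_same)
    have bt0: "t1 + int (btime (Less (Const 0) (Var ''top''))) + 1 = t1 + 4" by simp
    have w: "(1::int) \<le> 2 ^ l" by simp
    have bd: "0 \<le> p" "0 \<le> q" "p + 2 ^ l \<le> X" "q + 2 ^ l \<le> 2 * X"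
      using I(4) bounds by auto
    have "wp B quad_pop (\<lambda>t' s'. t' \<le> t1 + 4 + 60 \<and>
      scalar s' ''top'' = int (length cs') \<and> scalar s' ''p'' = p \<and> scalar s' ''q'' = q \<and> scalar s' ''w'' = 2 ^ l \<and>
      scalar s' ''iA'' = r + c * p - a * (q + 2 ^ l - 1) \<and> scalar s' ''dA'' = q + 2 ^ l - 1 - p \<and>
      scalar s' ''iB'' = r + c * (p + 2 ^ l - 1) - a * q \<and> scalar s' ''dB'' = q - (p + 2 ^ l - 1)) (t1 + 4) s1"
    proof (rule wp_quad_pop)
      show "\<bar>p\<bar> \<le> N" "\<bar>q\<bar> \<le> N" "\<bar>2 ^ l\<bar> \<le> N" "\<bar>2 ^ l - 1\<bar> \<le> N" "\<bar>r\<bar> \<le> N" "\<bar>a\<bar> \<le> N" "\<bar>c\<bar> \<le> N"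
        using bd w bounds X_bounds params_le coeffs by linarith+
    qed (use I len same1' in \<open>auto simp: env_def\<close>)
    then show ?case
      unfolding quad_body_def wp_Seq bt0
    proof (rule wp_conseq, goal_cases)
      case (1 t2 s2)
      note s2 = 1(1)
      have same2: "env s2" "scalar s2 ''r'' = r" "scalar s2 ''ch'' = ch" "arr s2 ''S'' = arr s ''S''"
          "stk s2 ((l, p, q) # cs')" "scalar s2 ''count'' = scalar s1 ''count''"
        using 1(2) same1' I(2)
        by (auto simp: quad_pop_def same_scalar same_arr elim!: env_same stk_cong)
      have sc: "scalar s2 ''iA'' = start r p (q + 2 ^ l - 1)" "scalar s2 ''dA'' = q + 2 ^ l - 1 - p"
          "scalar s2 ''iB'' = start r (p + 2 ^ l - 1) q" "scalar s2 ''dB'' = q - (p + 2 ^ l - 1)"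
        using s2 by (simp_all add: start_def)
      note tests = quad_tests[OF same2(1) sc bounds(1,2) bd(1,2) w bd(3,4)]
      have bt: "btime quad_inside = 28" "btime quad_full = 28"
        by (simp_all add: quad_inside_def quad_full_def)
      have fS: "(\<lambda>x. arr s2 ''S'' (nat x) = ch) = f" by (simp add: f_def same2)
      consider "outside r (2 ^ l) p q" | "full r (2 ^ l) p q" "\<not> outside r (2 ^ l) p q" |
        l' where "l = Suc l'" "\<not> outside r (2 ^ l) p q" "\<not> full r (2 ^ l) p q"
        using outside_or_full[of r p q] by (cases l) auto
      then show ?case
      proof cases
        assume o: "outside r (2 ^ l) p q"
        have "sol f r (2 ^ l) p q = 0" using sol_outside[of r "2 ^ l" p q] o by simp
        \<comment> \<open>The 300 per cell pays for the loop test, the pop, both cell tests and a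
          split, together at most 206 units.\<close>
        moreover have "300 \<le> co l p q" using o by (cases l) (simp_all add: co_def)
        ultimately have "?I cs' (t2 + int (btime quad_inside) + 1 + 1) s2"
          using I s2 same2 bt by auto
        moreover have "sum_list (map ?sz cs') < sum_list (map ?sz cs)" by (simp add: cs)
        ultimately show ?thesis
          unfolding wp_If wp_Skip using tests o by (auto simp: case_prod_unfold)
      next
        assume f: "full r (2 ^ l) p q" "\<not> outside r (2 ^ l) p q"
        have "wp B (full_cell cp) (\<lambda>t' s'. t' \<le> 58 + t2 + (C + 200) * ((c - a) * lg) * 2 ^ l \<and>
            scalar s' ''count'' = scalar s2 ''count'' + sol f r (2 ^ l) p q) (58 + t2) s2"
          using f(1) same2 s2 bounds bd I(6,7) sol_sum[of cs'] cnt
          unfolding fS[symmetric] by (intro wp_full_cell_sol) (simp_all add: fS)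
        then have "wp B (full_cell cp) (\<lambda>t'' s''. \<exists>g'. ?I g' t'' s'' \<and>
            sum_list (map ?sz g') < sum_list (map ?sz cs)) (58 + t2) s2"
        proof (rule wp_conseq, goal_cases)
          case (1 t3 s3)
          have co: "co l p q = 300 + (C + 200) * ((c - a) * lg) * 2 ^ l"
            using f outside_or_full by (cases l) (auto simp: co_def)
          have "stk s3 cs'" "scalar s3 ''top'' = int (length cs')"
            using 1(2) same2(5) s2
            by (auto simp: cell_defs same_scalar same_arr
                elim!: stk_cong)
          moreover have "t3 + sum_list (map ?co cs') \<le> t + co L 0 q0"
            using 1(1) s2 I(5) co by simp
          moreover have "0 \<le> scalar s3 ''count''"
            "scalar s3 ''count'' + sum_list (map ?sol cs') = cnt + sol f r (2 ^ L) 0 q0"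
            using 1(1) same2(6) I(6,7) sol_nonneg[of f r "2 ^ l" p q] by simp_all
          moreover have "sum_list (map ?sz cs') \<le> 8 ^ L" "sum_list (map ?sz cs') < sum_list (map ?sz cs)"
            using I(8) by (simp_all add: cs)
          ultimately show ?case using I(3) by blast
        qed
        then show ?thesis
          unfolding wp_If using tests f by (simp add: bt)
      next
        fix l' assume l': "l = Suc l'" "\<not> outside r (2 ^ l) p q" "\<not> full r (2 ^ l) p q"
        let ?ch = "\<lambda>cs. (l', p + 2 ^ l', q + 2 ^ l') # (l', p + 2 ^ l', q) # (l', p, q + 2 ^ l') # (l', p, q) # cs"
        have sz: "sum_list (map ?sz (?ch cs')) = 4 * 8 ^ l' + sum_list (map ?sz cs')"
          "(8::nat) ^ l = 8 * 8 ^ l'" by (simp_all add: l')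
        then have sz_le: "sum_list (map ?sz (?ch cs')) \<le> 8 ^ L"
          "sum_list (map ?sz (?ch cs')) < sum_list (map ?sz cs)"
          using I(8) by (simp_all add: cs)
        have "wp B quad_split (\<lambda>t' s'. t' \<le> 58 + t2 + 84 \<and> (\<exists>cs. cs = ?ch cs' \<and>
            scalar s' ''top'' = int (length cs) \<and> stk s' cs)) (58 + t2) s2"
        proof (rule wp_quad_split)
          show "int (length cs') + 4 \<le> N" using size[OF sz_le(1)] by simp
          show "2 ^ Suc l' \<le> N" "\<bar>p\<bar> \<le> N" "\<bar>q\<bar> \<le> N"
            using bd w X_bounds unfolding l'(1)[symmetric] by linarith+
        qed (use s2 same2 l' in auto)
        then have "wp B quad_split (\<lambda>t'' s''. \<exists>g'. ?I g' t'' s'' \<and>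
            sum_list (map ?sz g') < sum_list (map ?sz cs)) (58 + t2) s2"
        proof (rule wp_conseq, goal_cases)
          case (1 t3 s3)
          have co: "sum_list (map ?co (?ch cs')) = co l p q - 300 + sum_list (map ?co cs')"
            using l' by (simp add: co_def)
          have so: "sum_list (map ?sol (?ch cs')) = sol f r (2 ^ l) p q + sum_list (map ?sol cs')"
            using sol_split[of f r "2 ^ l'" p q] by (simp add: l')
          have "scalar s3 ''count'' = scalar s1 ''count''"
            using 1(2) same2(6) by (simp add: quad_split_def quad_push_def same_scalar)
          then have "0 \<le> scalar s3 ''count''"
            "scalar s3 ''count'' + sum_list (map ?sol (?ch cs')) = cnt + sol f r (2 ^ L) 0 q0"
            using I(6,7) so by simp_all
          moreover have "t3 + sum_list (map ?co (?ch cs')) \<le> t + co L 0 q0"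
            using 1(1) s2 I(5) co by linarith
          moreover obtain g where g: "(2::int) ^ l' = g" "0 \<le> g" by simp
          then have "\<forall>x\<in>set (?ch cs'). ?box x"
            using I(3,4) g(2) by (auto simp: l' g(1))
          ultimately show ?case using 1(1) sz_le by blast
        qed
        then show ?thesis
          unfolding wp_If using tests l'(2,3) by (simp add: bt)
      qed
    qed
  next
    case (4 cs t1 s1)
    then have "cs = []" by auto
    with 4 show ?case by simp
  qed
qed

end


section \<open>Counting the cadences of one character\<close>

definition char_conv :: "com \<Rightarrow> com" where
  "char_conv cp = For ''r'' (Var ''x0'') (Var ''xe'')
     (Write ''sp'' (Const 0) (Const 0);; Write ''sq'' (Const 0) (Var ''d0'');;
      Write ''sw'' (Const 0) (Var ''s0'');; ''top'' ::= Const 1;; quad cp)"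

definition pair_test :: bexp where
  "pair_test =
    And (Equal (Var ''d'' \<otimes> Var ''D'') (Var ''z'' \<ominus> Var ''x''))
      (And (Not (Less (Var ''d'') (Var ''u''))) (And (Not (Less (Var ''u'') (Const 1)))
        (And (Not (Less (Var ''n'') (Var ''u'' \<oplus> (Var ''k'' \<ominus> Const 1) \<otimes> Var ''d'')))
          (Less (Var ''n'') (Var ''u'' \<oplus> Var ''k'' \<otimes> Var ''d'')))))"

text \<open>Pairs with \<open>z \<le> x\<close> are tried too, but then \<open>d \<le> 0\<close> and
  the test \<open>1 \<le> u \<le> d\<close> rejects them. The character test sits in an inner
  conditional because \<open>And\<close> evaluates both operands and \<open>u + b * d\<close> is
  known to be a legal index only for valid pairs.\<close>

definition pair :: com where
  "pair =
    (''z'' ::= Read ''P'' (Var ''j'');;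
     ''d'' ::= Div (Var ''z'' \<ominus> Var ''x'') (Var ''D'');;
     ''u'' ::= Var ''x'' \<ominus> Var ''a'' \<otimes> Var ''d'';;
     If pair_test
       (If (Equal (Read ''S'' (Var ''u'' \<oplus> Var ''b'' \<otimes> Var ''d'')) (Var ''ch''))
         (''count'' ::= Var ''count'' \<oplus> Const 1) Skip)
       Skip)"

definition char_pairs :: com where
  "char_pairs = For ''i'' (Var ''g'') (Var ''h'')
     (''x'' ::= Read ''P'' (Var ''i'');; For ''j'' (Var ''g'') (Var ''h'') pair)"

context cadence
begin

definition cad :: "(int \<Rightarrow> bool) \<Rightarrow> (int \<times> int) set" where
  "cad f = {(i, d). valid i d \<and> f (i + a * d) \<and> f (i + b * d) \<and> f (i + c * d)}"

definition is_pair :: "(int \<Rightarrow> bool) \<Rightarrow> int \<Rightarrow> int \<Rightarrow> bool" where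
  "is_pair f x z \<longleftrightarrow> (let d = (z - x) div (c - a); u = x - a * d in
     d * (c - a) = z - x \<and> valid u d \<and> f (u + b * d))"

text \<open>The outer positions determine \<open>i\<close> and \<open>d\<close> because
  \<open>a < c\<close>, so the elements of \<open>cad f\<close> correspond to ordered pairs of
  occurrences. Listing the occurrences by an injective \<open>P\<close> turns the sum over indices
  into a sum over such pairs.\<close>

lemma sum_is_pair:
  fixes P :: "nat \<Rightarrow> int"
  assumes "inj_on P {g..<h}" "P ` {g..<h} = {x. 1 \<le> x \<and> x \<le> n \<and> f x}"
  shows "(\<Sum>i\<in>{g..<h}. \<Sum>j\<in>{g..<h}. of_bool (is_pair f (P i) (P j))) = int (card (cad f))"
    (is "?l = _")
proof -
  let ?Q = "{x. 1 \<le> x \<and> x \<le> n \<and> f x}"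
  have fin: "finite ?Q" using assms(2) by (metis finite_atLeastLessThan finite_imageI)
  have "?l = (\<Sum>x\<in>?Q. \<Sum>z\<in>?Q. of_bool (is_pair f x z))"
    unfolding assms(2)[symmetric] by (simp only: sum.reindex[OF assms(1)] comp_def)
  also have "\<dots> = (\<Sum>y\<in>?Q \<times> ?Q. of_bool (is_pair f (fst y) (snd y)))"
    by (simp only: sum.cartesian_product case_prod_unfold)
  also have "\<dots> = int (card {y \<in> ?Q \<times> ?Q. is_pair f (fst y) (snd y)})"
    using fin by (intro int_card_filter[symmetric]) auto
  also have "card {y \<in> ?Q \<times> ?Q. is_pair f (fst y) (snd y)} = card (cad f)"
  proof (rule bij_betw_same_card[symmetric, of "\<lambda>(i, d). (i + a * d, i + c * d)"], rule bij_betw_imageI)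
    show "inj_on (\<lambda>(i, d). (i + a * d, i + c * d)) (cad f)"
    proof (rule inj_onI, clarify)
      fix i d i' d' assume "i + a * d = i' + a * d'" "i + c * d = i' + c * d'"
      then have "(c - a) * d = (c - a) * d'" by (simp add: algebra_simps)
      with ab bc have "d = d'" by simp
      with \<open>i + a * d = i' + a * d'\<close> show "i = i' \<and> d = d'" by simp
    qed
    show "(\<lambda>(i, d). (i + a * d, i + c * d)) ` cad f = {y \<in> ?Q \<times> ?Q. is_pair f (fst y) (snd y)}"
    proof (intro equalityI subsetI)
      fix y assume "y \<in> (\<lambda>(i, d). (i + a * d, i + c * d)) ` cad f"
      then obtain i d where y: "y = (i + a * d, i + c * d)" and v: "valid i d"
        and f: "f (i + a * d)" "f (i + b * d)" "f (i + c * d)"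
        by (auto simp: cad_def)
      have d: "1 \<le> d" "1 \<le> i" using v by (auto simp: valid_def)
      have "(i + c * d - (i + a * d)) = d * (c - a)" by (simp add: algebra_simps)
      then have q: "(i + c * d - (i + a * d)) div (c - a) = d" using ab bc by simp
      have "is_pair f (i + a * d) (i + c * d)"
        unfolding is_pair_def Let_def q using v f by (simp add: algebra_simps)
      moreover have "0 \<le> a * d" "0 \<le> c * d" "a * d \<le> (k - 1) * d" "c * d \<le> (k - 1) * d"
        using coeffs d by (auto intro!: mult_right_mono)
      then have "1 \<le> i + a * d" "i + a * d \<le> n" "1 \<le> i + c * d" "i + c * d \<le> n"
        using v d unfolding valid_def by linarith+
      ultimately show "y \<in> {y \<in> ?Q \<times> ?Q. is_pair f (fst y) (snd y)}"
        using f by (simp add: y)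
    next
      fix y assume y: "y \<in> {y \<in> ?Q \<times> ?Q. is_pair f (fst y) (snd y)}"
      obtain x z where xz: "y = (x, z)" by (cases y)
      define d where "d = (z - x) div (c - a)"
      have *: "f x" "f z" "d * (c - a) = z - x" "valid (x - a * d) d" "f (x - a * d + b * d)"
        using y by (auto simp: xz is_pair_def Let_def d_def)
      have z: "x - a * d + c * d = z" using *(3) by (simp add: algebra_simps)
      have "(x - a * d, d) \<in> cad f" using * z by (simp add: cad_def)
      moreover have "y = (\<lambda>(i, d). (i + a * d, i + c * d)) (x - a * d, d)"
        using z by (simp add: xz)
      ultimately show "y \<in> (\<lambda>(i, d). (i + a * d, i + c * d)) ` cad f" by blast
    qed
  qed
  finally show ?thesis .
qed

end

context cadence_machine
begin

lemma wp_char_conv: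
  fixes ch cnt :: int and s :: state and L :: nat
  defines "f \<equiv> \<lambda>x. arr s ''S'' (nat x) = ch"
  assumes env: "env s"
    and st: "scalar s ''ch'' = ch" "scalar s ''count'' = cnt" "scalar s ''x0'' = x_min"
      "scalar s ''xe'' = x_min + classes" "scalar s ''d0'' = d_min" "scalar s ''s0'' = 2 ^ L"
    and d: "d_min \<le> d_max"
    and L: "side \<le> 2 ^ L" "2 ^ L \<le> 2 * side" "int L + 1 \<le> 6 * lg"
    and bounds: "2 ^ L \<le> X" "x_min + classes \<le> X" "d_min \<le> X"
    and cnt: "0 \<le> cnt" "cnt + int (card (cad f)) \<le> N"
  shows "wp B (char_conv cp) (\<lambda>t' s'. t' \<le> t + (1728 * C + 1000000) * (n * lg * lg) \<and>
    scalar s' ''count'' = cnt + int (card (cad f))) t s"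
proof -
  define K1 where "K1 = (C + 200) * ((c - a) * lg)"
  define T where "T = (int L + 1) * 2 ^ L * (6000 + 16 * K1)"
  define so where "so r = sol f r (2 ^ L) 0 d_min" for r
  have cad: "(\<Sum>r\<in>{x_min..<x_min + classes}. so r) = int (card (cad f))"
    unfolding so_def cad_def using L(1) by (intro sum_sol) simp
  have D: "2 \<le> c - a" using ab bc by simp
  have x_min: "1 \<le> x_min" using a0 d_min_pos[OF d] by (simp add: x_min_def)
  have classes: "1 \<le> classes" using D x_span_nonneg[OF d] by (simp add: classes_def)
  have K1: "0 \<le> K1" using C_nonneg lg_pos D by (simp add: K1_def)
  have so_nn: "0 \<le> so r" for r by (simp add: so_def sol_nonneg)
  have n1: "1 \<le> n" using a0 ab bc ck kn by linarith
  \<comment> \<open>1728 is \<open>16 * 6 * 18\<close>: 16 from \<open>cost_le\<close>, 6 from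
    \<open>int L + 1 \<le> 6 * lg\<close>, and 18 because \<open>2 ^ L\<close> is at most twice
    \<open>side\<close>. Likewise 993600 is \<open>9200 * 6 * 18\<close> with
    \<open>9200 = 20 * 300 + 16 * 200\<close>. The rest up to 1000000 pays for the loop over the
    classes.\<close>
  have time: "classes * (T + 40) + 20 \<le> (1728 * C + 1000000) * (n * lg * lg)"
  proof -
    have c18: "classes * ((c - a) * 2 ^ L) \<le> 18 * n"
    proof -
      have "classes * ((c - a) * 2 ^ L) \<le> classes * ((c - a) * (2 * side))"
        using classes D L by (intro mult_left_mono) auto
      then show ?thesis using classes_side[OF d] by simp
    qed
    have Dl: "1 \<le> (c - a) * lg" using mult_mono[of 1 "c - a" 1 lg] D lg_pos by simp
    have "classes * 1 \<le> classes * ((c - a) * 2 ^ L)"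
      using classes mult_mono[of 1 "c - a" 1 "2 ^ L"] D by (intro mult_left_mono) auto
    then have cn: "classes \<le> 18 * n" using c18 by linarith
    have "T \<le> (int L + 1) * 2 ^ L * ((9200 + 16 * C) * ((c - a) * lg))"
      unfolding T_def K1_def using Dl by (intro mult_left_mono) (auto simp: algebra_simps)
    then have "classes * T \<le> classes * ((int L + 1) * 2 ^ L * ((9200 + 16 * C) * ((c - a) * lg)))"
      using classes by (intro mult_left_mono) auto
    also have "\<dots> = ((9200 + 16 * C) * lg) * ((int L + 1) * (classes * ((c - a) * 2 ^ L)))"
      by (simp only: ac_simps)
    also have "\<dots> \<le> ((9200 + 16 * C) * lg) * ((6 * lg) * (18 * n))"
    proof (rule mult_left_mono)
      show "(int L + 1) * (classes * ((c - a) * 2 ^ L)) \<le> (6 * lg) * (18 * n)"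
        by (rule mult_mono[OF L(3) c18]) (use lg_pos classes D in auto)
    qed (use C_nonneg lg_pos in auto)
    also have "\<dots> = (1728 * C + 993600) * (n * lg * lg)" by (simp add: algebra_simps)
    finally have "classes * T \<le> (1728 * C + 993600) * (n * lg * lg)" .
    moreover have "n * 1 \<le> n * (lg * lg)"
      using n1 lg_pos mult_mono[of 1 lg 1 lg] by (intro mult_left_mono) auto
    then have "classes * 40 + 20 \<le> 6400 * (n * lg * lg)"
      using cn n1 unfolding mult.assoc by linarith
    ultimately show ?thesis by (simp add: distrib_left distrib_right)
  qed
  show ?thesis
    unfolding char_conv_def
  proof (rule wp_For[where lo = x_min and hi = "x_min + classes" and T = "T + 30" and
        I = "\<lambda>i s'. scalar s' ''count'' = cnt + (\<Sum>r\<in>{x_min..<i}. so r)"], goal_cases)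
    case (9 r t1 s1)
    let ?s2 = "setv ''top'' 1 (seta ''sw'' 0 (2 ^ L) (seta ''sq'' 0 d_min (seta ''sp'' 0 0 s1)))"
    have s1: "env s1" "scalar s1 ''ch'' = ch" "scalar s1 ''d0'' = d_min" "scalar s1 ''s0'' = 2 ^ L"
      "arr s1 ''S'' = arr s ''S''"
      using 9(2) env st
      by (auto simp: quad_defs same_scalar same_arr elim!: env_same)
    have s2: "env ?s2" "arr ?s2 ''S'' = arr s ''S''" using s1 by (simp_all add: env_def)
    have le: "(\<Sum>r'\<in>{x_min..<r}. so r') + so r \<le> (\<Sum>r\<in>{x_min..<x_min + classes}. so r)"
    proof -
      have "(\<Sum>r'\<in>insert r {x_min..<r}. so r') \<le> (\<Sum>r\<in>{x_min..<x_min + classes}. so r)"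
        using 9(4,5) so_nn by (intro sum_mono2) auto
      then show ?thesis by simp
    qed
    have ins: "{x_min..<r + 1} = insert r {x_min..<r}" using 9(4) by auto
    have ff: "(\<lambda>x. arr ?s2 ''S'' (nat x) = ch) = f" by (simp add: f_def s1)
    have cnt0: "0 \<le> cnt + (\<Sum>r'\<in>{x_min..<r}. so r')" using cnt so_nn by (simp add: sum_nonneg)
    have "wp B (quad cp) (\<lambda>t' s'. t' \<le> t1 + 11 + cost 300 K1 r L 0 d_min + 4 \<and>
      scalar s' ''count'' = cnt + (\<Sum>r'\<in>{x_min..<r}. so r') + so r) (t1 + 11) ?s2"
      unfolding so_def[of r] ff[symmetric] K1_def
    proof (rule wp_quad)
      show "cnt + (\<Sum>r'\<in>{x_min..<r}. so r') + sol (\<lambda>x. arr ?s2 ''S'' (nat x) = ch) r (2 ^ L) 0 d_min \<le> N"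
        using le cad cnt(2) unfolding ff so_def[symmetric] by linarith
    qed (use s1 s2 9 bounds x_min cnt0 d_min_pos[OF d] in auto)
    then show ?case
      unfolding wp_Seq
    proof (simp add: s1 asafe_ok asafe_Read_ok add.commute[of _ t1], elim wp_conseq, goal_cases)
      case (1 t3 s3)
      have "scalar s3 ''r'' = r"
        using 1 9(3)
        by (simp add: quad_defs same_scalar)
      moreover have "cost 300 K1 r L 0 d_min \<le> T"
        using cost_le[of 300 K1 r L d_min] K1 by (simp add: T_def)
      ultimately show ?case using 1 ins by (simp add: add.assoc)
    qed
  next
    case (10 t1 s1)
    then show ?case using time cad classes by (simp add: algebra_simps)
  qed (use st x_min classes bounds X_bounds B_bounds in
      \<open>auto simp: quad_defs same_scalar\<close>)
qed

lemma wp_pair: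
  fixes ch x z j cnt :: int and s :: state
  defines "f \<equiv> \<lambda>x. arr s ''S'' (nat x) = ch"
  assumes env: "env s"
    and st: "scalar s ''ch'' = ch" "scalar s ''count'' = cnt" "scalar s ''x'' = x" "scalar s ''j'' = j"
      "arr s ''P'' (nat j) = z"
    and j: "0 \<le> j" "j \<le> N"
    and xz: "1 \<le> x" "x \<le> n" "1 \<le> z" "z \<le> n"
    and cnt: "0 \<le> cnt" "cnt + of_bool (is_pair f x z) \<le> N"
  shows "wp B pair (\<lambda>t' s'. t' \<le> t + 80 \<and> scalar s' ''count'' = cnt + of_bool (is_pair f x z)) t s"
proof -
  define d where "d = (z - x) div (c - a)"
  define u where "u = x - a * d"
  have D: "0 < c - a" using ab bc by simp
  have "\<bar>d\<bar> \<le> \<bar>z - x\<bar>" unfolding d_def using D by (intro abs_div_int_le) simp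
  then have d: "\<bar>d\<bar> \<le> n" using xz by linarith
  then have dN: "\<bar>d\<bar> \<le> N" using params_le by linarith
  have "\<bar>a * d\<bar> \<le> X * X"
    unfolding abs_mult using d nX params_le a0 by (intro mult_mono) auto
  moreover have "x \<le> X" "8 * X \<le> X * X" using xz nX X8 by (auto intro: mult_right_mono)
  ultimately have "\<bar>u\<bar> \<le> 8 * (X * X)" unfolding u_def using xz by linarith
  then have uN: "\<bar>u\<bar> \<le> N" using X_bounds(1) unfolding mult.assoc by linarith
  have e: "scalar s ''n'' = n" "scalar s ''k'' = k" "scalar s ''a'' = a" "scalar s ''b'' = b"
    "scalar s ''D'' = c - a" using env by (simp_all add: env_def)
  have sm: "\<bar>x\<bar> \<le> N" "\<bar>z\<bar> \<le> N" "\<bar>c - a\<bar> \<le> N" "\<bar>a\<bar> \<le> N" "\<bar>b\<bar> \<le> N" "\<bar>k\<bar> \<le> N" "\<bar>n\<bar> \<le> N" "c \<noteq> a" "\<bar>j\<bar> \<le> N"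
    using xz D params_le coeffs j by linarith+
  define s3 where "s3 = setv ''u'' u (setv ''d'' d (setv ''z'' z s))"
  have s3: "scalar s3 ''u'' = u" "scalar s3 ''d'' = d" "scalar s3 ''z'' = z" "scalar s3 ''x'' = x"
    "scalar s3 ''n'' = n" "scalar s3 ''k'' = k" "scalar s3 ''a'' = a" "scalar s3 ''b'' = b"
    "scalar s3 ''D'' = c - a" "scalar s3 ''ch'' = ch" "scalar s3 ''count'' = cnt" "arr s3 = arr s"
    by (simp_all add: s3_def e st)
  have test: "bsafe B pair_test s3" "btime pair_test = 36"
    "bval pair_test s3 \<longleftrightarrow> d * (c - a) = z - x \<and> valid u d"
    unfolding pair_test_def by (auto simp: s3 asafe_ok sm uN dN valid_def)
  have pr: "is_pair f x z \<longleftrightarrow> (d * (c - a) = z - x \<and> valid u d) \<and> f (u + b * d)"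
    by (simp add: is_pair_def Let_def d_def u_def)
  define R where "R = If pair_test
       (If (Equal (Read ''S'' (Var ''u'' \<oplus> Var ''b'' \<otimes> Var ''d'')) (Var ''ch''))
         (''count'' ::= Var ''count'' \<oplus> Const 1) Skip) Skip"
  define Q where "Q t' s' \<longleftrightarrow> t' \<le> t + 80 \<and> scalar s' ''count'' = cnt + of_bool (is_pair f x z)" for t' and s' :: state
  have "wp B R Q (t + 15) s3"
  proof (cases "d * (c - a) = z - x \<and> valid u d")
    case True
    have "0 \<le> b * d" "0 \<le> u" using True coeffs by (auto simp: valid_def)
    then have nn: "0 \<le> u + b * d" by simp
    show ?thesis
    proof (cases "f (u + b * d)")
      case fT: True
      have "cnt \<le> N" "is_pair f x z" using cnt(2) pr True fT by auto
      then show ?thesis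
        unfolding R_def Q_def using test True fT[unfolded f_def]
        by (simp add: s3 asafe_ok asafe_Read_ok sm uN dN nn cnt)
    next
      case False
      then show ?thesis
        unfolding R_def Q_def using test True pr False[unfolded f_def]
        by (simp add: s3 asafe_ok asafe_Read_ok sm uN dN nn cnt)
    qed
  next
    case False
    then have "\<not> bval pair_test s3" "\<not> is_pair f x z" using test(3) pr by blast+
    then show ?thesis unfolding R_def Q_def using test(1,2) by (simp add: s3)
  qed
  then show ?thesis
    unfolding pair_def R_def[symmetric] Q_def[symmetric] s3_def u_def d_def using dN
    by (simp add: st e asafe_ok asafe_Read_ok sm j d_def add.commute)
qed

lemma wp_char_pairs:
  fixes ch cnt :: int and g h :: nat and s :: state
  defines "f \<equiv> \<lambda>x. arr s ''S'' (nat x) = ch"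
  defines "P \<equiv> arr s ''P''"
  assumes env: "env s"
    and st: "scalar s ''ch'' = ch" "scalar s ''count'' = cnt" "scalar s ''g'' = int g" "scalar s ''h'' = int h"
    and gh: "g < h" "int h \<le> N"
    and P: "inj_on P {g..<h}" "P ` {g..<h} = {x. 1 \<le> x \<and> x \<le> n \<and> f x}"
    and cnt: "0 \<le> cnt" "cnt + int (card (cad f)) \<le> N"
  shows "wp B char_pairs (\<lambda>t' s'. t' \<le> t + 200 * (int h - int g)\<^sup>2 \<and>
    scalar s' ''count'' = cnt + int (card (cad f))) t s"
proof -
  define m where "m = int h - int g"
  have m: "1 \<le> m" using gh by (simp add: m_def)
  define row where "row i j = (\<Sum>j'\<in>{g..<j}. of_bool (is_pair f (P i) (P j')) :: int)" for i j
  have row_nn: "0 \<le> row i j" for i j by (simp add: row_def sum_nonneg)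
  have cad: "(\<Sum>i\<in>{g..<h}. row i h) = int (card (cad f))"
    unfolding row_def by (rule sum_is_pair[OF P])
  have le: "(\<Sum>i'\<in>{g..<i}. row i' h) + row i h \<le> int (card (cad f))" if "g \<le> i" "i < h" for i
  proof -
    have "(\<Sum>i'\<in>{g..<Suc i}. row i' h) \<le> (\<Sum>i\<in>{g..<h}. row i h)"
      using that row_nn by (intro sum_mono2) auto
    then show ?thesis using that cad by simp
  qed
  have row_le: "row i j + of_bool (is_pair f (P i) (P j)) \<le> row i h" if "g \<le> j" "j < h" for i j
  proof -
    have "row i (Suc j) \<le> row i h"
      unfolding row_def using that by (intro sum_mono2) auto
    then show ?thesis using that by (simp add: row_def)
  qed
  have P1: "1 \<le> P i" "P i \<le> n" if "g \<le> i" "i < h" for i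
    using P(2) that by (metis (mono_tags, lifting) atLeastLessThan_iff imageI mem_Collect_eq)+
  show ?thesis
    unfolding char_pairs_def
  proof (rule wp_For[where lo = "int g" and hi = "int h" and T = "90 * m + 20" and
        I = "\<lambda>i s'. scalar s' ''count'' = cnt + (\<Sum>i'\<in>{g..<nat i}. row i' h)"], goal_cases)
    case (9 i' t1 s1)
    obtain i where i: "i' = int i" using 9(4) nonneg_int_cases[of i'] by force
    have gi: "g \<le> i" "i < h" using 9(4,5) i by auto
    let ?s2 = "setv ''x'' (P i) s1"
    have s1: "env s1" "scalar s1 ''ch'' = ch" "scalar s1 ''g'' = int g" "scalar s1 ''h'' = int h"
      "arr s1 ''S'' = arr s ''S''" "arr s1 ''P'' = P"
      using 9(2) env st by (auto simp: pair_def P_def same_scalar same_arr elim!: env_same)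
    have e2: "env ?s2" using s1(1) by (simp add: env_def)
    have iN: "int i \<le> N" using gi gh by linarith
    have "wp B (For ''j'' (Var ''g'') (Var ''h'') pair) (\<lambda>t' s'. t' \<le> t1 + 3 + (int h - int g) * 88 + 6 \<and>
        scalar s' ''i'' = i' \<and> scalar s' ''count'' = cnt + (\<Sum>i'\<in>{g..<i}. row i' h) + row i h) (t1 + 3) ?s2"
    proof (rule wp_For[where lo = "int g" and hi = "int h" and T = 80 and
        I = "\<lambda>j s'. scalar s' ''count'' = cnt + (\<Sum>i'\<in>{g..<i}. row i' h) + row i (nat j)"], goal_cases)
      case (9 j' t2 s2)
      obtain j where j: "j' = int j" using 9(4) nonneg_int_cases[of j'] by force
      have gj: "g \<le> j" "j < h" using 9(4,5) j by auto
      have s2: "env s2" "scalar s2 ''ch'' = ch" "scalar s2 ''x'' = P i" "arr s2 ''S'' = arr s ''S''" "arr s2 ''P'' = P"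
        using 9(2) s1 env_same[OF e2 9(2)] by (simp_all add: pair_def same_scalar same_arr)
      have ff: "f = (\<lambda>x. arr s2 ''S'' (nat x) = ch)" by (simp add: f_def s2)
      have jN: "int j \<le> N" using gj gh by linarith
      have nn: "0 \<le> cnt + (\<Sum>i'\<in>{g..<i}. row i' h) + row i j"
        using cnt row_nn by (simp add: sum_nonneg)
      have up: "cnt + (\<Sum>i'\<in>{g..<i}. row i' h) + row i j + of_bool (is_pair f (P i) (P j)) \<le> N"
        using cnt(2) le[OF gi] row_le[OF gj, of i] by linarith
      have "wp B pair (\<lambda>t' s'. t' \<le> t2 + 80 \<and> scalar s' ''count'' =
          cnt + (\<Sum>i'\<in>{g..<i}. row i' h) + row i j + of_bool (is_pair f (P i) (P j))) t2 s2"
        unfolding ff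
        by (rule wp_pair[where j = j'])
          (use s2 9(1,3) j jN P1[OF gi] P1[OF gj] nn up[unfolded ff] in auto)
      then show ?case
      proof (rule wp_conseq, goal_cases)
        case (1 t3 s3)
        have "scalar s3 ''j'' = j'" using 1(2) 9(3) by (simp add: pair_def same_scalar)
        moreover have "nat (j' + 1) = Suc j" using j by simp
        moreover have "row i (Suc j) = row i j + of_bool (is_pair f (P i) (P j))"
          using gj by (simp add: row_def)
        ultimately show ?case using 1(1) by simp
      qed
    next
      case (10 t2 s2)
      then show ?case using 9(3) by (simp add: pair_def same_scalar)
    qed (use s1 gh B_bounds 9(1) i in \<open>auto simp: pair_def same_scalar row_def\<close>)
    then show ?case
      using 9(3) iN gi
      unfolding wp_Seq
    proof (simp add: s1 i asafe_ok asafe_Read_ok add.commute[of _ t1], elim conjE wp_conseq, goal_cases)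
      case (1 t3 s3)
      have "nat (int i + 1) = Suc i" by simp
      then show ?case using 1 gi by (simp add: m_def)
    qed
  next
    case (10 t1 s1)
    have "(int h - int g) * (90 * m + 20 + 8) + 6 \<le> 200 * m\<^sup>2"
    proof -
      have "m * 1 \<le> m * m" using m by (intro mult_left_mono) auto
      then show ?thesis using m unfolding m_def[symmetric] power2_eq_square distrib_left by linarith
    qed
    then show ?case using 10 cad by (simp add: m_def algebra_simps)
  qed (use st gh B_bounds in \<open>auto simp: pair_def same_scalar\<close>)
qed

end


section \<open>Sorting the positions\<close>

definition merge_left :: com where
  "merge_left = (Write ''Q'' (Var ''t'') (Read ''P'' (Var ''i''));; ''i'' ::= Var ''i'' \<oplus> Const 1)"

definition merge_right :: com where
  "merge_right = (Write ''Q'' (Var ''t'') (Read ''P'' (Var ''j''));; ''j'' ::= Var ''j'' \<oplus> Const 1)"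

text \<open>An exhausted run may end at \<open>n\<close>, where \<open>P\<close> has arbitrary
  contents that need not be a legal index. As \<open>And\<close> evaluates both operands, the bounds
  are tested in outer conditionals.\<close>

definition merge_step :: com where
  "merge_step =
    If (Less (Var ''j'') (Var ''hi''))
      (If (Less (Var ''i'') (Var ''mid''))
        (If (Less (Read ''S'' (Read ''P'' (Var ''j''))) (Read ''S'' (Read ''P'' (Var ''i''))))
          merge_right merge_left)
        merge_right)
      merge_left"

definition merge_run :: com where
  "merge_run =
    (''mid'' ::= Var ''lo'' \<oplus> Var ''w'';; ''hi'' ::= Var ''mid'' \<oplus> Var ''w'';;
     If (Less (Var ''n'') (Var ''mid'')) (''mid'' ::= Var ''n'') Skip;;
     If (Less (Var ''n'') (Var ''hi'')) (''hi'' ::= Var ''n'') Skip;;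
     ''i'' ::= Var ''lo'';; ''j'' ::= Var ''mid'';;
     For ''t'' (Var ''lo'') (Var ''hi'') merge_step)"

definition merge_pass :: com where
  "merge_pass =
    (''lo'' ::= Const 0;;
     While (Less (Var ''lo'') (Var ''n''))
       (merge_run;; ''lo'' ::= Var ''lo'' \<oplus> Var ''w'' \<oplus> Var ''w'');;
     For ''i'' (Const 0) (Var ''n'') (Write ''P'' (Var ''i'') (Read ''Q'' (Var ''i'')));;
     ''w'' ::= Var ''w'' \<oplus> Var ''w'')"

definition merge_sort :: com where
  "merge_sort =
    (For ''i'' (Const 0) (Var ''n'') (Write ''P'' (Var ''i'') (Var ''i'' \<oplus> Const 1));;
     ''w'' ::= Const 1;;
     While (Less (Var ''w'') (Var ''n'')) merge_pass)"

lemmas merge_defs = merge_run_def merge_step_def merge_left_def merge_right_def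

section \<open>Sorted blocks and the merge invariant\<close>

definition sorted_run :: "(int \<Rightarrow> int) \<Rightarrow> (nat \<Rightarrow> int) \<Rightarrow> nat \<Rightarrow> nat \<Rightarrow> bool" where
  "sorted_run key P l h \<longleftrightarrow> (\<forall>i j. l \<le> i \<and> i \<le> j \<and> j < h \<longrightarrow> key (P i) \<le> key (P j))"

definition sorted_blocks :: "(int \<Rightarrow> int) \<Rightarrow> (nat \<Rightarrow> int) \<Rightarrow> nat \<Rightarrow> nat \<Rightarrow> bool" where
  "sorted_blocks key P w h \<longleftrightarrow>
     (\<forall>i j. i \<le> j \<and> j < h \<and> i div w = j div w \<longrightarrow> key (P i) \<le> key (P j))"

lemma sorted_blocks_run:
  assumes "sorted_blocks key P w n" "0 < w"
  shows "sorted_run key P (w * g) (min n (w * g + w))"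
  unfolding sorted_run_def
proof (intro allI impI)
  fix i j assume "w * g \<le> i \<and> i \<le> j \<and> j < min n (w * g + w)"
  moreover from this have "i div w = g" "j div w = g"
    using assms(2) by (auto intro!: div_nat_eqI simp: algebra_simps)
  ultimately show "key (P i) \<le> key (P j)"
    using assms(1) by (simp add: sorted_blocks_def)
qed

lemma sorted_blocks_extend:
  assumes "sorted_blocks key P w (min n (w * g))" "sorted_run key P (w * g) (min n (w * g + w))" "0 < w"
  shows "sorted_blocks key P w (min n (w * g + w))"
  unfolding sorted_blocks_def
proof (intro allI impI)
  fix i j assume ij: "i \<le> j \<and> j < min n (w * g + w) \<and> i div w = j div w"
  show "key (P i) \<le> key (P j)"
  proof (cases "j < w * g")
    case True
    then show ?thesis using ij assms(1) by (simp add: sorted_blocks_def)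
  next
    case False
    then have "j div w = g" using ij assms(3) by (auto intro!: div_nat_eqI simp: algebra_simps)
    then have "w * g \<le> i" using ij assms(3) by (metis times_div_less_eq_dividend)
    then show ?thesis using ij assms(2) by (simp add: sorted_run_def)
  qed
qed

lemma sorted_run_cong:
  "sorted_run key P l h \<Longrightarrow> (\<And>i. l \<le> i \<Longrightarrow> i < h \<Longrightarrow> P' i = P i) \<Longrightarrow> sorted_run key P' l h"
  by (simp add: sorted_run_def)

lemma sorted_blocks_cong:
  "sorted_blocks key P w h \<Longrightarrow> (\<And>i. i < h \<Longrightarrow> P' i = P i) \<Longrightarrow> sorted_blocks key P' w h"
  by (simp add: sorted_blocks_def)

text \<open>The invariant of a merge: \<open>[lo, i)\<close> and \<open>[mid, j)\<close> of \<open>P\<close> have been moved to \<open>Q\<close>.\<close>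

definition merging :: "(int \<Rightarrow> int) \<Rightarrow> (nat \<Rightarrow> int) \<Rightarrow> (nat \<Rightarrow> int) \<Rightarrow> nat \<Rightarrow> nat \<Rightarrow> nat \<Rightarrow> nat \<Rightarrow> nat \<Rightarrow> bool"
  where
  "merging key P Q lo mid hi i j \<longleftrightarrow> lo \<le> i \<and> i \<le> mid \<and> mid \<le> j \<and> j \<le> hi \<and>
     Q ` {lo..<i + (j - mid)} = P ` ({lo..<i} \<union> {mid..<j}) \<and>
     sorted_run key Q lo (i + (j - mid)) \<and>
     (\<forall>x\<in>{lo..<i + (j - mid)}. \<forall>y\<in>{i..<mid} \<union> {j..<hi}. key (Q x) \<le> key (P y))"

text \<open>The moved entry is least among those remaining and, by the invariant, not below anything
  already written; so the output stays sorted and below the rest. The flag \<open>left\<close>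
  treats both runs at once.\<close>

lemma merging_step:
  assumes m: "merging key P Q lo mid hi i j"
    and new: "y0 = (if left then i else j)" "if left then i < mid else j < hi"
    and least: "\<forall>y\<in>{i..<mid} \<union> {j..<hi}. key (P y0) \<le> key (P y)"
  shows "merging key P (Q(i + (j - mid) := P y0)) lo mid hi
    (if left then i + 1 else i) (if left then j else j + 1)"
proof -
  let ?t = "i + (j - mid)" and ?Q = "Q(i + (j - mid) := P y0)"
  let ?i = "if left then i + 1 else i" and ?j = "if left then j else j + 1"
  have b: "lo \<le> i" "i \<le> mid" "mid \<le> j" "j \<le> hi" using m by (auto simp: merging_def)
  have t: "?i + (?j - mid) = Suc ?t" using b by auto
  have int: "{lo..<Suc ?t} = insert ?t {lo..<?t}" using b by auto
  have img: "?Q ` {lo..<Suc ?t} = insert (P y0) (Q ` {lo..<?t})"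
    unfolding int by (auto simp: image_iff)
  have cons: "{lo..<?i} \<union> {mid..<?j} = insert y0 ({lo..<i} \<union> {mid..<j})"
    using b new by (auto split: if_splits)
  have rest: "{?i..<mid} \<union> {?j..<hi} \<subseteq> {i..<mid} \<union> {j..<hi}" by auto
  have y0: "y0 \<in> {i..<mid} \<union> {j..<hi}" using new by (auto split: if_splits)
  have le: "key (Q x) \<le> key (P y)" if "lo \<le> x" "x < ?t" "y \<in> {i..<mid} \<union> {j..<hi}" for x y
    using m that unfolding merging_def by (meson atLeastLessThan_iff)
  have sorted: "key (Q x) \<le> key (Q y)" if "lo \<le> x" "x \<le> y" "y < ?t" for x y
    using m that unfolding merging_def sorted_run_def by blast
  have "sorted_run key ?Q lo (Suc ?t)"
    unfolding sorted_run_def using le[OF _ _ y0] sorted by (auto simp: less_Suc_eq)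
  moreover have "key (?Q x) \<le> key (P y)" if "x \<in> {lo..<Suc ?t}" "y \<in> {?i..<mid} \<union> {?j..<hi}" for x y
    using that rest le[of x y] least by (cases "x = ?t") (auto simp del: Un_iff)
  moreover have "?Q ` {lo..<Suc ?t} = P ` ({lo..<?i} \<union> {mid..<?j})"
    unfolding img cons using m[unfolded merging_def] by (elim conjE) (simp only: image_insert)
  ultimately show ?thesis
    unfolding merging_def t using b new by (auto split: if_splits)
qed

context word_bounds
begin

lemma wp_merge_run:
  fixes s :: state and n w lo :: nat
  defines "P \<equiv> arr s ''P''" and "mid \<equiv> min n (lo + w)" and "hi \<equiv> min n (lo + 2 * w)"
    and "key \<equiv> \<lambda>x. arr s ''S'' (nat x)"
  assumes st: "scalar s ''n'' = int n" "scalar s ''w'' = int w" "scalar s ''lo'' = int lo"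
    and bounds: "lo < n" "0 < w" "w \<le> n" "3 * int n \<le> N"
    and P: "\<And>i. i < n \<Longrightarrow> 1 \<le> P i \<and> P i \<le> int n"
    and sorted: "sorted_run key P lo mid" "sorted_run key P mid hi"
  shows "wp B merge_run (\<lambda>t' s'. t' \<le> t + 80 * int w + 50 \<and>
    arr s' ''Q'' ` {lo..<hi} = P ` {lo..<hi} \<and> sorted_run key (arr s' ''Q'') lo hi \<and>
    (\<forall>x. x < lo \<longrightarrow> arr s' ''Q'' x = arr s ''Q'' x)) t s"
proof -
  have lm: "lo \<le> mid" "mid \<le> hi" "hi \<le> n" "lo \<le> hi" "hi \<le> lo + 2 * w"
    using bounds by (auto simp: mid_def hi_def)
  have loop: "wp B (For ''t'' (Var ''lo'') (Var ''hi'') merge_step) (\<lambda>t' s'. t' \<le> t1 + 32 * int (hi - lo) + 6 \<and>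
    arr s' ''Q'' ` {lo..<hi} = P ` {lo..<hi} \<and> sorted_run key (arr s' ''Q'') lo hi \<and>
    (\<forall>x. x < lo \<longrightarrow> arr s' ''Q'' x = arr s ''Q'' x)) t1 s5'"
    if s5': "scalar s5' ''hi'' = int hi" "scalar s5' ''mid'' = int mid" "scalar s5' ''lo'' = int lo"
    "scalar s5' ''i'' = int lo" "scalar s5' ''j'' = int mid" "arr s5' = arr s" for t1 s5'
  proof (rule wp_For[where lo = "int lo" and hi = "int hi" and T = 24 and
        I = "\<lambda>\<tau> s'. \<exists>i j. scalar s' ''i'' = int i \<and> scalar s' ''j'' = int j \<and> nat \<tau> = i + (j - mid) \<and>
          merging key P (arr s' ''Q'') lo mid hi i j \<and> (\<forall>x. x < lo \<longrightarrow> arr s' ''Q'' x = arr s ''Q'' x)"], goal_cases)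
    case 7
    show ?case
      using lm s5' by (intro exI[of _ lo] exI[of _ mid]) (simp add: merging_def sorted_run_def)
  next
    case (9 \<tau> t2 s2)
    then obtain i j where ij: "scalar s2 ''i'' = int i" "scalar s2 ''j'' = int j" "nat \<tau> = i + (j - mid)"
      and m: "merging key P (arr s2 ''Q'') lo mid hi i j"
      and Q: "\<forall>x. x < lo \<longrightarrow> arr s2 ''Q'' x = arr s ''Q'' x" by blast
    have b: "lo \<le> i" "i \<le> mid" "mid \<le> j" "j \<le> hi" using m by (auto simp: merging_def)
    have v: "scalar s2 ''hi'' = int hi" "scalar s2 ''mid'' = int mid" "arr s2 ''P'' = P" "arr s2 ''S'' = arr s ''S''"
      using 9(2) s5' by (simp_all add: merge_step_def merge_left_def merge_right_def same_scalar same_arr P_def)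
    define tt where "tt = i + (j - mid)"
    have nx: "scalar s2 ''t'' = \<tau>" "nat \<tau> = tt" "nat (\<tau> + 1) = Suc tt" "0 \<le> \<tau>"
      using 9(3,4) ij(3) by (simp_all add: tt_def)
    have tt: "lo \<le> tt" "Suc tt = Suc i + (j - mid)" "Suc tt = i + (Suc j - mid)"
      using b by (simp_all add: tt_def)
    have Qtt: "\<forall>x. x < lo \<longrightarrow> ((arr s2 ''Q'')(tt := y)) x = arr s ''Q'' x" for y
      using Q tt(1) by simp
    have small: "int i \<le> N" "int j \<le> N" "\<tau> \<le> N" using b lm bounds 9(5) by linarith+
    have left: "wp B merge_left (\<lambda>t' s'. scalar s' ''t'' = \<tau> \<and> (\<exists>i j. scalar (setv ''t'' (\<tau> + 1) s') ''i'' = int i \<and>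
        scalar (setv ''t'' (\<tau> + 1) s') ''j'' = int j \<and> nat (\<tau> + 1) = i + (j - mid) \<and>
          merging key P (arr (setv ''t'' (\<tau> + 1) s') ''Q'') lo mid hi i j \<and>
          (\<forall>x. x < lo \<longrightarrow> arr (setv ''t'' (\<tau> + 1) s') ''Q'' x = arr s ''Q'' x)) \<and> t' \<le> t2 + 24) t3 s2"
      if "i < mid" "j = hi \<or> key (P i) \<le> key (P j)" "t3 \<le> t2 + 16" for t3
    proof -
      have "\<forall>y\<in>{i..<mid} \<union> {j..<hi}. key (P i) \<le> key (P y)"
      proof
        fix y assume y: "y \<in> {i..<mid} \<union> {j..<hi}"
        show "key (P i) \<le> key (P y)"
        proof (cases "y < mid")
          case True
          then have "i \<le> y" using y b by auto
          then show ?thesis using sorted(1) True b by (simp add: sorted_run_def)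
        next
          case False
          then have "j \<le> y" "y < hi" using y by auto
          then have "key (P j) \<le> key (P y)" using sorted(2) b by (simp add: sorted_run_def)
          then show ?thesis using that(2) \<open>j \<le> y\<close> \<open>y < hi\<close> by auto
        qed
      qed
      from merging_step[OF m, of i True, simplified, OF that(1)] this
      have "merging key P ((arr s2 ''Q'')(tt := P i)) lo mid hi (Suc i) j"
        by (simp only: tt_def Suc_eq_plus1)
      then show ?thesis
        unfolding merge_left_def using that(3) Qtt[of "P i"] tt(2)
        by (simp add: v ij(1,2) nx small asafe_ok asafe_Read_ok del: fun_upd_apply)
    qed
    have right: "wp B merge_right (\<lambda>t' s'. scalar s' ''t'' = \<tau> \<and> (\<exists>i j. scalar (setv ''t'' (\<tau> + 1) s') ''i'' = int i \<and>
        scalar (setv ''t'' (\<tau> + 1) s') ''j'' = int j \<and> nat (\<tau> + 1) = i + (j - mid) \<and>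
          merging key P (arr (setv ''t'' (\<tau> + 1) s') ''Q'') lo mid hi i j \<and>
          (\<forall>x. x < lo \<longrightarrow> arr (setv ''t'' (\<tau> + 1) s') ''Q'' x = arr s ''Q'' x)) \<and> t' \<le> t2 + 24) t3 s2"
      if "j < hi" "i = mid \<or> key (P j) \<le> key (P i)" "t3 \<le> t2 + 16" for t3
    proof -
      have "\<forall>y\<in>{i..<mid} \<union> {j..<hi}. key (P j) \<le> key (P y)"
      proof
        fix y assume y: "y \<in> {i..<mid} \<union> {j..<hi}"
        show "key (P j) \<le> key (P y)"
        proof (cases "y < mid")
          case True
          then have "i \<le> y" using y b by auto
          then have "key (P i) \<le> key (P y)" using sorted(1) True b by (simp add: sorted_run_def)
          then show ?thesis using that(2) \<open>i \<le> y\<close> True by auto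
        next
          case False
          then have "j \<le> y" "y < hi" using y by auto
          then show ?thesis using sorted(2) b by (simp add: sorted_run_def)
        qed
      qed
      from merging_step[OF m, of j False, simplified, OF that(1)] this
      have "merging key P ((arr s2 ''Q'')(tt := P j)) lo mid hi i (Suc j)"
        by (simp only: tt_def Suc_eq_plus1)
      then show ?thesis
        unfolding merge_right_def using that(3) Qtt[of "P j"] tt(3)
        by (simp add: v ij(1,2) nx small asafe_ok asafe_Read_ok del: fun_upd_apply)
          (intro exI[of _ "Suc j"] conjI, simp_all)
    qed
    have Pi: "0 \<le> P i" "P i \<le> N" if "i < n" using P[OF that] bounds by auto
    have Pj: "0 \<le> P j" "P j \<le> N" if "j < n" using P[OF that] bounds by auto
    have lt: "i < mid \<or> j < hi" using 9(5) nx tt_def b lm by linarith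
    show ?case
    proof (cases "j < hi")
      case False
      then show ?thesis
        using lt b unfolding merge_step_def by (simp add: v ij(1,2) left)
    next
      case jh: True
      show ?thesis
      proof (cases "i < mid")
        case False
        then show ?thesis
          using b jh unfolding merge_step_def by (simp add: v ij(1,2) right)
      next
        case True
        have nn: "i < n" "j < n" using True jh lm by simp_all
        have "bsafe B (Less (Read ''S'' (Read ''P'' (Var ''j''))) (Read ''S'' (Read ''P'' (Var ''i'')))) s2"
          using Pi[OF nn(1)] Pj[OF nn(2)] by (simp add: asafe_Read_ok v ij(1,2) small)
        moreover have "bval (Less (Read ''S'' (Read ''P'' (Var ''j''))) (Read ''S'' (Read ''P'' (Var ''i'')))) s2 \<longleftrightarrow>
            key (P j) < key (P i)" by (simp add: v ij(1,2) key_def)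
        ultimately show ?thesis
          using True jh unfolding merge_step_def
          by (cases "key (P j) < key (P i)") (simp_all add: v ij(1,2) left right)
      qed
    qed
  next
    case (10 t' s')
    then obtain i j where ij: "nat (int hi) = i + (j - mid)"
      and m: "merging key P (arr s' ''Q'') lo mid hi i j"
      and Q: "\<forall>x. x < lo \<longrightarrow> arr s' ''Q'' x = arr s ''Q'' x" by blast
    have "i = mid" "j = hi" using ij m lm by (auto simp: merging_def)
    moreover have "{lo..<mid} \<union> {mid..<hi} = {lo..<hi}" using lm by auto
    ultimately show ?case
      using m Q 10(4) lm by (simp add: merging_def)
  qed (use s5' lm bounds B_bounds in \<open>auto simp: merge_step_def merge_left_def merge_right_def same_scalar\<close>)
  have le: "int lo \<le> N" "int w \<le> N" "int lo + int w \<le> N" "int n \<le> N"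
    using bounds by linarith+
  have final: "wp B (For ''t'' (Var ''lo'') (Var ''hi'') merge_step) (\<lambda>t' s'. t' \<le> t + 80 * int w + 50 \<and>
      arr s' ''Q'' ` {lo..<hi} = P ` {lo..<hi} \<and> sorted_run key (arr s' ''Q'') lo hi \<and>
      (\<forall>x. x < lo \<longrightarrow> arr s' ''Q'' x = arr s ''Q'' x)) t1 s1"
    if "t1 \<le> t + 40" "scalar s1 ''hi'' = int hi" "scalar s1 ''mid'' = int mid" "scalar s1 ''lo'' = int lo"
    "scalar s1 ''i'' = int lo" "scalar s1 ''j'' = int mid" "arr s1 = arr s" for t1 s1
    by (rule wp_conseq[OF loop[OF that(2-)]]) (use that(1) lm in auto)
  show ?thesis
    unfolding merge_run_def wp_Seq
    using le
    by (auto simp: st asafe_ok mid_def hi_def min_def intro!: final)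
qed

end

context word_bounds
begin

lemma wp_merge_pass:
  fixes s :: state and n w :: nat
  defines "P \<equiv> arr s ''P''" and "key \<equiv> \<lambda>x. arr s ''S'' (nat x)"
  assumes st: "scalar s ''n'' = int n" "scalar s ''w'' = int w"
    and bounds: "0 < w" "w < n" "3 * int n \<le> N"
    and P: "\<And>i. i < n \<Longrightarrow> 1 \<le> P i \<and> P i \<le> int n"
    and sorted: "sorted_blocks key P w n"
  shows "wp B merge_pass (\<lambda>t' s'. t' \<le> t + 250 * int n \<and> scalar s' ''w'' = int (2 * w) \<and>
    arr s' ''P'' ` {..<n} = P ` {..<n} \<and> sorted_blocks key (arr s' ''P'') (2 * w) n) t s"
proof -
  let ?W = "2 * w"
  let ?body = "merge_run;; ''lo'' ::= Var ''lo'' \<oplus> Var ''w'' \<oplus> Var ''w''"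
  let ?s1 = "setv ''lo'' 0 s"
  let ?Q = "\<lambda>t' s'. t' \<le> t + 220 * int n + 6 \<and> arr s' ''Q'' ` {..<n} = P ` {..<n} \<and>
      sorted_blocks key (arr s' ''Q'') ?W n"
  \<comment> \<open>\<open>g\<close> counts the finished pairs of runs. The last pair may be
    incomplete, so \<open>?W * g\<close> may exceed \<open>n\<close> by less than \<open>?W\<close>;
    hence the minimum.\<close>
  let ?I = "\<lambda>g t' s'. scalar s' ''lo'' = int (?W * g) \<and> ?W * g < n + ?W \<and>
      arr s' ''Q'' ` {..<min n (?W * g)} = P ` {..<min n (?W * g)} \<and>
      sorted_blocks key (arr s' ''Q'') ?W (min n (?W * g)) \<and> t' \<le> t + 2 + 70 * int (?W * g)"
  have W: "0 < ?W" using bounds by simp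
  have "wp B (While (Less (Var ''lo'') (Var ''n'')) ?body) ?Q (t + 2) ?s1"
  proof (rule wp_While[where I = ?I and f = "\<lambda>g. n + ?W - ?W * g" and g = 0], goal_cases)
    case 1
    then show ?case using bounds by (simp add: sorted_blocks_def)
  next
    case 2
    then show ?case by simp
  next
    case (3 g t1 s1)
    let ?lo = "?W * g"
    have s1: "scalar s1 ''n'' = int n" "scalar s1 ''w'' = int w" "arr s1 ''P'' = P" "arr s1 ''S'' = arr s ''S''"
      using 3(2) st by (simp_all add: merge_defs same_scalar
          same_arr P_def)
    have "scalar s1 ''lo'' = int ?lo" using 3(1) by blast
    then have "int ?lo < int n" using 3(3) s1(1) by (simp del: of_nat_mult)
    then have lo: "?lo < n" by linarith
    have hi: "min n (?W * Suc g) = min n (?lo + 2 * w)" by simp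
    have sr: "sorted_run key P ?lo (min n (?lo + w))"
      using sorted_blocks_run[OF sorted bounds(1), of "2 * g"] by (simp add: ac_simps)
    have sr2: "sorted_run key P (min n (?lo + w)) (min n (?lo + 2 * w))"
    proof (cases "?lo + w < n")
      case True
      then show ?thesis
        using sorted_blocks_run[OF sorted bounds(1), of "2 * g + 1"] by (simp add: algebra_simps)
    qed (auto simp: sorted_run_def)
    have ks: "(\<lambda>x. arr s1 ''S'' (nat x)) = key" by (simp add: key_def s1)
    have "wp B merge_run (\<lambda>t' s'. t' \<le> t1 + 4 + 80 * int w + 50 \<and>
      arr s' ''Q'' ` {?lo..<min n (?lo + 2 * w)} = P ` {?lo..<min n (?lo + 2 * w)} \<and>
      sorted_run key (arr s' ''Q'') ?lo (min n (?lo + 2 * w)) \<and>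
      (\<forall>x. x < ?lo \<longrightarrow> arr s' ''Q'' x = arr s1 ''Q'' x)) (t1 + 4) s1"
      using wp_merge_run[of s1 n w ?lo "t1 + 4"] s1(1,2) 3(1) lo bounds P sr sr2
      unfolding ks s1(3) by simp
    note run = this
    have tm0: "t1 + int (btime (Less (Var ''lo'') (Var ''n''))) + 1 = t1 + 4" by simp
    show ?case
      unfolding wp_Seq tm0
    proof (rule wp_conseq[OF run], goal_cases)
      case (1 t2 s2)
      note s2 = 1(1)
      have v: "scalar s2 ''lo'' = int ?lo" "scalar s2 ''w'' = int w"
        using 1(2) s1 3(1)
        by (simp_all add: merge_defs same_scalar)
      have un: "{..<min n (?W * Suc g)} = {..<?lo} \<union> {?lo..<min n (?lo + 2 * w)}"
        using lo by auto
      have minlo: "min n ?lo = ?lo" using lo by simp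
      have old: "arr s2 ''Q'' ` {..<?lo} = P ` {..<?lo}"
      proof -
        have "arr s2 ''Q'' ` {..<?lo} = arr s1 ''Q'' ` {..<?lo}"
          using s2 by (intro image_cong) auto
        moreover have "arr s1 ''Q'' ` {..<min n ?lo} = P ` {..<min n ?lo}" using 3(1) by blast
        ultimately show ?thesis unfolding minlo by simp
      qed
      have img: "arr s2 ''Q'' ` {..<min n (?W * Suc g)} = P ` {..<min n (?W * Suc g)}"
        unfolding un image_Un old using s2 by blast
      have "sorted_blocks key (arr s2 ''Q'') ?W (min n ?lo)"
      proof (rule sorted_blocks_cong)
        show "sorted_blocks key (arr s1 ''Q'') ?W (min n ?lo)" using 3(1) by blast
      qed (use s2 in simp)
      from sorted_blocks_extend[OF this _ W]
      have bl: "sorted_blocks key (arr s2 ''Q'') ?W (min n (?W * Suc g))"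
        using s2 unfolding hi by simp
      have small: "int ?lo + int w \<le> N" "int ?lo \<le> N" "int w \<le> N"
        using lo bounds by linarith+
      have lo': "int ?lo + int w + int w = int (?W * Suc g)" by simp
      have tm: "t2 + 6 \<le> t + 2 + 70 * int (?W * Suc g)"
        using s2 3(1) bounds(1) by simp
      have lt: "?W * Suc g < n + ?W" "n + ?W - ?W * Suc g < n + ?W - ?W * g"
        using lo bounds by auto
      show ?case
        unfolding wp_Assign
      proof (intro conjI exI[of _ "Suc g"])
        show "asafe B (Var ''lo'' \<oplus> Var ''w'' \<oplus> Var ''w'') s2"
          using small v by (intro asafe_ok) auto
      qed (use v lo' tm lt img bl in \<open>simp_all del: mult_Suc_right of_nat_mult\<close>)
    qed
  next
    case (4 g t1 s1)
    have "scalar s1 ''n'' = int n"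
      using 4(2) st by (simp add: merge_defs same_scalar)
    moreover have lo: "scalar s1 ''lo'' = int (?W * g)" using 4(1) by blast
    ultimately have "int n \<le> int (?W * g)" using 4(3) by (simp del: of_nat_mult)
    then have mn: "min n (?W * g) = n" by linarith
    have "?W * g < n + ?W" using 4(1) by blast
    then have "?W * g \<le> 3 * n" using bounds(2) by linarith
    then have "int (?W * g) \<le> 3 * int n" by linarith
    moreover have "t1 \<le> t + 2 + 70 * int (?W * g)" using 4(1) by blast
    ultimately have "t1 + 4 \<le> t + 220 * int n + 6" using bounds by linarith
    moreover have "arr s1 ''Q'' ` {..<min n (?W * g)} = P ` {..<min n (?W * g)}"
      "sorted_blocks key (arr s1 ''Q'') ?W (min n (?W * g))" using 4(1) by blast+
    ultimately show ?case unfolding mn by simp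
  qed
  then show ?thesis
    unfolding merge_pass_def wp_Seq wp_Assign
  proof (intro conjI, goal_cases)
    case 2
    then have "wp B (While (Less (Var ''lo'') (Var ''n'')) ?body) ?Q
        (t + int (atime (Const 0)) + 1) (setv ''lo'' (aval (Const 0) s) s)" by (simp add: add.commute)
    then show ?case
      unfolding wp_Seq
    proof (rule wp_conseq, goal_cases)
      case (1 t2 s2)
      have s2: "scalar s2 ''n'' = int n" "scalar s2 ''w'' = int w"
        using 1(2) st by (simp_all add: merge_defs same_scalar)
      have nN: "int n \<le> N" "int w \<le> N" using bounds by linarith+
      show ?case
      proof (rule wp_For[where lo = 0 and hi = "int n" and T = 4 and
          I = "\<lambda>i s'. \<forall>j<nat i. arr s' ''P'' j = arr s2 ''Q'' j"], goal_cases)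
        case (9 i t3 s3)
        then show ?case
          using nN by (simp add: asafe_ok asafe_Read_ok same_arr nat_add_distrib less_Suc_eq)
      next
        case (10 t3 s3)
        have P': "arr s3 ''P'' j = arr s2 ''Q'' j" if "j < n" for j using 10(1) that by simp
        have "arr s3 ''P'' ` {..<n} = arr s2 ''Q'' ` {..<n}" using P' by simp
        moreover have "sorted_blocks key (arr s3 ''P'') ?W n"
          using P' 1(1) by (auto intro: sorted_blocks_cong)
        moreover have "scalar s3 ''w'' = int w" using 10(2) s2 by (simp add: same_scalar)
        moreover have "1 \<le> int n" using bounds by simp
        ultimately show ?case using 1(1) 10(4) nN by (simp add: asafe_ok)
      qed (use s2 nN B_bounds in \<open>auto simp: same_scalar\<close>)
    qed
  qed simp
qed

lemma wp_merge_sort: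
  fixes s :: state and n lg :: nat
  defines "key \<equiv> \<lambda>x. arr s ''S'' (nat x)"
  assumes st: "scalar s ''n'' = int n"
    and bounds: "1 \<le> n" "3 * int n \<le> N" "n \<le> 2 ^ lg"
  shows "wp B merge_sort (\<lambda>t' s'. t' \<le> t + 300 * (int n * (int lg + 1)) \<and>
    arr s' ''P'' ` {..<n} = {1..int n} \<and> sorted_run key (arr s' ''P'') 0 n) t s"
proof -
  have nN: "int n \<le> N" using bounds by linarith
  let ?I = "\<lambda>e t' s'. scalar s' ''w'' = 2 ^ e \<and> e \<le> lg \<and> arr s' ''P'' ` {..<n} = {1..int n} \<and>
      sorted_blocks key (arr s' ''P'') (2 ^ e) n \<and> t' \<le> t + 30 * int n + int e * (260 * int n)"
  have "wp B (While (Less (Var ''w'') (Var ''n'')) merge_pass) (\<lambda>t' s'. t' \<le> t + 300 * (int n * (int lg + 1)) \<and>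
    arr s' ''P'' ` {..<n} = {1..int n} \<and> sorted_run key (arr s' ''P'') 0 n) t1 s1"
    if I: "?I 0 t1 s1" and s1: "scalar s1 ''n'' = int n" "arr s1 ''S'' = arr s ''S''" for t1 s1
  proof (rule wp_While[where I = ?I and f = "\<lambda>e. lg - e" and g = 0], goal_cases)
    case 1
    show ?case by (rule I)
  next
    case 2
    then show ?case by simp
  next
    case (3 e t2 s2)
    have s2: "scalar s2 ''n'' = int n" "arr s2 ''S'' = arr s ''S''"
      using 3(2) s1 by (simp_all add: merge_pass_def merge_defs same_scalar same_arr)
    have w: "scalar s2 ''w'' = int (2 ^ e)" using 3(1) by simp
    have en: "2 ^ e < n" using 3(3) w s2 by simp
    have "e < lg"
    proof (rule ccontr)
      assume "\<not> e < lg"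
      then have "(2::nat) ^ lg \<le> 2 ^ e" by (intro power_increasing) auto
      with en bounds show False by linarith
    qed
    have "1 \<le> arr s2 ''P'' i \<and> arr s2 ''P'' i \<le> int n" if "i < n" for i
      using 3(1) that by (metis atLeastAtMost_iff imageI lessThan_iff)
    note mp = wp_merge_pass[OF s2(1) w _ en bounds(2) this, of "t2 + 4"]
    have ks: "(\<lambda>x. arr s2 ''S'' (nat x)) = key" by (simp add: key_def s2)
    have "wp B merge_pass (\<lambda>t' s'. t' \<le> t2 + 4 + 250 * int n \<and> scalar s' ''w'' = int (2 * 2 ^ e) \<and>
      arr s' ''P'' ` {..<n} = arr s2 ''P'' ` {..<n} \<and> sorted_blocks key (arr s' ''P'') (2 * 2 ^ e) n) (t2 + 4) s2"
      using mp 3(1) unfolding ks by simp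
    note pass = this
    have tm0: "t2 + int (btime (Less (Var ''w'') (Var ''n''))) + 1 = t2 + 4" by simp
    show ?case
      unfolding tm0
    proof (rule wp_conseq[OF pass], goal_cases)
      case (1 t3 s3)
      have "t3 \<le> t + 30 * int n + int (Suc e) * (260 * int n)"
        using 1(1) 3(1) bounds(1) by (simp add: algebra_simps)
      then show ?case using 1(1) 3(1) \<open>e < lg\<close> by (intro exI[of _ "Suc e"]) auto
    qed
  next
    case (4 e t2 s2)
    have "scalar s2 ''n'' = int n"
      using 4(2) s1 by (simp add: merge_pass_def merge_defs same_scalar)
    then have "int n \<le> int (2 ^ e)" using 4(1,3) by simp
    then have en: "n \<le> 2 ^ e" by linarith
    have "sorted_run key (arr s2 ''P'') 0 n"
      unfolding sorted_run_def
    proof (intro allI impI)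
      fix i j assume ij: "0 \<le> i \<and> i \<le> j \<and> j < n"
      then have "i div 2 ^ e = 0" "j div 2 ^ e = 0" using en by simp_all
      then show "key (arr s2 ''P'' i) \<le> key (arr s2 ''P'' j)"
        using 4(1) ij by (simp add: sorted_blocks_def)
    qed
    moreover have "int e * (260 * int n) \<le> int lg * (260 * int n)"
      using 4(1) by (intro mult_right_mono) auto
    then have "t2 + 4 \<le> t + 300 * (int n * (int lg + 1))"
      using 4(1) bounds(1) mult_nonneg_nonneg[of "int lg" "int n"]
      unfolding distrib_left mult.commute[of "int n" "int lg"] by linarith
    ultimately show ?case using 4(1) by simp
  qed
  note loop = this
  show ?thesis
    unfolding merge_sort_def wp_Seq
  proof (rule wp_For[where lo = 0 and hi = "int n" and T = 5 and
      I = "\<lambda>i s'. \<forall>j<nat i. arr s' ''P'' j = int j + 1"], goal_cases)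
    case (9 i t3 s3)
    then show ?case
      using nN by (simp add: asafe_ok asafe_Read_ok nat_add_distrib less_Suc_eq)
  next
    case (10 t3 s3)
    have P: "arr s3 ''P'' j = int j + 1" if "j < n" for j using 10(1) that by simp
    have "(\<lambda>j. int j + 1) ` {..<n} = {1..int n}"
    proof (intro equalityI subsetI)
      fix x assume "x \<in> {1..int n}"
      then have "x = int (nat (x - 1)) + 1" "nat (x - 1) < n" by auto
      then show "x \<in> (\<lambda>j. int j + 1) ` {..<n}" by blast
    qed auto
    then have "arr s3 ''P'' ` {..<n} = {1..int n}" using P by simp
    moreover have "sorted_blocks key (arr s3 ''P'') 1 n" by (simp add: sorted_blocks_def)
    ultimately show ?case
      using 10 bounds(1) st unfolding wp_Assign
      by (intro conjI loop) (simp_all add: same_scalar same_arr)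
  qed (use st nN B_bounds in \<open>auto simp: same_scalar\<close>)
qed

end


section \<open>Processing all characters\<close>

definition scan :: com where
  "scan = While (And (Less (Var ''h'') (Var ''n'')) (Equal (Read ''S'' (Read ''P'' (Var ''h''))) (Var ''ch'')))
     (''h'' ::= Var ''h'' \<oplus> Const 1)"

text \<open>\<open>''cut''\<close> holds \<open>n * lg * lg\<close>; comparing it with the square of
  the block length avoids a square root.\<close>

definition group :: "com \<Rightarrow> com" where
  "group cp =
    (''ch'' ::= Read ''S'' (Read ''P'' (Var ''g''));; ''h'' ::= Var ''g'' \<oplus> Const 1;; scan;;
     If (Less ((Var ''h'' \<ominus> Var ''g'') \<otimes> (Var ''h'' \<ominus> Var ''g'')) (Var ''cut'')) char_pairs (char_conv cp);;
     ''g'' ::= Var ''h'')"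

text \<open>
  \<open>And\<close> evaluates both operands, so the scan reads \<open>P[n]\<close>, which therefore holds a valid position.
\<close>

definition groups :: "com \<Rightarrow> com" where
  "groups cp =
    (''g'' ::= Const 0;; Write ''P'' (Var ''n'') (Const 1);; While (Less (Var ''g'') (Var ''n'')) (group cp))"

lemmas char_defs = char_conv_def char_pairs_def pair_def quad_defs

lemma (in word_bounds) wp_scan:
  fixes s :: state and n g :: nat
  defines "P \<equiv> arr s ''P''" and "key \<equiv> \<lambda>x. arr s ''S'' (nat x)"
  assumes st: "scalar s ''n'' = int n" "scalar s ''h'' = int g + 1" "scalar s ''ch'' = key (P g)"
    and g: "g < n" "int n + 1 \<le> N"
    and P: "\<And>i. i \<le> n \<Longrightarrow> 1 \<le> P i \<and> P i \<le> int n"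
  shows "wp B scan (\<lambda>t' s'. \<exists>h. scalar s' ''h'' = int h \<and> g < h \<and> h \<le> n \<and>
    (\<forall>j. g \<le> j \<and> j < h \<longrightarrow> key (P j) = key (P g)) \<and> (h < n \<longrightarrow> key (P h) \<noteq> key (P g)) \<and>
    t' \<le> t + 20 * (int h - int g)) t s"
  unfolding scan_def
\<comment> \<open>The \<open>- 20\<close> reserves time for the failing test at the end; it is
  available because the block contains index \<open>g\<close> from the start.\<close>
proof (rule wp_While[where I = "\<lambda>h t' s'. scalar s' ''h'' = int h \<and> g < h \<and> h \<le> n \<and>
    (\<forall>j. g \<le> j \<and> j < h \<longrightarrow> key (P j) = key (P g)) \<and> t' \<le> t + 20 * (int h - int g) - 20" and
    f = "\<lambda>h. n - h" and g = "Suc g"], goal_cases)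
  case 1
  then show ?case using st g by (auto simp: less_Suc_eq)
next
  case (2 h t1 s1)
  have "arr s1 ''P'' h = P h" using 2(2) by (simp add: same_arr P_def)
  moreover have h: "scalar s1 ''h'' = int h" "h \<le> n" using 2(1) by blast+
  moreover have "int h \<le> N" using h(2) g by linarith
  moreover have "0 \<le> P h" "P h \<le> N" using P[OF h(2)] g by linarith+
  ultimately show ?case by (simp add: asafe_Read_ok)
next
  case (3 h t1 s1)
  have v: "scalar s1 ''n'' = int n" "scalar s1 ''ch'' = key (P g)" "arr s1 ''P'' = P" "arr s1 ''S'' = arr s ''S''"
    using 3(2) st by (simp_all add: same_scalar same_arr P_def)
  have sh: "scalar s1 ''h'' = int h" and hg: "g < h" and t1: "t1 \<le> t + 20 * (int h - int g) - 20"
    and old: "\<forall>j. g \<le> j \<and> j < h \<longrightarrow> key (P j) = key (P g)"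
    using 3(1) by blast+
  have h: "h < n" "key (P h) = key (P g)" using 3(3) v sh by (simp_all add: key_def)
  have hN: "int h \<le> N" using h(1) g by linarith
  have new: "\<forall>j. g \<le> j \<and> j < Suc h \<longrightarrow> key (P j) = key (P g)"
    using old h(2) by (metis less_Suc_eq)
  show ?case
    unfolding wp_Assign
  proof (intro conjI exI[of _ "Suc h"])
    show "asafe B (Var ''h'' \<oplus> Const 1) s1" using sh hN by (intro asafe_ok) auto
    show "\<forall>j. g \<le> j \<and> j < Suc h \<longrightarrow> key (P j) = key (P g)" by (rule new)
  qed (use sh hg h(1) t1 in simp_all)
next
  case (4 h t1 s1)
  have v: "scalar s1 ''n'' = int n" "scalar s1 ''ch'' = key (P g)" "arr s1 ''P'' = P" "arr s1 ''S'' = arr s ''S''"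
    using 4(2) st by (simp_all add: same_scalar same_arr P_def)
  have h: "scalar s1 ''h'' = int h" and hg: "g < h" "h \<le> n"
    and t1: "t1 \<le> t + 20 * (int h - int g) - 20"
    and old: "\<forall>j. g \<le> j \<and> j < h \<longrightarrow> key (P j) = key (P g)"
    using 4(1) by blast+
  have "h < n \<longrightarrow> key (P h) \<noteq> key (P g)" using 4(3) v h by (simp add: key_def)
  moreover have "t1 + int (btime (And (Less (Var ''h'') (Var ''n''))
      (Equal (Read ''S'' (Read ''P'' (Var ''h''))) (Var ''ch'')))) + 1 \<le> t + 20 * (int h - int g)"
    using t1 by simp
  ultimately show ?case using h hg old by blast
qed

context cadence_machine
begin

definition genv :: "nat \<Rightarrow> state \<Rightarrow> bool" where
  "genv L s \<longleftrightarrow> env s \<and> scalar s ''x0'' = x_min \<and> scalar s ''xe'' = x_min + classes \<and>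
     scalar s ''d0'' = d_min \<and> scalar s ''s0'' = 2 ^ L \<and> scalar s ''cut'' = n * lg * lg"

definition occ :: "(int \<Rightarrow> int) \<Rightarrow> int \<Rightarrow> int" where
  "occ key v = int (card {x. 1 \<le> x \<and> x \<le> n \<and> key x = v})"

text \<open>Since the keys are sorted and smaller ones lie before \<open>g\<close>, the block from
  \<open>g\<close> to \<open>h\<close> lists exactly the occurrences of its character. The minimum
  in the time bound is attained by the branch that the comparison with \<open>''cut''\<close>
  selects.\<close>

lemma wp_group:
  fixes s :: state and L g :: nat and cnt :: int
  defines "P \<equiv> arr s ''P''" and "key \<equiv> \<lambda>x. arr s ''S'' (nat x)"
  defines "v \<equiv> key (P g)"
  assumes genv: "genv L s" and st: "scalar s ''g'' = int g" "scalar s ''count'' = cnt"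
    and g: "int g < n"
    and P: "\<And>i. int i \<le> n \<Longrightarrow> 1 \<le> P i \<and> P i \<le> n" "P ` {..<nat n} = {1..n}"
    and sorted: "sorted_run key P 0 (nat n)"
    and less: "\<And>i. i < g \<Longrightarrow> key (P i) < v"
    and d: "d_min \<le> d_max"
    and L: "side \<le> 2 ^ L" "2 ^ L \<le> 2 * side" "int L + 1 \<le> 6 * lg"
    and bounds: "2 ^ L \<le> X" "x_min + classes \<le> X" "d_min \<le> X"
    and cnt: "0 \<le> cnt" "cnt + int (card (cad (\<lambda>x. key x = v))) \<le> N"
  shows "wp B (group cp) (\<lambda>t' s'. \<exists>h. scalar s' ''g'' = int h \<and> g < h \<and> int h \<le> n \<and>
    (\<forall>j. g \<le> j \<and> j < h \<longrightarrow> key (P j) = v) \<and> (\<forall>j. h \<le> j \<and> int j < n \<longrightarrow> v < key (P j)) \<and>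
    t' \<le> t + 60 * (int h - int g) + (1728 * C + 1000000) * min ((occ key v)\<^sup>2) (n * lg * lg) \<and>
    scalar s' ''count'' = cnt + int (card (cad (\<lambda>x. key x = v)))) t s"
proof -
  let ?KK = "1728 * C + 1000000"
  let ?Q = "\<lambda>t' s'. \<exists>h. scalar s' ''g'' = int h \<and> g < h \<and> int h \<le> n \<and>
    (\<forall>j. g \<le> j \<and> j < h \<longrightarrow> key (P j) = v) \<and> (\<forall>j. h \<le> j \<and> int j < n \<longrightarrow> v < key (P j)) \<and>
    t' \<le> t + 60 * (int h - int g) + ?KK * min ((occ key v)\<^sup>2) (n * lg * lg) \<and>
    scalar s' ''count'' = cnt + int (card (cad (\<lambda>x. key x = v)))"
  have n: "int (nat n) = n" using params_le by simp
  have nN: "n + 1 \<le> N" "int g \<le> N" using params_le nX X_bounds X8 g by linarith+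
  have e: "scalar s ''n'' = n" using genv by (simp add: genv_def env_def)
  have Pg: "0 \<le> P g" "P g \<le> N" using P(1)[of g] g nN by auto
  have inj: "inj_on P {..<nat n}"
    using P(2) n by (intro eq_card_imp_inj_on) auto
  define s1 where "s1 = setv ''h'' (int g + 1) (setv ''ch'' v s)"
  have s1: "scalar s1 ''n'' = int (nat n)" "scalar s1 ''h'' = int g + 1" "scalar s1 ''ch'' = v"
    "arr s1 = arr s" "genv L s1" "scalar s1 ''g'' = int g" "scalar s1 ''count'' = cnt"
    using e n genv st by (simp_all add: s1_def genv_def env_def)
  have "wp B scan (\<lambda>t' s'. \<exists>h. scalar s' ''h'' = int h \<and> g < h \<and> h \<le> nat n \<and>
    (\<forall>j. g \<le> j \<and> j < h \<longrightarrow> key (P j) = v) \<and> (h < nat n \<longrightarrow> key (P h) \<noteq> v) \<and>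
    t' \<le> t + 8 + 20 * (int h - int g)) (t + 8) s1"
    using wp_scan[of s1 "nat n" g "t + 8"] s1 g nN P(1) n
    unfolding v_def key_def P_def s1(4) by simp
  then have "wp B scan (wp B (If (Less ((Var ''h'' \<ominus> Var ''g'') \<otimes> (Var ''h'' \<ominus> Var ''g'')) (Var ''cut''))
      char_pairs (char_conv cp)) (wp B (''g'' ::= Var ''h'') ?Q)) (t + 8) s1"
  proof (rule wp_conseq, goal_cases)
    case (1 t2 s2)
    then obtain h where h: "scalar s2 ''h'' = int h" "g < h" "h \<le> nat n"
      "\<forall>j. g \<le> j \<and> j < h \<longrightarrow> key (P j) = v" "h < nat n \<longrightarrow> key (P h) \<noteq> v"
      and t2: "t2 \<le> t + 8 + 20 * (int h - int g)" by blast
    have hn: "int h \<le> n" using h n by linarith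
    have s2: "scalar s2 ''g'' = int g" "scalar s2 ''count'' = cnt" "scalar s2 ''ch'' = v" "arr s2 = arr s"
      "scalar s2 ''cut'' = n * lg * lg"
      using 1(2) s1 by (auto simp: scan_def same_scalar same_arr genv_def intro!: ext)
    have genv2: "genv L s2" "env s2"
      using 1(2) s1(5) by (auto simp: scan_def genv_def same_scalar elim!: env_same)
    have le: "key (P i) \<le> key (P j)" if "i \<le> j" "j < nat n" for i j
      using sorted that by (simp add: sorted_run_def)
    have gt: "v < key (P j)" if "h \<le> j" "int j < n" for j
    proof -
      have "h < nat n" using that by linarith
      then have "v < key (P h)" using h(5) le[of g h] h(2) unfolding v_def by auto
      also have "\<dots> \<le> key (P j)" using le[of h j] that by simp
      finally show ?thesis .
    qed
    have img: "P ` {g..<h} = {x. 1 \<le> x \<and> x \<le> n \<and> key x = v}"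
    proof (intro equalityI subsetI)
      fix x assume "x \<in> P ` {g..<h}"
      then show "x \<in> {x. 1 \<le> x \<and> x \<le> n \<and> key x = v}" using h(4) P(1) hn by auto
    next
      fix x assume x: "x \<in> {x. 1 \<le> x \<and> x \<le> n \<and> key x = v}"
      then have "x \<in> P ` {..<nat n}" unfolding P(2) by simp
      then obtain j where j: "j < nat n" "x = P j" by blast
      have "\<not> j < g" using less[of j] x j by auto
      moreover have "int j < n" using j(1) by linarith
      then have "\<not> h \<le> j" using gt[of j] x j by auto
      ultimately show "x \<in> P ` {g..<h}" using j by auto
    qed
    have inj': "inj_on P {g..<h}" using inj by (rule inj_on_subset) (use h in auto)
    have occ: "occ key v = int h - int g"
      unfolding occ_def img[symmetric] card_image[OF inj'] using h by simp
    have safe: "asafe B ((Var ''h'' \<ominus> Var ''g'') \<otimes> (Var ''h'' \<ominus> Var ''g'')) s2"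
      using h s2 nN hn by (intro asafe_ok) auto
    have keys: "(\<lambda>x. arr s2 ''S'' (nat x) = v) = (\<lambda>x. key x = v)" by (simp add: key_def s2)
    have keyx: "arr s ''S'' (nat x) = key x" for x by (simp add: key_def)
    define M where "M = ?KK * min ((occ key v)\<^sup>2) (n * lg * lg)"
    let ?QQ = "\<lambda>t' s'. t' \<le> t2 + 10 + ?KK * min ((occ key v)\<^sup>2) (n * lg * lg) \<and>
      scalar s' ''count'' = cnt + int (card (cad (\<lambda>x. key x = v)))"
    have fin: "wp B (''g'' ::= Var ''h'') ?Q t3 s3" if "?QQ t3 s3" "scalar s3 ''h'' = int h" for t3 s3
    proof -
      have "int g + 1 \<le> int h" using h(2) by linarith
      then have "t3 + 2 \<le> t + 60 * (int h - int g) + ?KK * min ((occ key v)\<^sup>2) (n * lg * lg)"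
        using conjunct1[OF that(1)] t2 unfolding M_def[symmetric] by (simp add: algebra_simps)
      then show ?thesis
        unfolding wp_Assign using that h(2,4) hn gt by (intro conjI exI[of _ h]) auto
    qed
    show ?case
    proof (cases "(int h - int g) * (int h - int g) < n * lg * lg")
      case True
      have "wp B char_pairs (\<lambda>t' s'. t' \<le> t2 + 10 + 200 * (int h - int g)\<^sup>2 \<and>
        scalar s' ''count'' = cnt + int (card (cad (\<lambda>x. arr s2 ''S'' (nat x) = v)))) (t2 + 10) s2"
        by (rule wp_char_pairs[where g = g and h = h])
          (use genv2 s2 h hn nN inj' img cnt in \<open>simp_all add: keyx flip: P_def\<close>)
      then have "wp B char_pairs (wp B (''g'' ::= Var ''h'') ?Q) (t2 + 10) s2"
      proof (rule wp_conseq, goal_cases)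
        case (1 t3 s3)
        have "scalar s3 ''h'' = int h" using 1(2) h(1) by (simp add: char_pairs_def pair_def same_scalar)
        moreover have "200 * (int h - int g)\<^sup>2 \<le> ?KK * min ((occ key v)\<^sup>2) (n * lg * lg)"
        proof -
          have "min ((occ key v)\<^sup>2) (n * lg * lg) = (int h - int g)\<^sup>2"
            using True by (simp add: occ power2_eq_square)
          then show ?thesis using C_nonneg by (simp add: mult_right_mono)
        qed
        ultimately show ?case using 1(1) unfolding keys by (intro fin) auto
      qed
      then show ?thesis
        using True safe by (simp add: h s2 add.commute)
    next
      case False
      have "wp B (char_conv cp) (\<lambda>t' s'. t' \<le> t2 + 10 + ?KK * (n * lg * lg) \<and>
        scalar s' ''count'' = cnt + int (card (cad (\<lambda>x. arr s2 ''S'' (nat x) = v)))) (t2 + 10) s2"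
        using genv2 s2 d L bounds cnt
        by (intro wp_char_conv[where L = L]) (simp_all add: genv_def keyx)
      then have "wp B (char_conv cp) (wp B (''g'' ::= Var ''h'') ?Q) (t2 + 10) s2"
      proof (rule wp_conseq, goal_cases)
        case (1 t3 s3)
        have "scalar s3 ''h'' = int h"
          using 1(2) h(1) by (simp add: char_defs same_scalar)
        moreover have "min ((occ key v)\<^sup>2) (n * lg * lg) = n * lg * lg"
          using False by (simp add: occ power2_eq_square)
        ultimately show ?case using 1(1) unfolding keys by (intro fin) auto
      qed
      then show ?thesis
        using False safe by (simp add: h s2 add.commute)
    qed
  qed
  then show ?thesis
    unfolding group_def wp_Seq
    using Pg nN by (simp add: st asafe_ok asafe_Read_ok s1_def v_def key_def add.commute flip: P_def)
qed

definition chars :: "(int \<Rightarrow> int) \<Rightarrow> int set" where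
  "chars key = key ` {1..n}"

lemma wp_groups:
  fixes s :: state and L :: nat
  defines "P \<equiv> arr s ''P''" and "key \<equiv> \<lambda>x. arr s ''S'' (nat x)"
  assumes genv: "genv L s" and st: "scalar s ''count'' = 0"
    and P: "P ` {..<nat n} = {1..n}"
    and sorted: "sorted_run key P 0 (nat n)"
    and d: "d_min \<le> d_max"
    and L: "side \<le> 2 ^ L" "2 ^ L \<le> 2 * side" "int L + 1 \<le> 6 * lg"
    and bounds: "2 ^ L \<le> X" "x_min + classes \<le> X" "d_min \<le> X"
    and cnt: "(\<Sum>v\<in>chars key. int (card (cad (\<lambda>x. key x = v)))) \<le> N"
  shows "wp B (groups cp) (\<lambda>t' s'.
    t' \<le> t + 80 * n + (1728 * C + 1000000) * (\<Sum>v\<in>chars key. min ((occ key v)\<^sup>2) (n * lg * lg)) \<and>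
    scalar s' ''count'' = (\<Sum>v\<in>chars key. int (card (cad (\<lambda>x. key x = v))))) t s"
proof -
  let ?KK = "1728 * C + 1000000"
  define G where "G v = int (card (cad (\<lambda>x. key x = v)))" for v
  define M where "M v = min ((occ key v)\<^sup>2) (n * lg * lg)" for v
  \<comment> \<open>\<open>P\<close> with the sentinel that \<open>groups\<close> writes at index
    \<open>n\<close>; on the sorted range both agree.\<close>
  define P' where "P' = P(nat n := 1)"
  have n: "int (nat n) = n" "1 \<le> n" using params_le a0 ab bc ck kn by simp_all
  have nN: "n \<le> N" using params_le by simp
  have P'eq: "P' i = P i" if "i < nat n" for i using that by (simp add: P'_def)
  have P': "P' ` {..<nat n} = {1..n}" using P P'eq by simp
  have sorted': "sorted_run key P' 0 (nat n)" using sorted P'eq by (auto intro: sorted_run_cong)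
  have P1: "1 \<le> P' i \<and> P' i \<le> n" if "int i \<le> n" for i
  proof (cases "i = nat n")
    case False
    then have "i < nat n" using that n by linarith
    then show ?thesis using P' by (metis atLeastAtMost_iff imageI lessThan_iff)
  qed (use n in \<open>simp add: P'_def\<close>)
  have G0: "0 \<le> G v" for v by (simp add: G_def)
  have chars: "chars key = (\<lambda>i. key (P' i)) ` {..<nat n}"
    unfolding chars_def P'[symmetric] by (simp add: image_image)
  let ?V = "\<lambda>g. (\<lambda>i. key (P' i)) ` {..<g}"
  let ?I = "\<lambda>g t' s'. scalar s' ''g'' = int g \<and> int g \<le> n \<and>
    (\<forall>i j. i < g \<and> g \<le> j \<and> int j < n \<longrightarrow> key (P' i) < key (P' j)) \<and>
    scalar s' ''count'' = (\<Sum>v\<in>?V g. G v) \<and>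
    t' \<le> t + 5 + 64 * int g + ?KK * (\<Sum>v\<in>?V g. M v)"
  let ?s1 = "seta ''P'' (nat n) 1 (setv ''g'' 0 s)"
  have e: "scalar s ''n'' = n" using genv by (simp add: genv_def env_def)
  have genv1: "genv L ?s1" using genv by (simp add: genv_def env_def)
  have "wp B (While (Less (Var ''g'') (Var ''n'')) (group cp)) (\<lambda>t' s'.
    t' \<le> t + 80 * n + ?KK * (\<Sum>v\<in>chars key. M v) \<and> scalar s' ''count'' = (\<Sum>v\<in>chars key. G v)) (t + 5) ?s1"
  proof (rule wp_While[where I = ?I and f = "\<lambda>g. nat n - g" and g = 0], goal_cases)
    case 1
    show ?case using st n by simp
  next
    case 2
    then show ?case by simp
  next
    case (3 g t1 s1)
    have I: "scalar s1 ''g'' = int g" "int g \<le> n" "scalar s1 ''count'' = (\<Sum>v\<in>?V g. G v)"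
      "t1 \<le> t + 5 + 64 * int g + ?KK * (\<Sum>v\<in>?V g. M v)"
      and less: "\<forall>i j. i < g \<and> g \<le> j \<and> int j < n \<longrightarrow> key (P' i) < key (P' j)"
      using 3(1) by blast+
    have s1: "arr s1 ''P'' = P'" "arr s1 ''S'' = arr s ''S''" "scalar s1 ''n'' = n"
      using 3(2) e by (simp_all add: group_def scan_def char_defs same_arr same_scalar P'_def P_def fun_eq_iff)
    have keyx: "arr s ''S'' (nat x) = key x" for x by (simp add: key_def)
    have "env s1" using 3(2) genv1
      by (auto simp: genv_def group_def scan_def char_defs elim!: env_same)
    then have genv': "genv L s1"
      using 3(2) genv1 by (auto simp: genv_def group_def scan_def char_defs same_scalar)
    have gn: "int g < n" using 3(3) I(1) s1(3) by simp
    \<comment> \<open>Earlier blocks have strictly smaller keys, so no character is counted or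
      charged twice.\<close>
    have new: "key (P' g) \<notin> ?V g" using less gn by fastforce
    have tot: "(\<Sum>v\<in>?V g. G v) + G (key (P' g)) \<le> (\<Sum>v\<in>chars key. G v)"
    proof -
      have "(\<Sum>v\<in>insert (key (P' g)) (?V g). G v) \<le> (\<Sum>v\<in>chars key. G v)"
        unfolding chars using gn G0 by (intro sum_mono2) auto
      then show ?thesis using new by (simp add: add.commute)
    qed
    have run: "wp B (group cp) (\<lambda>t' s'. \<exists>h. scalar s' ''g'' = int h \<and> g < h \<and> int h \<le> n \<and>
      (\<forall>j. g \<le> j \<and> j < h \<longrightarrow> key (P' j) = key (P' g)) \<and> (\<forall>j. h \<le> j \<and> int j < n \<longrightarrow> key (P' g) < key (P' j)) \<and>
      t' \<le> t1 + 4 + 60 * (int h - int g) + ?KK * M (key (P' g)) \<and>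
      scalar s' ''count'' = (\<Sum>v\<in>?V g. G v) + G (key (P' g))) (t1 + 4) s1"
      using wp_group[of L s1 g "\<Sum>v\<in>?V g. G v" "t1 + 4"] genv' I(1,3) gn P1 P' sorted' less d L bounds
        tot cnt G0
      unfolding s1(1,2) keyx M_def G_def by (simp add: sum_nonneg)
    have tm0: "t1 + int (btime (Less (Var ''g'') (Var ''n''))) + 1 = t1 + 4" by simp
    show ?case
      unfolding tm0
    proof (rule wp_conseq[OF run], goal_cases)
      case (1 t2 s2)
      then obtain h where h: "scalar s2 ''g'' = int h" "g < h" "int h \<le> n"
        "\<forall>j. g \<le> j \<and> j < h \<longrightarrow> key (P' j) = key (P' g)" "\<forall>j. h \<le> j \<and> int j < n \<longrightarrow> key (P' g) < key (P' j)"
        "t2 \<le> t1 + 4 + 60 * (int h - int g) + ?KK * M (key (P' g))"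
        "scalar s2 ''count'' = (\<Sum>v\<in>?V g. G v) + G (key (P' g))" by blast
      have "{..<h} = {..<g} \<union> {g..<h}" using h(2) by auto
      moreover have "(\<lambda>i. key (P' i)) ` {g..<h} = (\<lambda>i. key (P' g)) ` {g..<h}"
        by (intro image_cong refl) (rule h(4)[rule_format], simp)
      moreover have "(\<lambda>i. key (P' g)) ` {g..<h} = {key (P' g)}" using h(2) by (simp add: image_constant_conv)
      ultimately have V: "?V h = insert (key (P' g)) (?V g)" by (simp add: image_Un)
      have sums: "(\<Sum>v\<in>?V h. F v) = F (key (P' g)) + (\<Sum>v\<in>?V g. F v)" for F :: "int \<Rightarrow> int"
        unfolding V using new by simp
      have less': "\<forall>i j. i < h \<and> h \<le> j \<and> int j < n \<longrightarrow> key (P' i) < key (P' j)"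
      proof (intro allI impI)
        fix i j assume ij: "i < h \<and> h \<le> j \<and> int j < n"
        show "key (P' i) < key (P' j)"
        proof (cases "i < g")
          case True
          then show ?thesis using less ij h(2) by auto
        next
          case False
          then have "key (P' i) = key (P' g)" using h(4) ij by (metis not_le)
          then show ?thesis using h(5) ij by metis
        qed
      qed
      have "int g + 1 \<le> int h" using h(2) by linarith
      then have "t2 \<le> t + 5 + 64 * int h + ?KK * (\<Sum>v\<in>?V h. M v)"
        using h(6) I(4) unfolding sums by (simp add: algebra_simps)
      moreover have "nat n - h < nat n - g" using h(2,3) gn by linarith
      ultimately show ?case
        using h(1,3,7) less' sums[of G] by (intro exI[of _ h]) (simp add: add.commute)
    qed
  next
    case (4 g t1 s1)
    have I: "scalar s1 ''g'' = int g" "int g \<le> n" "scalar s1 ''count'' = (\<Sum>v\<in>?V g. G v)"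
      "t1 \<le> t + 5 + 64 * int g + ?KK * (\<Sum>v\<in>?V g. M v)"
      using 4(1) by blast+
    have "scalar s1 ''n'' = n"
      using 4(2) e by (simp add: group_def scan_def char_defs same_scalar)
    then have "g = nat n" using I(1,2) 4(3) by simp
    then have "?V g = chars key" "int g = n" using chars n by simp_all
    then show ?case using I(3,4) n by simp
  qed
  then show ?thesis
    unfolding groups_def wp_Seq G_def M_def
    using n nN by (simp add: e asafe_ok asafe_Read_ok add.commute)
qed

end


section \<open>The complete algorithm\<close>

definition doubling :: "name \<Rightarrow> name \<Rightarrow> name \<Rightarrow> com" where
  "doubling x y z = While (Less (Var x) (Var y)) (x ::= Var x \<oplus> Var x;; z ::= Var z \<oplus> Const 1)"

definition params :: com where
  "params =
    (''D'' ::= Var ''c'' \<ominus> Var ''a'';; ''al'' ::= Var ''c'' \<ominus> Var ''b'';; ''be'' ::= Var ''b'' \<ominus> Var ''a'';;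
     ''d0'' ::= Div (Var ''n'') (Var ''k'' \<oplus> Const 1) \<oplus> Const 1;;
     ''d'' ::= Div (Var ''n'' \<ominus> Const 1) (Var ''k'' \<ominus> Const 1))"

text \<open>\<open>''d''\<close>, \<open>''u''\<close> and \<open>''m''\<close> hold
  \<open>d_max\<close>, \<open>x_span\<close> and \<open>side\<close>. \<open>''s0''\<close> and
  \<open>''e''\<close> are powers of two whose exponents are kept in \<open>''i''\<close> and
  \<open>''lg''\<close>; the latter starts at 1, so that \<open>lg\<close> is positive.\<close>

definition main_params :: com where
  "main_params =
    (''x0'' ::= Const 1 \<oplus> Var ''a'' \<otimes> Var ''d0'';;
     ''u'' ::= Var ''d'' \<oplus> Var ''a'' \<otimes> (Var ''d'' \<ominus> Var ''d0'');;
     ''xe'' ::= Var ''u'' \<oplus> Const 1;;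
     If (Less (Var ''D'') (Var ''xe'')) (''xe'' ::= Var ''D'') Skip;;
     ''xe'' ::= Var ''x0'' \<oplus> Var ''xe'';;
     ''m'' ::= Div (Var ''u'') (Var ''D'') \<oplus> (Var ''d'' \<ominus> Var ''d0'') \<oplus> Const 1;;
     ''s0'' ::= Const 1;; ''i'' ::= Const 0;; ''e'' ::= Const 2;; ''lg'' ::= Const 1)"

definition main :: "com \<Rightarrow> com" where
  "main cp =
    (main_params;; doubling ''s0'' ''m'' ''i'';; doubling ''e'' ''n'' ''lg'';;
     ''cut'' ::= Var ''n'' \<otimes> Var ''lg'' \<otimes> Var ''lg'';; merge_sort;; groups cp)"

definition exchange :: "name \<Rightarrow> name \<Rightarrow> com" where
  "exchange x y = (''t'' ::= Var x;; x ::= Var y;; y ::= Var ''t'')"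

definition sort3 :: com where
  "sort3 =
    (If (Less (Var ''b'') (Var ''a'')) (exchange ''a'' ''b'') Skip;;
     If (Less (Var ''c'') (Var ''b'')) (exchange ''b'' ''c'') Skip;;
     If (Less (Var ''b'') (Var ''a'')) (exchange ''a'' ''b'') Skip)"

definition count_cadences :: "com \<Rightarrow> com" where
  "count_cadences cp =
    (''count'' ::= Const 0;;
     If (Less (Var ''n'') (Var ''k'')) Skip
       (sort3;; params;; If (Less (Var ''d'') (Var ''d0'')) Skip (main cp)))"

lemma wp_sort3:
  assumes "scalar s ''a'' = a" "scalar s ''b'' = b" "scalar s ''c'' = c" "a \<noteq> b" "b \<noteq> c" "a \<noteq> c"
  shows "wp B sort3 (\<lambda>t' s'. t' \<le> t + 30 \<and> (\<exists>a' b' c'. scalar s' ''a'' = a' \<and> scalar s' ''b'' = b' \<and>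
    scalar s' ''c'' = c' \<and> a' < b' \<and> b' < c' \<and> {a', b', c'} = {a, b, c})) t s"
  unfolding sort3_def exchange_def using assms by auto

lemma (in word_bounds) wp_doubling:
  assumes names: "x \<noteq> y" "z \<noteq> x" "z \<noteq> y"
    and st: "scalar s x = 2 ^ u" "scalar s z = int u" "scalar s y = Y"
    and Y: "2 * Y \<le> N" "u \<le> v" "Y \<le> 2 ^ v" "\<And>l. u \<le> l \<Longrightarrow> l < v \<Longrightarrow> 2 ^ l < Y"
  shows "wp B (doubling x y z) (\<lambda>t' s'. t' \<le> t + 12 * int v + 4 \<and>
    scalar s' x = 2 ^ v \<and> scalar s' z = int v) t s"
  unfolding doubling_def
proof (rule wp_While[where I = "\<lambda>l t' s'. u \<le> l \<and> l \<le> v \<and> scalar s' x = 2 ^ l \<and> scalar s' z = int l \<and>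
    t' \<le> t + 12 * (int l - int u)" and f = "\<lambda>l. v - l" and g = u], goal_cases)
  case (3 l t1 s1)
  have sy: "scalar s1 y = Y" using 3(2) st names by (auto simp: same_scalar)
  have l: "2 ^ l < Y" "l < v"
  proof -
    show lY: "2 ^ l < Y" using 3(1,3) sy by simp
    show "l < v"
    proof (rule ccontr)
      assume "\<not> l < v"
      with 3(1) have "l = v" by simp
      with lY Y(3) show False by simp
    qed
  qed
  have "int l \<le> 2 ^ l" using of_nat_mono[OF less_imp_le[OF less_exp[of l]], where 'a = int] by simp
  then have small: "2 ^ l \<le> N" "int l \<le> N" using l(1) Y(1) zero_le_power[of "2::int" l] by linarith+
  show ?case
    using 3(1) names l(2) small by (simp add: asafe_ok) (intro exI[of _ "Suc l"], simp)
next
  case (4 l t1 s1)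
  have sy: "scalar s1 y = Y" using 4(2) st names by (auto simp: same_scalar)
  have "\<not> 2 ^ l < Y" using 4(1,3) sy by simp
  then have "l = v" using Y(4)[of l] 4(1) by force
  then show ?case using 4(1) by simp
qed (use st Y names in auto)

section \<open>Splitting the count by characters\<close>

context cadence
begin

lemma valid_range:
  assumes "valid i d" "0 \<le> x" "x < k"
  shows "1 \<le> i + x * d" "i + x * d \<le> n"
proof -
  have v: "1 \<le> i" "1 \<le> d" "i + (k - 1) * d \<le> n" using assms by (auto simp: valid_def)
  then have "0 \<le> x * d" "x * d \<le> (k - 1) * d" using assms by (auto intro!: mult_right_mono)
  then show "1 \<le> i + x * d" "i + x * d \<le> n" using v by linarith+
qed

lemma valid_subset: "{(i, d). valid i d \<and> R i d} \<subseteq> {1..n} \<times> {1..n}"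
proof clarsimp
  fix i d assume v: "valid i d"
  have "i + 0 * d \<le> n" "i + 1 * d \<le> n" using coeffs ab bc ck by (intro valid_range[OF v]; linarith)+
  then show "1 \<le> i \<and> i \<le> n \<and> 1 \<le> d \<and> d \<le> n" using v by (auto simp: valid_def)
qed

lemma card_valid: "card {(i, d). valid i d \<and> R i d} \<le> nat n * nat n"
proof -
  have "card {(i, d). valid i d \<and> R i d} \<le> card ({1..n} \<times> {1..n})"
    by (intro card_mono valid_subset) auto
  then show ?thesis by (simp add: card_cartesian_product)
qed

text \<open>Quantifying over the set \<open>{a, b, c}\<close> makes the condition independent of the
  order of the coefficients, which \<open>sort3\<close> changes.\<close>

definition monochromatic :: "(int \<Rightarrow> int) \<Rightarrow> (int \<times> int) set" where
  "monochromatic key = {(i, d). valid i d \<and>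
     (\<forall>x\<in>{a, b, c}. \<forall>y\<in>{a, b, c}. key (i + x * d) = key (i + y * d))}"

text \<open>The common character of the three positions is unique and occurs in the string, so the
  sets \<open>cad\<close> of different characters form a disjoint decomposition.\<close>

lemma sum_cad:
  "(\<Sum>v\<in>key ` {1..n}. int (card (cad (\<lambda>x. key x = v)))) = int (card (monochromatic key))"
proof -
  have "monochromatic key = (\<Union>v\<in>key ` {1..n}. cad (\<lambda>x. key x = v))"
  proof (intro equalityI subsetI)
    fix z assume "z \<in> monochromatic key"
    then obtain i d where z: "z = (i, d)" and v: "valid i d"
      and eq: "key (i + b * d) = key (i + a * d)" "key (i + c * d) = key (i + a * d)"
      by (auto simp: monochromatic_def)
    have "i + a * d \<in> {1..n}" using valid_range[OF v, of a] a0 ab bc ck by simp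
    then show "z \<in> (\<Union>v\<in>key ` {1..n}. cad (\<lambda>x. key x = v))"
      using v eq by (auto simp: z cad_def)
  qed (auto simp: monochromatic_def cad_def)
  moreover have "card (\<Union>v\<in>key ` {1..n}. cad (\<lambda>x. key x = v)) =
      (\<Sum>v\<in>key ` {1..n}. card (cad (\<lambda>x. key x = v)))"
  proof (rule card_UN_disjoint)
    show "\<forall>v\<in>key ` {1..n}. finite (cad (\<lambda>x. key x = v))"
      unfolding cad_def by (intro ballI finite_subset[OF valid_subset]) auto
  qed (auto simp: cad_def)
  ultimately show ?thesis by simp
qed

end

context cadence_machine
begin

lemma wp_main:
  fixes s :: state and lgn :: nat
  defines "key \<equiv> \<lambda>x. arr s ''S'' (nat x)"
  assumes env: "env s" and st: "scalar s ''d0'' = d_min" "scalar s ''d'' = d_max" "scalar s ''count'' = 0"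
    and d: "d_min \<le> d_max"
    and lgn: "lg = int lgn" "n \<le> 2 ^ lgn" "\<And>l. 1 \<le> l \<Longrightarrow> l < lgn \<Longrightarrow> 2 ^ l < n"
    and X: "12 * n \<le> X" "n * n + n + 1 \<le> X"
  shows "wp B (main cp) (\<lambda>t' s'. t' \<le> t + 1200 * (n * lg) +
      (1728 * C + 1000000) * (\<Sum>v\<in>chars key. min ((occ key v)\<^sup>2) (n * lg * lg)) \<and>
    scalar s' ''count'' = int (card (monochromatic key))) t s"
proof -
  define L where "L = (LEAST L. side \<le> 2 ^ L)"
  have "side \<le> 2 ^ nat side"
    using of_nat_mono[OF less_imp_le[OF less_exp[of "nat side"]], where 'a = int] side_pos[OF d] by simp
  then have L: "side \<le> 2 ^ L" unfolding L_def by (rule LeastI)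
  have L': "2 ^ l < side" if "l < L" for l using not_less_Least[of l "\<lambda>L. side \<le> 2 ^ L"] that by (simp add: L_def)
  have L2: "2 ^ L \<le> 2 * side" using L'[of "L - 1"] side_pos[OF d] by (cases L) auto
  have LX: "2 ^ L \<le> X" using L2 side_le[OF d] X by linarith
  have n1: "3 \<le> n" using a0 ab bc ck kn by linarith
  have lgn1: "1 \<le> lgn" using lg_pos lgn(1) by simp
  \<comment> \<open>\<open>2 ^ L\<close> is at most \<open>2 * side \<le> 12 * n\<close>, hence
    below \<open>16 * 2 ^ lgn\<close>.\<close>
  have L6: "int L + 1 \<le> 6 * lg"
  proof -
    have "(2::int) ^ L < 2 ^ (lgn + 4)" using L2 side_le[OF d] lgn(2) n1 by (simp add: power_add)
    then have "L < lgn + 4" by (rule power_less_imp_less_exp[rotated]) simp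
    then show ?thesis using lgn1 lgn(1) by linarith
  qed
  have lgN: "\<bar>int lgn\<bar> \<le> N"
  proof -
    have "int (lgn - 1) \<le> n"
    proof (cases "lgn = 1")
      case False
      then have "2 ^ (lgn - 1) < n" using lgn(3)[of "lgn - 1"] lgn1 by simp
      moreover have "int (lgn - 1) \<le> 2 ^ (lgn - 1)"
          using less_imp_le[OF less_exp[of "lgn - 1"]] by (metis of_nat_le_iff of_nat_numeral of_nat_power)
      ultimately show ?thesis by linarith
    qed (use n1 in simp)
    then show ?thesis using X X_bounds n1 by linarith
  qed
  have dX: "d_min \<le> n" using d d_max_le[OF d] by simp
  have sp: "0 \<le> x_span" "x_span \<le> 3 * n" using x_span_nonneg[OF d] x_span_le[OF d] by auto
  have an: "a * d_min \<le> n * n" using dX d_min_pos[OF d] a0 ab bc ck kn by (intro mult_mono) auto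
  have xX: "x_min + classes \<le> X" using an X a0 ck bc ab kn by (simp add: x_min_def classes_def)
  have dn: "d_min \<le> X" using dX nX by linarith
  have cnt: "(\<Sum>v\<in>chars key. int (card (cad (\<lambda>x. key x = v)))) \<le> N"
  proof -
    have "int (card (monochromatic key)) \<le> n * n"
      using of_nat_mono[OF card_valid, where 'a = int] n1 unfolding monochromatic_def by simp
    also have "\<dots> \<le> X" using X n1 by linarith
    finally show ?thesis unfolding chars_def sum_cad using X_bounds by linarith
  qed
  have sm: "\<bar>a\<bar> \<le> N" "\<bar>c - a\<bar> \<le> N" "\<bar>d_min\<bar> \<le> N" "\<bar>d_max\<bar> \<le> N" "\<bar>x_span\<bar> \<le> N" "\<bar>x_span + 1\<bar> \<le> N" "\<bar>x_min\<bar> \<le> N"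
    "c \<noteq> a" "\<bar>n\<bar> \<le> N" "\<bar>classes\<bar> \<le> N"
    using params_le a0 ab bc ck d_min_pos[OF d] dX d d_max_le[OF d] sp X X_bounds n1 an
    by (auto simp: x_min_def classes_def)
  let ?KK = "1728 * C + 1000000"
  define M where "M = ?KK * (\<Sum>v\<in>chars key. min ((occ key v)\<^sup>2) (n * lg * lg))"
  have e: "scalar s ''n'' = n" "scalar s ''a'' = a" "scalar s ''D'' = c - a" using env by (simp_all add: env_def)
  define Q where "Q t' s' \<longleftrightarrow> t' \<le> t + 1200 * (n * lg) + M \<and>
    scalar s' ''count'' = int (card (monochromatic key))" for t' and s' :: state
  have "wp B main_params (\<lambda>t' s'. t' \<le> t + 60 \<and> scalar s' ''x0'' = x_min \<and> scalar s' ''xe'' = x_min + classes \<and>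
    scalar s' ''m'' = side \<and> scalar s' ''s0'' = 1 \<and> scalar s' ''i'' = 0 \<and> scalar s' ''e'' = 2 \<and> scalar s' ''lg'' = 1) t s"
  proof -
    have x: "1 + a * d_min = x_min" "d_max + a * (d_max - d_min) = x_span" by (simp_all add: x_min_def x_span_def)
    have cl: "classes = (if c - a < x_span + 1 then c - a else x_span + 1)" by (auto simp: classes_def)
    show ?thesis
      unfolding main_params_def side_def cl
      by (simp add: st e x asafe_ok sm)
  qed
  then have "wp B main_params (wp B (doubling ''s0'' ''m'' ''i'') (wp B (doubling ''e'' ''n'' ''lg'')
    (wp B (''cut'' ::= Var ''n'' \<otimes> Var ''lg'' \<otimes> Var ''lg'') (wp B merge_sort (wp B (groups cp) Q))))) t s"
  proof (rule wp_conseq, goal_cases)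
    case (1 t1 s1)
    have "env s1" by (rule env_same[OF env 1(2)]) (simp_all add: main_params_def)
    then have s1: "env s1" "scalar s1 ''d0'' = d_min" "scalar s1 ''count'' = 0" "arr s1 ''S'' = arr s ''S''" "scalar s1 ''n'' = n"
      using 1(2) st e by (simp_all add: main_params_def same_scalar same_arr)
    have "2 * side \<le> X" using side_le[OF d] X by linarith
    then have "2 * side \<le> N" using X_bounds by linarith
    then have "wp B (doubling ''s0'' ''m'' ''i'') (\<lambda>t' s'. t' \<le> t1 + 12 * int L + 4 \<and> scalar s' ''s0'' = 2 ^ L \<and>
      scalar s' ''i'' = int L) t1 s1"
      using 1(1) L by (intro wp_doubling[where u = 0 and Y = side]) (simp_all add: L')
    then show ?case
    proof (rule wp_conseq, goal_cases)
      case (1 t2 s2)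
      note same2 = 1(2)[unfolded doubling_def, simplified]
      have "2 * n \<le> N" using X n1 X_bounds by linarith
      then have "wp B (doubling ''e'' ''n'' ''lg'') (\<lambda>t' s'. t' \<le> t2 + 12 * int lgn + 4 \<and> scalar s' ''e'' = 2 ^ lgn \<and>
        scalar s' ''lg'' = int lgn) t2 s2"
        using same2 s1 \<open>t1 \<le> t + 60 \<and> _\<close> lgn(2) lgn1
        by (intro wp_doubling[where u = 1 and Y = n]) (simp_all add: same_scalar lgn(3))
      then show ?case
      proof (rule wp_conseq, goal_cases)
        case (1 t3 s3)
        note same3 = 1(2)[unfolded doubling_def, simplified]
        define s4 where "s4 = setv ''cut'' (n * lg * lg) s3"
        have s4: "genv L s4" "scalar s4 ''count'' = 0" "arr s4 ''S'' = arr s ''S''" "scalar s4 ''n'' = n"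
        proof -
          have "env s3" by (rule env_same[OF env_same[OF s1(1) same2] same3]) simp_all
          then have "env s4" by (simp add: s4_def env_def)
          then show "genv L s4"
            using same2 same3 s1(2) \<open>t1 \<le> t + 60 \<and> _\<close> \<open>t2 \<le> _ \<and> _\<close> by (simp add: genv_def s4_def same_scalar)
        qed (use same2 same3 s1 in \<open>simp_all add: s4_def same_scalar same_arr\<close>)
        have n2: "scalar s4 ''n'' = int (nat n)" "1 \<le> nat n" "3 * int (nat n) \<le> N" "nat n \<le> 2 ^ lgn"
          using s4(4) n1 X X_bounds lgn(2) by (auto simp: nat_le_iff)
        have nn: "int (nat n) = n" using n1 by simp
        have keys: "(\<lambda>x. arr s4 ''S'' (nat x)) = key" by (simp add: key_def s4(3))
        have "wp B merge_sort (\<lambda>t' s'. t' \<le> t3 + 6 + 300 * (n * (lg + 1)) \<and>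
          arr s' ''P'' ` {..<nat n} = {1..n} \<and> sorted_run key (arr s' ''P'') 0 (nat n)) (t3 + 6) s4"
          using wp_merge_sort[OF n2, of "t3 + 6"] unfolding keys nn lgn(1) .
        then have "wp B merge_sort (wp B (groups cp) Q) (t3 + 6) s4"
        proof (rule wp_conseq, goal_cases)
          case (1 t5 s5)
          note same5 = 1(2)[unfolded merge_sort_def merge_pass_def merge_defs, simplified]
          have s5: "genv L s5" "scalar s5 ''count'' = 0" "arr s5 ''S'' = arr s ''S''"
          proof -
            have "env s4" using s4(1) by (simp add: genv_def)
            then have "env s5" by (rule env_same[OF _ same5]) simp_all
            then show "genv L s5" using same5 s4(1) by (simp add: genv_def same_scalar)
          qed (use same5 s4 in \<open>simp_all add: same_scalar same_arr\<close>)
          have keys5: "(\<lambda>x. arr s5 ''S'' (nat x)) = key" by (simp add: key_def s5(3))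
          have keyx: "arr s5 ''S'' (nat x) = key x" for x by (simp add: key_def s5(3))
          have "wp B (groups cp) (\<lambda>t' s'. t' \<le> t5 + 80 * n + M \<and>
            scalar s' ''count'' = int (card (monochromatic key))) t5 s5"
            using wp_groups[of L s5 t5] s5 1(1) d L L2 L6 LX xX dn cnt
            unfolding keys5 keyx M_def chars_def sum_cad by simp
          then show ?case
          proof (rule wp_conseq, goal_cases)
            case (1 t6 s6)
            have nl: "1 * lg \<le> n * lg" "n * 1 \<le> n * lg" "1 \<le> lg"
              using n1 lg_pos by (auto intro: mult_right_mono mult_left_mono)
            have "t6 \<le> t + 60 + 12 * int L + 4 + 12 * lg + 4 + 6 + 300 * (n * (lg + 1)) + 80 * n + M"
              using 1(1) \<open>t5 \<le> _ \<and> _\<close> \<open>t3 \<le> _ \<and> _\<close> \<open>t2 \<le> _ \<and> _\<close> \<open>t1 \<le> _ \<and> _\<close> lgn(1) by linarith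
            then have "t6 \<le> t + 1200 * (n * lg) + M"
              using nl L6 unfolding distrib_left by linarith
            then show ?case using 1(1) by (simp add: Q_def)
          qed
        qed
        then show ?case
          using s4(4) sm lgN lgn(1) \<open>t3 \<le> _ \<and> _\<close> by (simp add: asafe_ok s4_def add.commute)
      qed
    qed
  qed
  then show ?thesis
    unfolding main_def wp_Seq Q_def M_def .
qed

end


section \<open>The running time\<close>

text \<open>A minimum is at most the geometric mean.\<close>

lemma min_squares_le_mult: "min (x\<^sup>2) (y\<^sup>2) \<le> x * y" if "0 \<le> x" "0 \<le> y" for x y :: real
proof (cases "x \<le> y")
  case True
  then have "x * x \<le> x * y" using that by (intro mult_left_mono) auto
  then show ?thesis by (simp add: power2_eq_square min.coboundedI1)
next
  case False
  then have "y * y \<le> x * y" using that by (intro mult_right_mono) auto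
  then show ?thesis by (simp add: power2_eq_square min.coboundedI2)
qed

text \<open>First bound: at most \<open>sig\<close> characters, each charged
  \<open>n * lg * lg\<close>. Second: each minimum is at most \<open>f v * (sqrt n * lg)\<close> by
  \<open>min_squares_le_mult\<close>, and the \<open>f v\<close> add up to \<open>n\<close>. Passing
  from \<open>lg\<close> to \<open>log 2 n\<close> costs a factor of at most 4. Both bounds dominate
  \<open>n * log 2 n\<close>, which absorbs the lower-order terms:
  \<open>2600 = 200 + 2 * 1200\<close>.\<close>

lemma time_bound:
  fixes n lg :: int and f :: "int \<Rightarrow> int" and sig K :: real
  assumes n: "2 \<le> n" and lg: "0 \<le> lg" "real_of_int lg \<le> 2 * log 2 n"
    and V: "finite V" "(\<Sum>v\<in>V. f v) = n" "\<And>v. v \<in> V \<Longrightarrow> 0 \<le> f v" "real (card V) \<le> sig" "1 \<le> sig"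
    and t: "t \<le> 200 + 1200 * (n * lg) + K * (\<Sum>v\<in>V. min ((f v)\<^sup>2) (n * lg * lg))" and K: "0 \<le> K"
  shows "t \<le> (2600 + 4 * K) * min (sig * n * (log 2 n)\<^sup>2) (n powr (3 / 2) * log 2 n)"
proof -
  let ?l = "log 2 (real_of_int n)"
  let ?F = "\<Sum>v\<in>V. min ((f v)\<^sup>2) (n * lg * lg)"
  define m where "m = min (sig * n * ?l\<^sup>2) (n powr (3 / 2) * ?l)"
  have n0: "0 < real_of_int n" "2 \<le> real_of_int n" using n by linarith+
  have l: "1 \<le> ?l" using n0 by (simp add: le_log_iff)
  have p: "n powr (3 / 2) = n * sqrt n"
  proof -
    have "n powr (3 / 2) = real_of_int n powr (1 + 1 / 2)" by simp
    also have "\<dots> = n * sqrt n" unfolding powr_add using n0 by (simp add: powr_half_sqrt)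
    finally show ?thesis .
  qed
  have sq: "1 \<le> sqrt n" using n0 by simp
  have nl: "n * ?l \<le> m"
  proof -
    have "1 * ?l \<le> sig * ?l * ?l" using l V(5) by (intro mult_right_mono) (auto intro: order.trans[OF _ mult_mono[of 1 _ 1]])
    then have "n * (1 * ?l) \<le> n * (sig * ?l * ?l)" using n0 by (intro mult_left_mono) auto
    moreover have "n * 1 * ?l \<le> n * sqrt n * ?l" using n0 sq l by (intro mult_right_mono mult_left_mono) auto
    ultimately show ?thesis by (simp add: m_def p power2_eq_square ac_simps)
  qed
  have "2 * 1 \<le> n * ?l" using n0 l by (intro mult_mono) auto
  then have m1: "1 \<le> m" using nl by linarith
  have nlg: "real_of_int (n * lg) \<le> 2 * m"
  proof -
    have "n * lg \<le> n * (2 * ?l)" using lg n0 by (simp add: mult_left_mono)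
    then show ?thesis using nl by simp
  qed
  have F: "real_of_int ?F \<le> 4 * m"
  proof -
    have "real_of_int ?F \<le> 4 * (sig * n * ?l\<^sup>2)"
    proof -
      have "?F \<le> (\<Sum>v\<in>V. n * lg * lg)" by (intro sum_mono) simp
      then have "real_of_int ?F \<le> real_of_int (\<Sum>v\<in>V. n * lg * lg)" by (simp only: of_int_le_iff)
      also have "\<dots> = real (card V) * (real_of_int n * (real_of_int lg * real_of_int lg))" by simp
      also have "\<dots> \<le> sig * (n * ((2 * ?l) * (2 * ?l)))"
        using lg n0 V(4,5) l by (intro mult_mono) auto
      finally show ?thesis by (simp add: power2_eq_square)
    qed
    moreover have "real_of_int ?F \<le> 2 * (n powr (3 / 2) * ?l)"
    proof -
      have "real_of_int (min ((f v)\<^sup>2) (n * lg * lg)) \<le> f v * (sqrt n * lg)" if "v \<in> V" for v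
      proof -
        have "real_of_int (n * lg * lg) = (sqrt n * lg)\<^sup>2"
          using n0 by (simp add: power_mult_distrib power2_eq_square)
        then show ?thesis
          using min_squares_le_mult[of "f v" "sqrt n * lg"] V(3)[OF that] lg(1) n0
          by (simp add: of_int_min)
      qed
      then have "(\<Sum>v\<in>V. real_of_int (min ((f v)\<^sup>2) (n * lg * lg))) \<le> (\<Sum>v\<in>V. f v * (sqrt n * lg))"
        by (intro sum_mono)
      also have "\<dots> = n * (sqrt n * lg)"
        unfolding V(2)[symmetric] by (simp add: sum_distrib_right)
      also have "\<dots> \<le> n * (sqrt n * (2 * ?l))"
        using lg n0 by (intro mult_left_mono) auto
      finally show ?thesis by (simp add: p)
    qed
    moreover have "0 \<le> n powr (3 / 2) * ?l" using l by simp
    ultimately show ?thesis unfolding m_def by (simp add: min_def)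
  qed
  have "t \<le> 200 * m + 1200 * (2 * m) + K * (4 * m)"
    using t m1 nlg mult_left_mono[OF F K] by simp
  then show ?thesis unfolding m_def[symmetric] by (simp add: algebra_simps)
qed


section \<open>Correctness\<close>

text \<open>The passage from natural numbers to integers: truncated subtraction is harmless since
  \<open>1 \<le> k'\<close>, and \<open>i\<close>, \<open>d\<close> are positive on both sides. The
  coefficients enter as a set, so the sorted ones may replace the given ones.\<close>

lemma (in cadence) card_partial_cadences:
  fixes S :: "int list" and a' b' c' k' :: nat
  assumes n: "n = int (length S)" and k: "k = int k'" and abc: "{a, b, c} = {int a', int b', int c'}"
    and key: "\<forall>j\<in>{1..length S}. key (int j) = char_at S j"
  shows "card (partial_cadences a' b' c' k' S) = card (monochromatic key)"
proof (rule bij_betw_same_card[of "\<lambda>(i, d, k). (int i, int d)"], rule bij_betw_imageI)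
  show "inj_on (\<lambda>(i, d, k). (int i, int d)) (partial_cadences a' b' c' k' S)"
    by (auto simp: inj_on_def partial_cadences_def)
  have k1: "1 \<le> k'" using coeffs ab bc ck k by linarith
  have valid: "valid (int i) (int d) \<longleftrightarrow> 0 < i \<and> 0 < d \<and> int i - int d \<le> 0 \<and>
      i + (k' - 1) * d \<le> length S \<and> length S < i + k' * d" for i d
  proof -
    have eqs: "int i + (k - 1) * int d = int (i + (k' - 1) * d)" "int i + k * int d = int (i + k' * d)"
      using k k1 by (simp_all add: of_nat_diff)
    show ?thesis unfolding valid_def eqs unfolding n by (auto simp del: of_nat_add of_nat_mult)
  qed
  have char: "char_at S (i + x * d) = key (int i + int x * int d)"
    if "valid (int i) (int d)" "int x \<in> {a, b, c}" for i d x
  proof -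
    have "0 \<le> int x" "int x < k" using that(2) a0 ab bc ck by auto
    from valid_range[OF that(1) this] have "i + x * d \<in> {1..length S}"
      unfolding n by (simp flip: of_nat_mult of_nat_add)
    then show ?thesis using key by (metis of_nat_add of_nat_mult)
  qed
  have mono: "(int i, int d) \<in> monochromatic key \<longleftrightarrow> (i, d, k') \<in> partial_cadences a' b' c' k' S" for i d
  proof (cases "valid (int i) (int d)")
    case True
    then show ?thesis
      unfolding monochromatic_def partial_cadences_def abc mem_Collect_eq case_prod_conv
      using valid[of i d] char[OF True] abc by auto
  next
    case False
    then show ?thesis using valid[of i d] by (auto simp: monochromatic_def partial_cadences_def)
  qed
  show "(\<lambda>(i, d, k). (int i, int d)) ` partial_cadences a' b' c' k' S = monochromatic key"
  proof (intro equalityI subsetI)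
    fix z assume "z \<in> (\<lambda>(i, d, k). (int i, int d)) ` partial_cadences a' b' c' k' S"
    then obtain i d k'' where *: "(i, d, k'') \<in> partial_cadences a' b' c' k' S" "z = (int i, int d)" by auto
    moreover have "k'' = k'" using *(1) by (simp add: partial_cadences_def)
    ultimately show "z \<in> monochromatic key" using mono by simp
  next
    fix z assume z: "z \<in> monochromatic key"
    then obtain i d where "z = (i, d)" "1 \<le> i" "i \<le> d"
      by (auto simp: monochromatic_def valid_def)
    then have zn: "z = (int (nat i), int (nat d))" by simp
    then have "(nat i, nat d, k') \<in> partial_cadences a' b' c' k' S" using z mono[of "nat i" "nat d"] by blast
    then show "z \<in> (\<lambda>(i, d, k). (int i, int d)) ` partial_cadences a' b' c' k' S"
      using zn by (intro image_eqI[of _ _ "(nat i, nat d, k')"]) simp_all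
  qed
qed

text \<open>\<open>i\<close> and \<open>d\<close> are positive, so \<open>i + (k - 1) * d\<close> is
  at least \<open>k\<close>.\<close>

lemma partial_cadences_empty: "length S < k \<Longrightarrow> partial_cadences a b c k S = {}"
proof -
  assume k: "length S < k"
  have False if "0 < i" "0 < d" "i + (k - 1) * d \<le> length S" for i d :: nat
  proof -
    have "(k - 1) * 1 \<le> (k - 1) * d" using that by (intro mult_le_mono2) auto
    then show False using that k by linarith
  qed
  then show ?thesis by (auto simp: partial_cadences_def)
qed

lemma (in cadence_machine) wp_params_main:
  fixes s :: state and lgn :: nat
  defines "key \<equiv> \<lambda>x. arr s ''S'' (nat x)"
  assumes st: "scalar s ''n'' = n" "scalar s ''k'' = k" "scalar s ''a'' = a" "scalar s ''b'' = b" "scalar s ''c'' = c"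
    "scalar s ''count'' = 0"
    and lgn: "lg = int lgn" "n \<le> 2 ^ lgn" "\<And>l. 1 \<le> l \<Longrightarrow> l < lgn \<Longrightarrow> 2 ^ l < n"
    and X: "12 * n \<le> X" "n * n + n + 1 \<le> X"
  shows "wp B (params;; If (Less (Var ''d'') (Var ''d0'')) Skip (main cp)) (\<lambda>t' s'. t' \<le> t + 60 + 1200 * (n * lg) +
      (1728 * C + 1000000) * (\<Sum>v\<in>chars key. min ((occ key v)\<^sup>2) (n * lg * lg)) \<and>
    scalar s' ''count'' = int (card (monochromatic key))) t s"
proof -
  let ?KK = "1728 * C + 1000000"
  define M where "M = ?KK * (\<Sum>v\<in>chars key. min ((occ key v)\<^sup>2) (n * lg * lg))"
  have n0: "0 \<le> n" "0 \<le> n * lg" using a0 ab bc ck kn lg_pos by simp_all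
  have M0: "0 \<le> M"
    unfolding M_def using C_nonneg n0 lg_pos by (intro mult_nonneg_nonneg sum_nonneg) auto
  have sm: "\<bar>a\<bar> \<le> N" "\<bar>b\<bar> \<le> N" "\<bar>c\<bar> \<le> N" "\<bar>n\<bar> \<le> N" "\<bar>k\<bar> \<le> N" "k + 1 \<noteq> 0" "k \<noteq> 1"
    using params_le coeffs ab bc ck by linarith+
  have "wp B params (\<lambda>t' s'. t' \<le> t + 40 \<and> env s' \<and> scalar s' ''d0'' = d_min \<and> scalar s' ''d'' = d_max) t s"
    unfolding params_def
    by (simp add: st asafe_ok sm env_def d_min_def d_max_def)
  then have "wp B params (wp B (If (Less (Var ''d'') (Var ''d0'')) Skip (main cp)) (\<lambda>t' s'.
      t' \<le> t + 60 + 1200 * (n * lg) + M \<and> scalar s' ''count'' = int (card (monochromatic key)))) t s"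
  proof (rule wp_conseq, goal_cases)
    case (1 t1 s1)
    have s1: "scalar s1 ''count'' = 0" "arr s1 ''S'' = arr s ''S''"
      using 1(2) st by (simp_all add: params_def same_scalar same_arr)
    show ?case
    proof (cases "d_max < d_min")
      case True
      then have "monochromatic key = {}" using valid_d by (force simp: monochromatic_def)
      then show ?thesis using True 1(1) s1 M0 n0 by simp
    next
      case False
      have keys: "(\<lambda>x. arr s1 ''S'' (nat x)) = key" by (simp add: key_def s1)
      have "wp B (main cp) (\<lambda>t' s'. t' \<le> t1 + 4 + 1200 * (n * lg) + M \<and>
          scalar s' ''count'' = int (card (monochromatic key))) (t1 + 4) s1"
        using wp_main[of s1 lgn "t1 + 4"] 1(1) s1(1) False lgn X unfolding keys M_def by simp
      then have "wp B (main cp) (\<lambda>t' s'. t' \<le> t + 60 + 1200 * (n * lg) + M \<and>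
          scalar s' ''count'' = int (card (monochromatic key))) (t1 + 4) s1"
        by (rule wp_conseq) (use 1(1) in auto)
      then show ?thesis using False 1(1) by (simp add: add.commute)
    qed
  qed
  then show ?thesis unfolding wp_Seq M_def .
qed

text \<open>The factor 2 pays for rounding up: \<open>l - 1 < log 2 n\<close> if \<open>l\<close> is
  not 1, and \<open>1 \<le> log 2 n\<close>.\<close>

lemma log_ceiling:
  fixes n :: int
  assumes "2 \<le> n"
  obtains l :: nat where "1 \<le> l" "n \<le> 2 ^ l" "\<And>i. 1 \<le> i \<Longrightarrow> i < l \<Longrightarrow> 2 ^ i < n" "real l \<le> 2 * log 2 n"
proof -
  define l where "l = (LEAST l. 1 \<le> l \<and> n \<le> 2 ^ l)"
  have "int (nat n) \<le> 2 ^ nat n"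
    using less_imp_le[OF less_exp[of "nat n"]] by (metis of_nat_le_iff of_nat_numeral of_nat_power)
  then have "1 \<le> nat n \<and> n \<le> 2 ^ nat n" using assms by simp
  then have l: "1 \<le> l \<and> n \<le> 2 ^ l" unfolding l_def by (rule LeastI)
  have less: "2 ^ i < n" if "1 \<le> i" "i < l" for i
    using not_less_Least[of i "\<lambda>l. 1 \<le> l \<and> n \<le> 2 ^ l"] that by (simp add: l_def)
  have log1: "1 \<le> log 2 n" using assms by (simp add: le_log_iff)
  have "real l \<le> 2 * log 2 n"
  proof (cases "l = 1")
    case False
    then have "real_of_int (2 ^ (l - 1)) < real_of_int n" using less[of "l - 1"] l by linarith
    then have "real (l - 1) < log 2 n" using assms by (simp add: less_log_iff powr_realpow)
    then show ?thesis using l log1 by simp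
  qed (use log1 in simp)
  with l less that show ?thesis by blast
qed

theorem theorem8:
  assumes "fast_convolution"
  shows "\<exists>p w. \<exists>K::real. \<forall>(\<Sigma>::int set) S n k a b c s.
    finite \<Sigma> \<and> set S \<subseteq> \<Sigma> \<and> length S = n \<and>
    0 < k \<and> a < k \<and> b < k \<and> c < k \<and> a \<noteq> b \<and> b \<noteq> c \<and> a \<noteq> c \<and>
    cadence_input S k a b c s \<longrightarrow>
    (\<exists>t s'. exec (word_bound w n) p s t s' \<and>
       scalar s' ''count'' = int (card (partial_cadences a b c k S)) \<and>
       (2 \<le> n \<longrightarrow>
          real t \<le> K * min (real (card \<Sigma>) * real n * (log 2 (real n))\<^sup>2)
                          (real n powr (3 / 2) * log 2 (real n))))"
proof -
  obtain cp wc C0 where cp: "svars cp \<subseteq> range (Cons (CHR ''_''))" "avars cp \<subseteq> range (Cons (CHR ''_''))" "0 \<le> C0"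
    and conv: "\<And>B (m::nat) lg xs ys s t. 2 \<le> m \<Longrightarrow> (int m + 2) ^ wc \<le> B \<Longrightarrow> real m \<le> 2 ^ lg \<Longrightarrow>
      length xs = m \<Longrightarrow> length ys = m \<Longrightarrow> set xs \<subseteq> {0, 1} \<Longrightarrow> set ys \<subseteq> {0, 1} \<Longrightarrow>
      scalar s ''_m'' = int m \<Longrightarrow> \<forall>i<m. arr s ''_x'' i = xs ! i \<Longrightarrow>
      \<forall>i<m. arr s ''_y'' i = ys ! i \<Longrightarrow>
      wp B cp (\<lambda>t' s'. t' \<le> t + C0 * (int m * int lg) \<and>
        (\<forall>j<m. arr s' ''_z'' j = acyclic_convolution xs ys j)) t s"
  proof (rule fast_convolution_prime[OF assms], goal_cases)
    case (1 p w C)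
    show thesis by (rule 1(1)[OF 1(2,3,4)]) (rule 1(5); assumption)
  qed
  \<comment> \<open>With \<open>N = (n + 2) ^ 10\<close>, the requirement
    \<open>N ^ 8 \<le> B\<close> accounts for 80. A convolution of length \<open>m \<le> N\<close>
    needs \<open>(m + 2) ^ wc \<le> B\<close>, and \<open>m + 2 \<le> (n + 2) ^ 11\<close> accounts
    for \<open>11 * wc\<close>.\<close>
  define w where "w = 80 + 11 * wc"
  \<comment> \<open>The 20 compares logarithms: convolution lengths are at most
    \<open>N \<le> 2 ^ (20 * lgn)\<close>.\<close>
  define KK where "KK = 1728 * (20 * C0) + 1000000"
  define K where "K = 2600 + 4 * real_of_int KK"
  have KK: "0 \<le> KK" using cp(3) by (simp add: KK_def)
  have main: "wp (word_bound w n) (count_cadences cp) (\<lambda>t s'.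
      scalar s' ''count'' = int (card (partial_cadences a b c k S)) \<and>
      (2 \<le> n \<longrightarrow> t \<le> K * min (real (card \<Sigma>) * real n * (log 2 (real n))\<^sup>2)
                          (real n powr (3 / 2) * log 2 (real n)))) 0 s"
    if \<Sigma>: "finite \<Sigma>" "set S \<subseteq> \<Sigma>" "length S = n"
      and k: "a < k" "b < k" "c < k" "a \<noteq> b" "b \<noteq> c" "a \<noteq> c" and input: "cadence_input S k a b c s"
    for \<Sigma> :: "int set" and S n k a b c s
  proof -
    let ?B = "word_bound w n"
    let ?min = "min (real (card \<Sigma>) * real n * (log 2 (real n))\<^sup>2) (real n powr (3 / 2) * log 2 (real n))"
    let ?Q = "\<lambda>t s'. scalar s' ''count'' = int (card (partial_cadences a b c k S)) \<and>
      (2 \<le> n \<longrightarrow> real_of_int t \<le> K * ?min)"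
    have sig: "1 \<le> real (card \<Sigma>)" if "2 \<le> n"
    proof -
      have "\<Sigma> \<noteq> {}" using \<Sigma> that by auto
      then show ?thesis using \<Sigma>(1) by (simp add: Suc_le_eq card_gt_0_iff)
    qed
    have inp: "scalar s ''n'' = int n" "scalar s ''k'' = int k" "scalar s ''a'' = int a" "scalar s ''b'' = int b"
      "scalar s ''c'' = int c" and char: "\<forall>j\<in>{1..length S}. arr s ''S'' j = char_at S j"
      using input \<Sigma>(3) by (auto simp: cadence_input_def)
    show ?thesis
    proof (cases "n < k")
      case True
      have "2 \<le> n \<longrightarrow> 10 \<le> K * ?min"
      proof
        assume n: "2 \<le> n"
        \<comment> \<open>An instance of \<open>time_bound\<close> with \<open>lg = 0\<close> and
          one artificial character of \<open>n\<close> occurrences; it only serves to show that the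
          claimed bound exceeds this constant time.\<close>
        have "10 \<le> (2600 + 4 * real_of_int KK) * min (real (card \<Sigma>) * real_of_int (int n) * (log 2 (real_of_int (int n)))\<^sup>2)
            (real_of_int (int n) powr (3 / 2) * log 2 (real_of_int (int n)))"
          by (rule time_bound[where lg = 0 and V = "{0}" and f = "\<lambda>_. int n"])
            (use n sig KK in \<open>auto simp: le_log_iff\<close>)
        then show "10 \<le> K * ?min" by (simp add: K_def)
      qed
      then show ?thesis
        using True \<Sigma>(3) partial_cadences_empty[of S k a b c] unfolding count_cadences_def
        by (auto simp: inp)
    next
      case False
      have n3: "3 \<le> n" using False k by linarith
      obtain lgn where lgn: "1 \<le> lgn" "int n \<le> 2 ^ lgn" "\<And>i. 1 \<le> i \<Longrightarrow> i < lgn \<Longrightarrow> 2 ^ i < int n"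
        "real lgn \<le> 2 * log 2 (int n)"
        using log_ceiling[of "int n"] n3 by force
      \<comment> \<open>\<open>X\<close> must exceed \<open>12 * n\<close>, for the sides, and
        \<open>n * n + n + 1\<close>, for the number of cadences and for
        \<open>x_min + classes\<close>. \<open>X ^ 3 = (n + 2) ^ 9\<close> stays below
        \<open>N\<close>.\<close>
      define N X where "N = (int n + 2) ^ 10" and "X = (int n + 2) ^ 3"
      define lg where "lg = int lgn"
      have B: "?B = N ^ 8 * ((int n + 2) ^ 11) ^ wc"
        by (simp add: word_bound_def w_def N_def power_add power_mult[symmetric])
      have NB: "N ^ 8 \<le> ?B" unfolding B using n3 by (simp add: N_def)
      have n5: "5 \<le> int n + 2" using n3 by simp
      have N2: "2 \<le> N" using power_increasing[of 1 10 "int n + 2"] n5 by (simp add: N_def)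
      have NB': "(int m + 2) ^ wc \<le> ?B" if "int m \<le> N" for m
      proof -
        have "int m + 2 \<le> 2 * N" using that N2 by simp
        also have "\<dots> \<le> (int n + 2) * N" using n5 N2 by (intro mult_right_mono) auto
        also have "\<dots> = (int n + 2) ^ 11" by (simp add: N_def flip: power_Suc)
        finally have "(int m + 2) ^ wc \<le> ((int n + 2) ^ 11) ^ wc" by (intro power_mono) auto
        also have "\<dots> \<le> ?B" unfolding B using N2 n5 by (simp add: mult_le_cancel_right1)
        finally show ?thesis .
      qed
      have mlg: "real m \<le> 2 ^ (20 * lgn)" if "int m \<le> N" for m
      proof -
        have "int n + 2 \<le> 2 * 2 ^ lgn" using lgn(2) n3 by linarith
        also have "\<dots> = 2 ^ (lgn + 1)" by simp
        also have "\<dots> \<le> 2 ^ (2 * lgn)" using lgn(1) by (intro power_increasing) auto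
        finally have "N \<le> (2 ^ (2 * lgn)) ^ 10" unfolding N_def by (intro power_mono) auto
        also have "\<dots> = 2 ^ (20 * lgn)" by (simp flip: power_mult)
        finally have "real_of_int (int m) \<le> real_of_int (2 ^ (20 * lgn))" using that by linarith
        then show ?thesis by simp
      qed
      have "5 * 5 * (int n + 2) \<le> X" "5 * (int n + 2) * (int n + 2) \<le> X"
        unfolding X_def power3_eq_cube using n5 by (intro mult_mono; simp)+
      moreover have "(int n + 2) * (int n + 2) = int n * int n + 4 * int n + 4"
        by (simp add: algebra_simps)
      moreover have "0 \<le> int n * int n" by simp
      ultimately have X: "12 * int n \<le> X" "int n * int n + int n + 1 \<le> X" "8 \<le> X" "int n \<le> X"
        using n3 unfolding mult.assoc[of 5 "int n + 2" "int n + 2"] by linarith+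
      have XN: "X ^ 3 \<le> N" unfolding X_def N_def power_mult[symmetric] using n5 by (intro power_increasing) auto
      have machine: "conv_machine ?B N cp (20 * C0) lg"
      proof
        show "2 \<le> N" "N ^ 8 \<le> ?B" by (rule N2, rule NB)
        show "svars cp \<subseteq> range (Cons (CHR ''_''))" "avars cp \<subseteq> range (Cons (CHR ''_''))" by (rule cp)+
        show "0 \<le> 20 * C0" "1 \<le> lg" using cp(3) lgn(1) by (simp_all add: lg_def)
      next
        fix m :: nat and xs ys :: "int list" and s :: state and t :: int
        assume a: "2 \<le> m" "int m \<le> N" "length xs = m" "length ys = m" "set xs \<subseteq> {0, 1}" "set ys \<subseteq> {0, 1}"
          "scalar s ''_m'' = int m" "\<forall>i<m. arr s ''_x'' i = xs ! i" "\<forall>i<m. arr s ''_y'' i = ys ! i"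
        have "wp ?B cp (\<lambda>t' s'. t' \<le> t + C0 * (int m * int (20 * lgn)) \<and>
          (\<forall>j<m. arr s' ''_z'' j = acyclic_convolution xs ys j)) t s"
          by (rule conv[OF a(1) NB'[OF a(2)] mlg[OF a(2)] a(3-)])
        then show "wp ?B cp (\<lambda>t' s'. t' \<le> t + 20 * C0 * (int m * lg) \<and>
          (\<forall>j<m. arr s' ''_z'' j = acyclic_convolution xs ys j)) t s"
          by (rule wp_conseq) (simp add: lg_def ac_simps)
      qed
      define key where "key = (\<lambda>x. arr s ''S'' (nat x))"
      let ?s1 = "setv ''count'' 0 s"
      have "wp ?B sort3 (\<lambda>t' s'. t' \<le> 6 + 30 \<and> (\<exists>a' b' c'. scalar s' ''a'' = a' \<and> scalar s' ''b'' = b' \<and>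
        scalar s' ''c'' = c' \<and> a' < b' \<and> b' < c' \<and> {a', b', c'} = {int a, int b, int c})) 6 ?s1"
        using k by (intro wp_sort3) (simp_all add: inp)
      then have "wp ?B sort3 (wp ?B (params;; If (Less (Var ''d'') (Var ''d0'')) Skip (main cp)) ?Q) 6 ?s1"
      proof (rule wp_conseq, goal_cases)
        case (1 t2 s2)
        then obtain a' b' c' where abc: "scalar s2 ''a'' = a'" "scalar s2 ''b'' = b'" "scalar s2 ''c'' = c'"
          "a' < b'" "b' < c'" "{a', b', c'} = {int a, int b, int c}" by blast
        have "a' \<in> {int a, int b, int c}" "c' \<in> {int a, int b, int c}" unfolding abc(6)[symmetric] by simp_all
        then have bounds: "0 \<le> a'" "c' < int k" using k by auto
        interpret conv_machine ?B N cp "20 * C0" lg by (rule machine)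
        interpret cadence_machine ?B N cp "20 * C0" lg "int n" "int k" a' b' c' X
          by unfold_locales (use bounds abc False X XN in auto)
        have s2: "scalar s2 ''n'' = int n" "scalar s2 ''k'' = int k" "scalar s2 ''count'' = 0" "arr s2 ''S'' = arr s ''S''"
          using 1(2) inp by (simp_all add: sort3_def exchange_def same_scalar same_arr)
        have keys: "(\<lambda>x. arr s2 ''S'' (nat x)) = key" by (simp add: key_def s2)
        have card: "card (partial_cadences a b c k S) = card (monochromatic key)"
          using char by (intro card_partial_cadences) (simp_all add: \<Sigma>(3) abc(6) key_def)
        have V: "finite (chars key)" "real (card (chars key)) \<le> real (card \<Sigma>)"
        proof -
          show "finite (chars key)" by (simp add: chars_def)
          have "chars key \<subseteq> \<Sigma>"
          proof
            fix v assume "v \<in> chars key"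
            then obtain x where x: "1 \<le> x" "x \<le> int n" "v = key x" by (auto simp: chars_def)
            then have "nat x \<in> {1..length S}" using \<Sigma>(3) by auto
            then have "v = S ! (nat x - 1)" "nat x - 1 < length S"
              using bspec[OF char, of "nat x"] x(3) by (auto simp: key_def char_at_def)
            then show "v \<in> \<Sigma>" using \<Sigma>(2) by auto
          qed
          then show "real (card (chars key)) \<le> real (card \<Sigma>)" using \<Sigma>(1) by (simp add: card_mono)
        qed
        have occ: "(\<Sum>v\<in>chars key. occ key v) = int n"
        proof -
          have "{1..int n} = (\<Union>v\<in>chars key. {x. 1 \<le> x \<and> x \<le> int n \<and> key x = v})"
            by (auto simp: chars_def)
          then have "card {1..int n} = (\<Sum>v\<in>chars key. card {x. 1 \<le> x \<and> x \<le> int n \<and> key x = v})"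
            using V(1) by (auto intro!: card_UN_disjoint finite_subset[of _ "{1..int n}"])
          then have "int (\<Sum>v\<in>chars key. card {x. 1 \<le> x \<and> x \<le> int n \<and> key x = v}) = int n" by simp
          then show ?thesis by (simp only: occ_def of_nat_sum)
        qed
        have "wp ?B (params;; If (Less (Var ''d'') (Var ''d0'')) Skip (main cp)) (\<lambda>t' s'.
            t' \<le> t2 + 60 + 1200 * (int n * lg) + KK * (\<Sum>v\<in>chars key. min ((occ key v)\<^sup>2) (int n * lg * lg)) \<and>
            scalar s' ''count'' = int (card (monochromatic key))) t2 s2"
          using wp_params_main[of s2 lgn t2] s2 abc lgn X unfolding keys KK_def lg_def by simp
        then show ?case
        proof (rule wp_conseq, goal_cases)
          case (1 t3 s3)
          have "t3 \<le> (2600 + 4 * real_of_int KK) * min (real (card \<Sigma>) * real_of_int (int n) * (log 2 (real_of_int (int n)))\<^sup>2)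
              (real_of_int (int n) powr (3 / 2) * log 2 (real_of_int (int n)))"
          proof (rule time_bound[OF _ _ _ V(1) occ, where t = "real_of_int t3" and lg = lg])
            have "t3 \<le> 200 + 1200 * (int n * lg) + KK * (\<Sum>v\<in>chars key. min ((occ key v)\<^sup>2) (int n * lg * lg))"
              using 1(1) \<open>t2 \<le> 6 + 30 \<and> _\<close> by linarith
            then have "real_of_int t3 \<le> real_of_int (200 + 1200 * (int n * lg) +
                KK * (\<Sum>v\<in>chars key. min ((occ key v)\<^sup>2) (int n * lg * lg)))" by linarith
            then show "real_of_int t3 \<le> real_of_int (200 + 1200 * (int n * lg)) +
                real_of_int KK * real_of_int (\<Sum>v\<in>chars key. min ((occ key v)\<^sup>2) (int n * lg * lg))" by simp
          qed (use n3 lgn V sig KK in \<open>auto simp: lg_def occ_def\<close>)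
          then show ?case using 1(1) card by (simp add: K_def)
        qed
      qed
      then show ?thesis
        unfolding count_cadences_def using False by (simp add: inp)
    qed
  qed
  show ?thesis
  proof (rule exI[of _ "count_cadences cp"], rule exI[of _ w], rule exI[of _ K], intro allI impI)
    fix \<Sigma> :: "int set" and S n k a b c s
    assume "finite \<Sigma> \<and> set S \<subseteq> \<Sigma> \<and> length S = n \<and>
      0 < k \<and> a < k \<and> b < k \<and> c < k \<and> a \<noteq> b \<and> b \<noteq> c \<and> a \<noteq> c \<and> cadence_input S k a b c s"
    then show "\<exists>t s'. exec (word_bound w n) (count_cadences cp) s t s' \<and>
       scalar s' ''count'' = int (card (partial_cadences a b c k S)) \<and>
       (2 \<le> n \<longrightarrow>
          real t \<le> K * min (real (card \<Sigma>) * real n * (log 2 (real n))\<^sup>2)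
                          (real n powr (3 / 2) * log 2 (real n)))"
      using main[of \<Sigma> S n a k b c s] unfolding wp_def by auto
  qed
qed

end
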